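(* Let $\tau\in\mathbb C$ with $\mathrm{Im}(\tau)>0$, let $E=\mathbb C/\langle1,\tau\rangle$ be the corresponding complex torus, and let $0<d<n$ be coprime integers. Then the solution $r_{(E,(n,d))}$ of the classical Yang--Baxter equation attached to $(E,(n,d))$ (see context) is $$r_{(E,(n,d))}(x,y)=\sum_{(k,l)\in I}\exp\Bigl(-\frac{2\pi i d}{n}kz\Bigr)\,\sigma\Bigl(\frac dn(l-k\tau),z\Bigr)\,Z_{k,l}^\vee\otimes Z_{k,l},\qquad z=y-x,$$ where $\sigma$ is the Kronecker elliptic function. Hence $r_{(E,(n,d))}$ is the elliptic $r$-matrix of Belavin.
   Context: **Matrices.** Let $\varepsilon=\exp(2\pi i d/n)$, $X=\mathrm{diag}(1,\varepsilon,\dots,\varepsilon^{n-1})$, and let $Y$ be the $n\times n$ cyclic permutation matrix with $Y_{i,i+1}=1$ for $1\le i\le n-1$, $Y_{n,1}=1$, and all other entries $0$. Let $I=\{(p,q)\in\mathbb Z^2: 0\le p\le n-1,\ 0\le q\le n-1,\ (p,q)\ne(0,0)\}$ and, for $(k,l)\in I$, $Z_{k,l}=Y^kX^{-l}$ and $Z_{k,l}^\vee=\frac1nX^lY^{-k}$. **Kronecker elliptic function.** $\sigma(a,z)=\dfrac{\bar\theta'(0)\,\bar\theta(a+z)}{\bar\theta(a)\,\bar\theta(z)}$, where $\bar\theta(z)=\theta_1(z|\tau)=2q^{1/4}\sum_{m\ge0}(-1)^mq^{m(m+1)}\sin((2m+1)\pi z)$, $q=\exp(\pi i\tau)$. Equivalently,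 it is the meromorphic continuation in $z$ of $2\pi i\sum_{m\in\mathbb Z}\frac{\exp(-2\pi i m z)}{1-\exp(-2\pi i(a-m\tau))}$ from the strip $-\mathrm{Im}\,\tau<\mathrm{Im}\,z<0$. **The solution $r_{(E,(n,d))}$.** Let $\mathcal P$ be a simple vector bundle ($\mathrm{End}(\mathcal P)=\mathbb C$) of rank $n$ and degree $d$ on $E$, and $\mathcal A=\mathrm{Ad}(\mathcal P)$ the sheaf of Lie algebras of its traceless endomorphisms. With $\mathfrak g=\mathfrak{sl}_n(\mathbb C)$ there is an isomorphism of sheaves of Lie algebras between $\mathcal A$ and the sheaf of sections of $\mathbb C\times\mathfrak g/\sim$, where $(z,G)\sim(z+1,XGX^{-1})\sim(z+\tau,YGY^{-1})$. Over a small neighbourhood of $0$ this induces a trivialization of $\mathcal A$, which is the one used here. Put $\omega=dz$. For distinct points $x,y$ near $0$, the map $\mathrm{res}_x:H^0(\mathcal A(x))\to\mathcal A|_x$ (residue at $x$ of $s\,\omega$) is an isomorphism, and $\mathrm{ev}_y:H^0(\mathcal A(x))\to\mathcal A|_y$ is evaluation at $y$. Then $r_{(E,(n,d))}(x,y)\in\mathfrak g\otimes\mathfrak g$ is the tensor corresponding to $\mathrm{ev}_y\circ\mathrm{res}_x^{-1}$, viewed in $\mathrm{End}(\mathfrak g)$ through the trivialization, under the isomorphism $\mathfrak g\otimes\mathfrak g\to\mathrm{End}(\mathfrak g)$, $a\otimes b\mapsto(c\mapsto\mathrm{tr}(ac)b)$. "The elliptic $r$-matrix of Belavin" is the name of the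 function on the right-hand side of the displayed formula. *)

theory Defs
  imports
    "HOL-Complex_Analysis.Complex_Analysis"
    "Jordan_Normal_Form.Determinant"
    "Jordan_Normal_Form.Gauss_Jordan_Elimination"
begin

no_notation fls_nth (infixl \<open>$$\<close> 75)

section \<open>Matrices and tensors\<close>

text \<open>Row and column indices of \<^typ>\<open>complex mat\<close> start at 0.\<close>

definition mtrace :: "complex mat \<Rightarrow> complex" where
  "mtrace A = (\<Sum>i<dim_row A. A $$ (i, i))"

definition minv :: "complex mat \<Rightarrow> complex mat" where
  "minv A = the (mat_inverse A)"

definition sl :: "nat \<Rightarrow> complex mat set" where
  "sl n = {A \<in> carrier_mat n n. mtrace A = 0}"

definition mat_sum :: "nat \<Rightarrow> ('k \<Rightarrow> complex mat) \<Rightarrow> 'k set \<Rightarrow> complex mat" where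
  "mat_sum N F K = mat N N (\<lambda>ij. \<Sum>k\<in>K. F k $$ ij)"

definition mat_holomorphic_on :: "nat \<Rightarrow> (complex \<Rightarrow> complex mat) \<Rightarrow> complex set \<Rightarrow> bool" where
  "mat_holomorphic_on n F S \<longleftrightarrow> (\<forall>i<n. \<forall>j<n. (\<lambda>z. F z $$ (i, j)) holomorphic_on S)"

text \<open>The space of \<open>n\<^sup>2\<close> by \<open>n\<^sup>2\<close> matrices is used as the tensor square of the space
  of \<open>n\<close> by \<open>n\<close> matrices, with the Kronecker product as pure tensor.\<close>

definition tensor :: "nat \<Rightarrow> complex mat \<Rightarrow> complex mat \<Rightarrow> complex mat" where
  "tensor n A B = mat (n * n) (n * n)
     (\<lambda>(r, s). A $$ (r div n, s div n) * B $$ (r mod n, s mod n))"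

definition sl_tensor_sl :: "nat \<Rightarrow> complex mat set" where
  "sl_tensor_sl n = {T. \<exists>m a b. (\<forall>k<m. a k \<in> sl n \<and> b k \<in> sl n) \<and>
     T = mat_sum (n * n) (\<lambda>k. tensor n (a k) (b k)) {..<(m::nat)}}"

text \<open>The linear extension of \<open>a \<otimes> b \<mapsto> (c \<mapsto> tr (a c) b)\<close>, cf. \<open>tensor_to_End_tensor\<close>.\<close>

definition tensor_to_End :: "nat \<Rightarrow> complex mat \<Rightarrow> complex mat \<Rightarrow> complex mat" where
  "tensor_to_End n T c = mat n n
     (\<lambda>(p, q). \<Sum>i<n. \<Sum>j<n. T $$ (i * n + p, j * n + q) * c $$ (j, i))"

lemma tensor_to_End_tensor:
  assumes "a \<in> carrier_mat n n" "b \<in> carrier_mat n n" "c \<in> carrier_mat n n"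
  shows "tensor_to_End n (tensor n a b) c = mtrace (a * c) \<cdot>\<^sub>m b"
proof (rule eq_matI)
  fix p q assume "p < dim_row (mtrace (a * c) \<cdot>\<^sub>m b)" "q < dim_col (mtrace (a * c) \<cdot>\<^sub>m b)"
  then have p: "p < n" and q: "q < n" using assms by auto
  have less: "i * n + p' < n * n" if "i < n" "p' < n" for i p'
  proof -
    have "i * n + p' < (i + 1) * n" using that by simp
    also have "\<dots> \<le> n * n" using that by (intro mult_right_mono) auto
    finally show ?thesis .
  qed
  have "tensor_to_End n (tensor n a b) c $$ (p, q) =
      (\<Sum>i<n. \<Sum>j<n. (a $$ (i, j) * b $$ (p, q)) * c $$ (j, i))"
    unfolding tensor_to_End_def using p q less
    by (auto simp: tensor_def intro!: sum.cong)
  also have "\<dots> = (\<Sum>i<n. \<Sum>j<n. a $$ (i, j) * c $$ (j, i)) * b $$ (p, q)"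
    by (simp add: sum_distrib_left sum_distrib_right mult_ac)
  also have "(\<Sum>i<n. \<Sum>j<n. a $$ (i, j) * c $$ (j, i)) = mtrace (a * c)"
    unfolding mtrace_def using assms
    by (auto simp: scalar_prod_def atLeast0LessThan intro!: sum.cong)
  finally show "tensor_to_End n (tensor n a b) c $$ (p, q) = (mtrace (a * c) \<cdot>\<^sub>m b) $$ (p, q)"
    using p q assms by simp
qed (use assms in \<open>auto simp: tensor_to_End_def\<close>)

section \<open>The matrices \<open>X\<close>, \<open>Y\<close>, \<open>Z\<close>\<close>

definition eps :: "nat \<Rightarrow> nat \<Rightarrow> complex" where
  "eps n d = exp (2 * of_real pi * \<i> * of_nat d / of_nat n)"

definition X_mat :: "nat \<Rightarrow> nat \<Rightarrow> complex mat" where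
  "X_mat n d = mat n n (\<lambda>(i, j). if i = j then eps n d ^ i else 0)"

definition Y_mat :: "nat \<Rightarrow> complex mat" where
  "Y_mat n = mat n n (\<lambda>(i, j). if j = (i + 1) mod n then 1 else 0)"

definition I_set :: "nat \<Rightarrow> (nat \<times> nat) set" where
  "I_set n = {..n - 1} \<times> {..n - 1} - {(0, 0)}"

definition Z_mat :: "nat \<Rightarrow> nat \<Rightarrow> nat \<Rightarrow> nat \<Rightarrow> complex mat" where
  "Z_mat n d k l = (Y_mat n ^\<^sub>m k) * (minv (X_mat n d) ^\<^sub>m l)"

definition Z_dual :: "nat \<Rightarrow> nat \<Rightarrow> nat \<Rightarrow> nat \<Rightarrow> complex mat" where
  "Z_dual n d k l = (1 / of_nat n) \<cdot>\<^sub>m ((X_mat n d ^\<^sub>m l) * (minv (Y_mat n) ^\<^sub>m k))"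

section \<open>The Kronecker elliptic function\<close>

definition theta1 :: "complex \<Rightarrow> complex \<Rightarrow> complex" where
  "theta1 \<tau> z = 2 * exp (of_real pi * \<i> * \<tau> / 4) *
     (\<Sum>m. (-1) ^ m * exp (of_real pi * \<i> * \<tau>) ^ (m * (m + 1)) *
        sin (of_nat (2 * m + 1) * of_real pi * z))"

definition kronecker_sigma :: "complex \<Rightarrow> complex \<Rightarrow> complex \<Rightarrow> complex" where
  "kronecker_sigma \<tau> a z =
     deriv (theta1 \<tau>) 0 * theta1 \<tau> (a + z) / (theta1 \<tau> a * theta1 \<tau> z)"

definition belavin_r_matrix ::
    "complex \<Rightarrow> nat \<Rightarrow> nat \<Rightarrow> complex \<Rightarrow> complex \<Rightarrow> complex mat" where
  "belavin_r_matrix \<tau> n d x y = mat_sum (n * n)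
     (\<lambda>(k, l). (exp (- (2 * of_real pi * \<i> * of_nat d / of_nat n) * of_nat k * (y - x)) *
         kronecker_sigma \<tau> (of_nat d / of_nat n * (of_nat l - of_nat k * \<tau>)) (y - x))
       \<cdot>\<^sub>m tensor n (Z_dual n d k l) (Z_mat n d k l))
     (I_set n)"

section \<open>The complex torus\<close>

text \<open>Points of the torus are cosets of the lattice; its topology and its complex structure
  are those of the quotient by the projection \<open>tproj \<tau>\<close>.\<close>

type_synonym tpoint = "complex set"

definition tproj :: "complex \<Rightarrow> complex \<Rightarrow> tpoint" where
  "tproj \<tau> z = {z + of_int a + of_int b * \<tau> | a b. True}"

definition torus :: "complex \<Rightarrow> tpoint set" where
  "torus \<tau> = range (tproj \<tau>)"

definition torus_open :: "complex \<Rightarrow> tpoint set \<Rightarrow> bool" where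
  "torus_open \<tau> U \<longleftrightarrow> U \<subseteq> torus \<tau> \<and> open (tproj \<tau> -` U)"

definition torus_holomorphic_on :: "complex \<Rightarrow> (tpoint \<Rightarrow> complex) \<Rightarrow> tpoint set \<Rightarrow> bool" where
  "torus_holomorphic_on \<tau> f U \<longleftrightarrow> (\<lambda>z. f (tproj \<tau> z)) holomorphic_on (tproj \<tau> -` U)"

section \<open>Holomorphic vector bundles on the torus\<close>

text \<open>A bundle is given by an open cover and a holomorphic cocycle; a section \<open>s\<close> is a
  family of local representatives \<open>s\<^sub>i\<close> with \<open>s\<^sub>i = g\<^sub>i\<^sub>j s\<^sub>j\<close>, where \<open>g\<^sub>i\<^sub>j\<close> is \<open>transition P i j\<close>.\<close>

record 'i vbundle =
  chart :: "'i \<Rightarrow> tpoint set"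
  transition :: "'i \<Rightarrow> 'i \<Rightarrow> tpoint \<Rightarrow> complex mat"

definition vector_bundle :: "complex \<Rightarrow> nat \<Rightarrow> 'i vbundle \<Rightarrow> bool" where
  "vector_bundle \<tau> n P \<longleftrightarrow>
     (\<forall>i. torus_open \<tau> (chart P i)) \<and>
     (\<Union>i. chart P i) = torus \<tau> \<and>
     (\<forall>i j. \<forall>p \<in> chart P i \<inter> chart P j.
        transition P i j p \<in> carrier_mat n n \<and> invertible_mat (transition P i j p)) \<and>
     (\<forall>i j. mat_holomorphic_on n (\<lambda>z. transition P i j (tproj \<tau> z))
        (tproj \<tau> -` (chart P i \<inter> chart P j))) \<and>
     (\<forall>i j k. \<forall>p \<in> chart P i \<inter> chart P j \<inter> chart P k.
        transition P i j p * transition P j k p = transition P i k p)"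

text \<open>The degree is that of the determinant line bundle, i.e.\ the number of zeros minus the
  number of poles of any of its nonzero meromorphic sections. Equality of meromorphic
  functions is equality near, but not necessarily at, every point, since the value of a
  HOL function at a pole is arbitrary.\<close>

definition det_meromorphic_section :: "complex \<Rightarrow> 'i vbundle \<Rightarrow> ('i \<Rightarrow> tpoint \<Rightarrow> complex) \<Rightarrow> bool" where
  "det_meromorphic_section \<tau> P f \<longleftrightarrow>
     (\<forall>i. (\<lambda>z. f i (tproj \<tau> z)) meromorphic_on (tproj \<tau> -` chart P i)) \<and>
     (\<forall>i j z. tproj \<tau> z \<in> chart P i \<inter> chart P j \<longrightarrow>
        (\<forall>\<^sub>F w in at z. f i (tproj \<tau> w) = det (transition P i j (tproj \<tau> w)) * f j (tproj \<tau> w)))"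

definition nonzero_section :: "complex \<Rightarrow> 'i vbundle \<Rightarrow> ('i \<Rightarrow> tpoint \<Rightarrow> complex) \<Rightarrow> bool" where
  "nonzero_section \<tau> P f \<longleftrightarrow>
     (\<forall>i z. tproj \<tau> z \<in> chart P i \<longrightarrow> (\<forall>\<^sub>F w in at z. f i (tproj \<tau> w) \<noteq> 0))"

definition section_order ::
    "complex \<Rightarrow> 'i vbundle \<Rightarrow> ('i \<Rightarrow> tpoint \<Rightarrow> complex) \<Rightarrow> tpoint \<Rightarrow> int" where
  "section_order \<tau> P f p = (THE k. \<exists>i z. p \<in> chart P i \<and> tproj \<tau> z = p \<and>
     k = zorder (\<lambda>w. f i (tproj \<tau> w)) z)"

definition bundle_degree :: "complex \<Rightarrow> 'i vbundle \<Rightarrow> int" where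
  "bundle_degree \<tau> P = (THE m. \<exists>f. det_meromorphic_section \<tau> P f \<and> nonzero_section \<tau> P f \<and>
     m = (\<Sum>p | p \<in> torus \<tau> \<and> section_order \<tau> P f p \<noteq> 0. section_order \<tau> P f p))"

text \<open>Sections over \<open>U\<close> are extended by the zero matrix, so that equality of sections is
  equality of functions.\<close>

definition end_sections ::
    "complex \<Rightarrow> nat \<Rightarrow> 'i vbundle \<Rightarrow> tpoint set \<Rightarrow> ('i \<Rightarrow> tpoint \<Rightarrow> complex mat) set" where
  "end_sections \<tau> n P U = {s.
     (\<forall>i p. if p \<in> U \<inter> chart P i then s i p \<in> carrier_mat n n else s i p = 0\<^sub>m n n) \<and>
     (\<forall>i. mat_holomorphic_on n (\<lambda>z. s i (tproj \<tau> z)) (tproj \<tau> -` (U \<inter> chart P i))) \<and>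
     (\<forall>i j. \<forall>p \<in> U \<inter> chart P i \<inter> chart P j. s i p * transition P i j p = transition P i j p * s j p)}"

definition simple_bundle :: "complex \<Rightarrow> nat \<Rightarrow> 'i vbundle \<Rightarrow> bool" where
  "simple_bundle \<tau> n P \<longleftrightarrow>
     (\<forall>s \<in> end_sections \<tau> n P (torus \<tau>). \<exists>c. \<forall>i. \<forall>p \<in> chart P i. s i p = c \<cdot>\<^sub>m 1\<^sub>m n)"

section \<open>Sheaves of Lie algebras\<close>

record 's lie_sheaf =
  sections :: "tpoint set \<Rightarrow> 's set"
  restriction :: "tpoint set \<Rightarrow> 's \<Rightarrow> 's"
  add_sec :: "'s \<Rightarrow> 's \<Rightarrow> 's"
  smult_sec :: "(tpoint \<Rightarrow> complex) \<Rightarrow> 's \<Rightarrow> 's"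
  bracket :: "'s \<Rightarrow> 's \<Rightarrow> 's"

definition lie_sheaf_iso ::
    "complex \<Rightarrow> 's lie_sheaf \<Rightarrow> 't lie_sheaf \<Rightarrow> (tpoint set \<Rightarrow> 's \<Rightarrow> 't) \<Rightarrow> bool" where
  "lie_sheaf_iso \<tau> A B \<phi> \<longleftrightarrow> (\<forall>U. torus_open \<tau> U \<longrightarrow>
     bij_betw (\<phi> U) (sections A U) (sections B U) \<and>
     (\<forall>s \<in> sections A U. \<forall>t \<in> sections A U.
        \<phi> U (add_sec A s t) = add_sec B (\<phi> U s) (\<phi> U t) \<and>
        \<phi> U (bracket A s t) = bracket B (\<phi> U s) (\<phi> U t)) \<and>
     (\<forall>f s. torus_holomorphic_on \<tau> f U \<longrightarrow> s \<in> sections A U \<longrightarrow>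
        \<phi> U (smult_sec A f s) = smult_sec B f (\<phi> U s)) \<and>
     (\<forall>V s. torus_open \<tau> V \<longrightarrow> V \<subseteq> U \<longrightarrow> s \<in> sections A U \<longrightarrow>
        \<phi> V (restriction A V s) = restriction B V (\<phi> U s)))"

definition Ad_sheaf ::
    "complex \<Rightarrow> nat \<Rightarrow> 'i vbundle \<Rightarrow> ('i \<Rightarrow> tpoint \<Rightarrow> complex mat) lie_sheaf" where
  "Ad_sheaf \<tau> n P = \<lparr>
     sections = (\<lambda>U. {s \<in> end_sections \<tau> n P U. \<forall>i p. mtrace (s i p) = 0}),
     restriction = (\<lambda>V s i p. if p \<in> V then s i p else 0\<^sub>m n n),
     add_sec = (\<lambda>s t i p. s i p + t i p),
     smult_sec = (\<lambda>f s i p. f p \<cdot>\<^sub>m s i p),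
     bracket = (\<lambda>s t i p. s i p * t i p - t i p * s i p)\<rparr>"

text \<open>The sheaf of sections of the quotient of \<open>\<complex> \<times> sl\<^sub>n\<close> by
  \<open>(z, G) \<sim> (z + 1, X G X\<^sup>-\<^sup>1) \<sim> (z + \<tau>, Y G Y\<^sup>-\<^sup>1)\<close>. A function \<open>F\<close> below stands for the section
  \<open>tproj \<tau> z \<mapsto> [(z, F z)]\<close>; the two equations say that this is well defined.\<close>

definition quotient_sheaf :: "complex \<Rightarrow> nat \<Rightarrow> nat \<Rightarrow> (complex \<Rightarrow> complex mat) lie_sheaf" where
  "quotient_sheaf \<tau> n d = \<lparr>
     sections = (\<lambda>U. {F.
       (\<forall>z. if tproj \<tau> z \<in> U then F z \<in> sl n else F z = 0\<^sub>m n n) \<and>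
       mat_holomorphic_on n F (tproj \<tau> -` U) \<and>
       (\<forall>z. tproj \<tau> z \<in> U \<longrightarrow>
          F (z + 1) = X_mat n d * F z * minv (X_mat n d) \<and>
          F (z + \<tau>) = Y_mat n * F z * minv (Y_mat n))}),
     restriction = (\<lambda>V F z. if tproj \<tau> z \<in> V then F z else 0\<^sub>m n n),
     add_sec = (\<lambda>F G z. F z + G z),
     smult_sec = (\<lambda>f F z. f (tproj \<tau> z) \<cdot>\<^sub>m F z),
     bracket = (\<lambda>F G z. F z * G z - G z * F z)\<rparr>"

section \<open>Residue, evaluation and the tensor \<open>r\<close>\<close>

definition Ad_fibre :: "nat \<Rightarrow> 'i vbundle \<Rightarrow> tpoint \<Rightarrow> ('i \<Rightarrow> complex mat) set" where
  "Ad_fibre n P p = {v.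
     (\<forall>i. if p \<in> chart P i then v i \<in> sl n else v i = 0\<^sub>m n n) \<and>
     (\<forall>i j. p \<in> chart P i \<inter> chart P j \<longrightarrow> v i * transition P i j p = transition P i j p * v j)}"

text \<open>From here on points of the torus are represented by complex numbers \<open>x\<close>.\<close>

definition at_most_simple_pole :: "(complex \<Rightarrow> complex) \<Rightarrow> complex \<Rightarrow> bool" where
  "at_most_simple_pole f x \<longleftrightarrow>
     (\<exists>h. h analytic_on {x} \<and> (\<forall>\<^sub>F z in at x. f z = h z / (z - x)))"

text \<open>The space of global sections of \<open>\<A>(x)\<close>.\<close>

definition H0_Ad ::
    "complex \<Rightarrow> nat \<Rightarrow> 'i vbundle \<Rightarrow> complex \<Rightarrow> ('i \<Rightarrow> tpoint \<Rightarrow> complex mat) set" where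
  "H0_Ad \<tau> n P x = {s \<in> sections (Ad_sheaf \<tau> n P) (torus \<tau> - {tproj \<tau> x}).
     \<forall>i. tproj \<tau> x \<in> chart P i \<longrightarrow>
       (\<forall>a<n. \<forall>b<n. at_most_simple_pole (\<lambda>z. s i (tproj \<tau> z) $$ (a, b)) x)}"

definition res_map ::
    "complex \<Rightarrow> nat \<Rightarrow> 'i vbundle \<Rightarrow> complex \<Rightarrow> ('i \<Rightarrow> tpoint \<Rightarrow> complex mat) \<Rightarrow> 'i \<Rightarrow> complex mat"
where
  "res_map \<tau> n P x s = (\<lambda>i. if tproj \<tau> x \<in> chart P i
     then mat n n (\<lambda>(a, b). residue (\<lambda>z. s i (tproj \<tau> z) $$ (a, b)) x) else 0\<^sub>m n n)"

definition ev_map ::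
    "complex \<Rightarrow> complex \<Rightarrow> ('i \<Rightarrow> tpoint \<Rightarrow> complex mat) \<Rightarrow> 'i \<Rightarrow> complex mat" where
  "ev_map \<tau> y s = (\<lambda>i. s i (tproj \<tau> y))"

text \<open>The map from the fibre at \<open>x\<close> to \<open>sl\<^sub>n\<close> induced by an isomorphism \<open>\<phi>\<close> to
  \<open>quotient_sheaf\<close>: extend a vector to a local section \<open>s\<close> and evaluate \<open>\<phi> s\<close> at \<open>x\<close>. For \<open>x\<close> in
  an open set of complex numbers on which \<open>tproj \<tau>\<close> is injective this is a trivialization of
  the sheaf over the image of that set.\<close>

definition trivialization ::
    "complex \<Rightarrow> nat \<Rightarrow> 'i vbundle \<Rightarrow>
     (tpoint set \<Rightarrow> ('i \<Rightarrow> tpoint \<Rightarrow> complex mat) \<Rightarrow> complex \<Rightarrow> complex mat) \<Rightarrow>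
     complex \<Rightarrow> ('i \<Rightarrow> complex mat) \<Rightarrow> complex mat" where
  "trivialization \<tau> n P \<phi> x v = (THE G. \<exists>U s. torus_open \<tau> U \<and> tproj \<tau> x \<in> U \<and>
     s \<in> sections (Ad_sheaf \<tau> n P) U \<and> ev_map \<tau> x s = v \<and> G = \<phi> U s x)"

definition res_inverse ::
    "complex \<Rightarrow> nat \<Rightarrow> 'i vbundle \<Rightarrow> complex \<Rightarrow> ('i \<Rightarrow> complex mat) \<Rightarrow> 'i \<Rightarrow> tpoint \<Rightarrow> complex mat"
where
  "res_inverse \<tau> n P x = inv_into (H0_Ad \<tau> n P x) (res_map \<tau> n P x)"

definition r_endo ::
    "complex \<Rightarrow> nat \<Rightarrow> 'i vbundle \<Rightarrow>
     (tpoint set \<Rightarrow> ('i \<Rightarrow> tpoint \<Rightarrow> complex mat) \<Rightarrow> complex \<Rightarrow> complex mat) \<Rightarrow>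
     complex \<Rightarrow> complex \<Rightarrow> complex mat \<Rightarrow> complex mat" where
  "r_endo \<tau> n P \<phi> x y c =
     trivialization \<tau> n P \<phi> y (ev_map \<tau> y (res_inverse \<tau> n P x
       (inv_into (Ad_fibre n P (tproj \<tau> x)) (trivialization \<tau> n P \<phi> x) c)))"

definition r_matrix ::
    "complex \<Rightarrow> nat \<Rightarrow> 'i vbundle \<Rightarrow>
     (tpoint set \<Rightarrow> ('i \<Rightarrow> tpoint \<Rightarrow> complex mat) \<Rightarrow> complex \<Rightarrow> complex mat) \<Rightarrow>
     complex \<Rightarrow> complex \<Rightarrow> complex mat" where
  "r_matrix \<tau> n P \<phi> x y = (THE T. T \<in> sl_tensor_sl n \<and>
     (\<forall>c \<in> sl n. tensor_to_End n T c = r_endo \<tau> n P \<phi> x y c))"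

end

theory Submission
  imports Defs
begin

text \<open>A function \<open>F\<close> with \<open>F (z + 1) = X F(z) X\<^sup>-\<^sup>1\<close> and
  \<open>F (z + \<tau>) = Y F(z) Y\<^sup>-\<^sup>1\<close>, with traceless values and with at
  most simple poles, all at the translates of \<open>x\<close>, is determined by its residue
  at \<open>x\<close>: the difference of two such functions with the same residue is entire,
  its entries are bounded since conjugation by \<open>X\<close> and \<open>Y\<close> only
  permutes them and multiplies them by roots of unity, so it is a constant matrix commuting
  with \<open>X\<close> and \<open>Y\<close>, hence a scalar of trace zero
  (\<open>twisted_global_zero\<close>, \<open>twisted_residue_unique\<close>). So
  \<open>ev\<^sub>y \<circ> res\<^sub>x\<^sup>-\<^sup>1\<close> is known as soon as one writes
  down, for every traceless \<open>c\<close>, one function of this kind with residue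
  \<open>c\<close>.

  That function is the kernel of Belavin. The matrices \<open>Z\<^sub>k\<^sub>l\<close> are
  eigenvectors of conjugation by \<open>X\<close> and \<open>Y\<close>, and the scalar
  function multiplying \<open>Z\<^sub>k\<^sub>l\<close> has exactly the matching quasi-periods
  and residue 1 at 0 (\<open>belavin_coeff_plus_1\<close>,
  \<open>belavin_coeff_plus_tau\<close>, \<open>belavin_coeff_simple_pole\<close>). Since
  \<open>c\<close> is the sum of the \<open>tr (Z\<^sup>\<or>\<^sub>k\<^sub>l c)
  Z\<^sub>k\<^sub>l\<close> (\<open>Z_completeness\<close>), taking these traces as weights
  gives residue \<open>c\<close> (\<open>kernel_residue\<close>), and the tensor with this
  endomorphism is the one claimed. Here one needs that the theta function vanishes on the
  lattice only and to first order at 0 (\<open>theta1_eq_0_iff\<close>,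
  \<open>deriv_theta1_0\<close>). To see this, a product \<open>P\<close> of a sine and two
  Euler functions, which has precisely these zeros by construction, is shown to have the
  quasi-periods of the theta function; the quotient is then entire and doubly periodic, hence
  constant, and the constant is not 0.

  It remains to transport residue and evaluation through the given isomorphism
  \<open>\<phi>\<close> of sheaves of Lie algebras, which is linear over holomorphic functions
  and compatible with restriction. Let \<open>f\<close> be a local coordinate at
  \<open>x\<close>. On both sides, a section vanishes at \<open>x\<close> iff it is
  \<open>f\<close> times a section (\<open>Ad_divide\<close>, \<open>twisted_divide\<close>),
  so \<open>\<phi>\<close> induces an injective map on fibres
  (\<open>phi_value_eq_iff\<close>); and the residue of \<open>s\<close> at a simple pole is
  the value at \<open>x\<close> of the regular section \<open>f s\<close>, which
  \<open>\<phi>\<close> sends to \<open>f \<phi>(s)\<close> (\<open>phi_product_iff\<close>).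
  Hence \<open>\<phi>\<close> matches residues with residues and values with values, and
  \<open>r_endo_eq_kernel\<close> follows.\<close>

section \<open>Power series with coefficient ratios tending to zero\<close>

text \<open>The two power series that build up the theta function and its zeros are given by
  their coefficient ratios; ratios tending to zero make them entire.\<close>

lemma summable_if_ratio_tendsto_0:
  fixes b r :: "nat \<Rightarrow> complex"
  assumes b: "\<And>m. b (Suc m) = r m * b m" and r: "r \<longlonglongrightarrow> 0"
  shows "summable (\<lambda>m. b m * z ^ m)"
proof -
  have "(\<lambda>m. r m * z) \<longlonglongrightarrow> 0" using tendsto_mult_right[OF r, of z] by simp
  then have "\<forall>\<^sub>F m in sequentially. norm (r m * z) < 1/2"
    by (intro order_tendstoD(2)[OF tendsto_norm_zero]) auto
  then obtain N where N: "\<And>m. m \<ge> N \<Longrightarrow> norm (r m * z) < 1/2"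
    by (auto simp: eventually_sequentially)
  show ?thesis
  proof (rule summable_ratio_test[of "1/2" N])
    fix m assume "N \<le> m"
    have "b (Suc m) * z ^ Suc m = (r m * z) * (b m * z ^ m)" by (simp add: b)
    then have "norm (b (Suc m) * z ^ Suc m) = norm (r m * z) * norm (b m * z ^ m)"
      by (simp only: norm_mult)
    also have "\<dots> \<le> 1/2 * norm (b m * z ^ m)"
      using N[OF \<open>N \<le> m\<close>] by (intro mult_right_mono) auto
    finally show "norm (b (Suc m) * z ^ Suc m) \<le> 1/2 * norm (b m * z ^ m)" .
  qed simp
qed

lemma holomorphic_if_ratio_tendsto_0:
  fixes b r :: "nat \<Rightarrow> complex"
  assumes b: "\<And>m. b (Suc m) = r m * b m" and r: "r \<longlonglongrightarrow> 0"
  shows "(\<lambda>z. \<Sum>m. b m * z ^ m) holomorphic_on A"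
  using termdiffs_strong_converges_everywhere[OF summable_if_ratio_tendsto_0[OF b r]]
  by (meson field_differentiable_at_within field_differentiable_def holomorphic_on_def)

section \<open>The theta function as a difference of power series\<close>

text \<open>The sum of the terms of the theta series with nonnegative index: up to a constant
  factor, the theta function is \<open>u h(u\<^sup>2) - u\<^sup>-\<^sup>1
  h(u\<^sup>-\<^sup>2)\<close> with \<open>h = half_theta q\<close> and \<open>u =
  e\<^sup>\<pi>\<^sup>i\<^sup>z\<close> (\<open>theta1_exp_pi\<close>). Being a power series, it
  is easier to handle than a sum over all integers.\<close>

definition half_theta :: "complex \<Rightarrow> complex \<Rightarrow> complex" where
  "half_theta q v = (\<Sum>m. (-1) ^ m * q ^ (m * (m + 1)) * v ^ m)"

lemma power_Suc_tendsto_0: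
  fixes p :: complex assumes "norm p < 1" shows "(\<lambda>m. p ^ Suc m) \<longlonglongrightarrow> 0"
  using LIMSEQ_power_zero[OF assms] LIMSEQ_Suc by blast

lemma half_theta_ratio:
  "(-1) ^ Suc m * q ^ (Suc m * (Suc m + 1)) = - ((q\<^sup>2) ^ Suc m) * ((-1) ^ m * q ^ (m * (m + 1)))"
  for q :: complex
proof -
  have "Suc m * (Suc m + 1) = 2 * Suc m + m * (m + 1)" by simp
  then show ?thesis by (simp only: power_add power_mult) simp
qed

lemma norm_square_less_1: "norm q < 1 \<Longrightarrow> norm (q\<^sup>2) < 1" for q :: complex
  by (simp add: norm_power power_less_one_iff abs_square_less_1)

lemma half_theta_tendsto: "norm q < 1 \<Longrightarrow> (\<lambda>m. - ((q\<^sup>2) ^ Suc m)) \<longlonglongrightarrow> 0" for q :: complex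
  using tendsto_minus[OF power_Suc_tendsto_0[OF norm_square_less_1]] by simp

lemma half_theta_summable:
  "norm q < 1 \<Longrightarrow> summable (\<lambda>m. (-1) ^ m * q ^ (m * (m + 1)) * v ^ m)" for q v :: complex
  by (rule summable_if_ratio_tendsto_0[OF half_theta_ratio half_theta_tendsto])

lemma half_theta_sums:
  "norm q < 1 \<Longrightarrow> (\<lambda>m. (-1) ^ m * q ^ (m * (m + 1)) * v ^ m) sums half_theta q v" for q v :: complex
  unfolding half_theta_def by (intro summable_sums half_theta_summable)

lemma half_theta_holomorphic: "norm q < 1 \<Longrightarrow> half_theta q holomorphic_on A"
  unfolding half_theta_def
  by (rule holomorphic_if_ratio_tendsto_0[OF half_theta_ratio half_theta_tendsto])

lemma half_theta_0: "half_theta q 0 = 1"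
  unfolding half_theta_def using powser_zero[of "\<lambda>m. (-1) ^ m * q ^ (m * (m + 1))"] by simp

text \<open>Splitting off the constant term shifts the index, and \<open>(m + 1)(m + 2) = m (m +
  1) + 2 (m + 1)\<close> absorbs the shift into the argument. This is the source of the
  quasi-periodicity of the theta function in the direction \<open>\<tau>\<close>.\<close>

lemma half_theta_functional_equation:
  assumes q: "norm q < 1"
  shows "half_theta q v = 1 - q\<^sup>2 * v * half_theta q (q\<^sup>2 * v)"
proof -
  let ?f = "\<lambda>v m. (-1) ^ m * q ^ (m * (m + 1)) * v ^ m"
  have "?f v (Suc m) = - (q\<^sup>2 * v) * ?f (q\<^sup>2 * v) m" for m
    unfolding half_theta_ratio by (simp add: power_mult_distrib algebra_simps)
  then have "(\<lambda>m. ?f v (Suc m)) sums (- (q\<^sup>2 * v) * half_theta q (q\<^sup>2 * v))"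
    by (simp only:) (rule sums_mult[OF half_theta_sums[OF q]])
  moreover have "(\<lambda>m. ?f v (Suc m)) sums (half_theta q v - ?f v 0)"
    using half_theta_sums[OF q] by (subst sums_Suc_iff) simp
  ultimately have "- (q\<^sup>2 * v) * half_theta q (q\<^sup>2 * v) = half_theta q v - ?f v 0"
    by (rule sums_unique2)
  then show ?thesis by (simp add: algebra_simps eq_diff_eq)
qed

text \<open>If \<open>v h(v) = h(1/v)\<close> held for all \<open>v \<noteq> 0\<close>, the
  entire function \<open>v h(v)\<close> would tend to \<open>h(0) = 1\<close> at infinity and be
  constant by Liouville's theorem, although it vanishes at 0. So the theta function is not
  identically zero (\<open>theta1_nonzero\<close>).\<close>

lemma half_theta_not_symmetric:
  assumes q: "norm q < 1"
  shows "\<exists>v. v \<noteq> 0 \<and> v * half_theta q v \<noteq> half_theta q (1 / v)"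
proof (rule ccontr)
  assume "\<not> ?thesis"
  then have sym: "v * half_theta q v = half_theta q (inverse v)" if "v \<noteq> 0" for v
    using that by (auto simp: divide_inverse)
  have "isCont (half_theta q) 0"
    using holomorphic_on_imp_continuous_on[OF half_theta_holomorphic[OF q, of UNIV]]
    by (simp add: continuous_on_eq_continuous_at)
  then have "(half_theta q \<longlongrightarrow> 1) (at 0)" by (simp add: isCont_def half_theta_0)
  then have "((\<lambda>v. half_theta q (inverse v)) \<longlongrightarrow> 1) at_infinity"
    using filterlim_filtermap[of "half_theta q" "nhds 1" inverse at_infinity]
    by (simp add: at_to_infinity)
  then have lim: "((\<lambda>v. v * half_theta q v) \<longlongrightarrow> 1) at_infinity"
    by (rule Lim_transform_eventually)
       (rule eventually_mono[OF eventually_not_equal_at_infinity[of 0]], rule sym[symmetric])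
  have "(\<lambda>v. v * half_theta q v) holomorphic_on UNIV"
    by (intro holomorphic_intros half_theta_holomorphic q)
  from Liouville_weak[OF this lim, of 0] show False by simp
qed

definition exp_pi :: "complex \<Rightarrow> complex" where "exp_pi z = exp (of_real pi * \<i> * z)"

lemma exp_pi_add: "exp_pi (z + w) = exp_pi z * exp_pi w" by (simp add: exp_pi_def exp_add algebra_simps)
lemma exp_pi_minus: "exp_pi (- z) = inverse (exp_pi z)" by (simp add: exp_pi_def exp_minus)
lemma exp_pi_nz [simp]: "exp_pi z \<noteq> 0" by (simp add: exp_pi_def)
lemma exp_pi_1 [simp]: "exp_pi 1 = -1" by (simp add: exp_pi_def)
lemma exp_pi_0 [simp]: "exp_pi 0 = 1" by (simp add: exp_pi_def)
lemma norm_exp_pi_less_1: "Im \<tau> > 0 \<Longrightarrow> norm (exp_pi \<tau>) < 1"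
  by (simp add: exp_pi_def)

lemma sin_exp_pi: "sin (of_real pi * z) = (exp_pi z - inverse (exp_pi z)) / (2 * \<i>)"
  by (simp add: sin_exp_eq exp_pi_def exp_minus mult_ac)

lemma theta1_exp_pi:
  assumes "Im \<tau> > 0"
  shows "theta1 \<tau> z = - \<i> * exp (of_real pi * \<i> * \<tau> / 4) *
    (exp_pi z * half_theta (exp_pi \<tau>) (exp_pi z ^ 2) - inverse (exp_pi z) * half_theta (exp_pi \<tau>) (inverse (exp_pi z ^ 2)))"
proof -
  let ?c = "\<lambda>m. (-1) ^ m * exp_pi \<tau> ^ (m * (m + 1))"
  have e: "exp_pi (of_nat (2 * m + 1) * z) = exp_pi z * (exp_pi z ^ 2) ^ m" for m z
    by (simp add: exp_pi_def exp_of_nat_mult[symmetric] exp_add[symmetric] algebra_simps)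
  have "(-1) ^ m * exp_pi \<tau> ^ (m * (m + 1)) * sin (of_nat (2 * m + 1) * of_real pi * z) =
     (exp_pi z / (2 * \<i>)) * (?c m * (exp_pi z ^ 2) ^ m) - (inverse (exp_pi z) / (2 * \<i>)) * (?c m * (inverse (exp_pi z ^ 2)) ^ m)" for m
  proof -
    have "sin (of_nat (2 * m + 1) * of_real pi * z) = sin (of_real pi * (of_nat (2 * m + 1) * z))"
      by (simp add: mult_ac)
    also have "\<dots> = (exp_pi z * (exp_pi z ^ 2) ^ m - inverse (exp_pi z) * inverse (exp_pi z ^ 2) ^ m) / (2 * \<i>)"
      unfolding sin_exp_pi e by (simp add: power_inverse)
    finally show ?thesis by (simp only:) (simp add: field_simps)
  qed
  then have "(\<lambda>m. (-1) ^ m * exp_pi \<tau> ^ (m * (m + 1)) * sin (of_nat (2 * m + 1) * of_real pi * z)) sums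
      ((exp_pi z / (2 * \<i>)) * half_theta (exp_pi \<tau>) (exp_pi z ^ 2)
      - (inverse (exp_pi z) / (2 * \<i>)) * half_theta (exp_pi \<tau>) (inverse (exp_pi z ^ 2)))"
    by (simp only:) (intro sums_diff sums_mult half_theta_sums norm_exp_pi_less_1 assms)
  from sums_unique[OF this, symmetric] show ?thesis
    unfolding theta1_def exp_pi_def[of \<tau>, symmetric]
    by (simp only:) (simp add: field_simps)
qed

lemma theta1_holomorphic: "Im \<tau> > 0 \<Longrightarrow> theta1 \<tau> holomorphic_on A"
proof -
  assume t: "Im \<tau> > 0"
  have h: "(\<lambda>z. half_theta (exp_pi \<tau>) (g z)) holomorphic_on A" if "g holomorphic_on A" for g
    using holomorphic_on_compose[OF that half_theta_holomorphic[OF norm_exp_pi_less_1[OF t]]] by (simp add: o_def)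
  have "(\<lambda>z. - \<i> * exp (of_real pi * \<i> * \<tau> / 4) *
    (exp_pi z * half_theta (exp_pi \<tau>) (exp_pi z ^ 2) - inverse (exp_pi z) * half_theta (exp_pi \<tau>) (inverse (exp_pi z ^ 2)))) holomorphic_on A"
    by (intro holomorphic_intros h) (auto simp: exp_pi_def intro!: holomorphic_intros)
  then show ?thesis by (subst theta1_exp_pi[OF t, abs_def])
qed

lemma theta1_0 [simp]: "theta1 \<tau> 0 = 0" by (simp add: theta1_def)

lemma theta1_plus_1: "Im \<tau> > 0 \<Longrightarrow> theta1 \<tau> (z + 1) = - theta1 \<tau> z"
  by (simp only: theta1_exp_pi exp_pi_add exp_pi_1) (simp add: algebra_simps)

text \<open>The cancellation behind \<open>theta1_plus_tau\<close>.\<close>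

lemma half_theta_algebra:
  fixes u q :: complex
  assumes "u \<noteq> 0" "q \<noteq> 0"
  shows "u * q * h - inverse (u * q) * (1 - inverse (u\<^sup>2) * k) =
    - inverse (q * u\<^sup>2) * (u * (1 - q\<^sup>2 * u\<^sup>2 * h) - inverse u * k)"
proof -
  have *: "u * q * h - iu * iq * (1 - iu\<^sup>2 * k) = - (iq * iu\<^sup>2) * (u * (1 - q\<^sup>2 * u\<^sup>2 * h) - iu * k)"
    if "u * iu = 1" "q * iq = 1" for iu iq
  proof -
    have "- (iq * iu\<^sup>2) * (u * (1 - q\<^sup>2 * u\<^sup>2 * h) - iu * k) =
      u * q * h * ((q * iq) * (u * iu)\<^sup>2) - iu * iq * ((u * iu) - iu\<^sup>2 * k)"
      by (simp add: algebra_simps power2_eq_square)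
    then show ?thesis by (simp add: that)
  qed
  show ?thesis
    using *[of "inverse u" "inverse q"] assms by (simp add: power_inverse)
qed

text \<open>The cancellation behind \<open>theta_prod_plus_tau\<close>.\<close>

lemma theta_prod_algebra:
  fixes u q :: complex
  assumes "u \<noteq> 0" "q \<noteq> 0"
  shows "(u * q - inverse (u * q)) * (1 - inverse (u\<^sup>2)) =
     - inverse (q * u\<^sup>2) * ((u - inverse u) * (1 - q\<^sup>2 * u\<^sup>2))"
proof -
  have *: "(u * q - iu * iq) * (1 - iu\<^sup>2) = - (iq * iu\<^sup>2) * ((u - iu) * (1 - q\<^sup>2 * u\<^sup>2))"
    if "u * iu = 1" "q * iq = 1" for iu iq
  proof -
    have "- (iq * iu\<^sup>2) * ((u - iu) * (1 - q\<^sup>2 * u\<^sup>2)) =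
      u * q * ((q * iq) * (u * iu)\<^sup>2) - q * iu * ((q * iq) * (u * iu)\<^sup>2) - iu * iq * (u * iu) + iu * iq * iu\<^sup>2"
      by (simp add: algebra_simps power2_eq_square)
    also have "\<dots> = u * q - q * iu - iu * iq + iu * iq * iu\<^sup>2" by (simp add: that)
    also have "q * iu = u * q * iu\<^sup>2"
      using that by (simp add: power2_eq_square mult_ac)
    finally show ?thesis by (simp add: algebra_simps)
  qed
  show ?thesis
    using *[of "inverse u" "inverse q"] assms by (simp add: power_inverse)
qed

text \<open>The functional equation of \<open>half_theta\<close>, used at
  \<open>u\<^sup>2\<close> and at \<open>(u q)\<^sup>-\<^sup>2\<close>, leaves two boundary
  terms, which cancel.\<close>

lemma theta1_plus_tau:
  assumes "Im \<tau> > 0"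
  shows "theta1 \<tau> (z + \<tau>) = - inverse (exp_pi \<tau> * exp_pi z ^ 2) * theta1 \<tau> z"
proof -
  define q u where "q = exp_pi \<tau>" and "u = exp_pi z"
  have nz: "q \<noteq> 0" "u \<noteq> 0" by (auto simp: q_def u_def)
  have q: "norm q < 1" unfolding q_def using assms by (rule norm_exp_pi_less_1)
  have 1: "half_theta q (u^2) = 1 - q\<^sup>2 * u^2 * half_theta q (q\<^sup>2 * u^2)"
    by (rule half_theta_functional_equation[OF q])
  have 2: "half_theta q (inverse ((u * q)\<^sup>2)) = 1 - inverse (u^2) * half_theta q (inverse (u^2))"
    using half_theta_functional_equation[OF q, of "inverse ((u * q)\<^sup>2)"] nz by (simp add: field_simps)
  have eq: "(u * q) * half_theta q ((u * q)^2) - inverse (u * q) * half_theta q (inverse ((u * q) ^ 2))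
    = - inverse (q * u ^ 2) * (u * half_theta q (u ^ 2) - inverse u * half_theta q (inverse (u ^ 2)))"
  proof -
    define h k where "h = half_theta q (q\<^sup>2 * u^2)" and "k = half_theta q (inverse (u^2))"
    have "(u * q) * half_theta q ((u * q)^2) - inverse (u * q) * half_theta q (inverse ((u * q) ^ 2))
       = u * q * h - inverse (u * q) * (1 - inverse (u^2) * k)"
      by (simp only: 2 h_def k_def) (simp only: power_mult_distrib mult.commute)
    also have "\<dots> = - inverse (q * u ^ 2) * (u * (1 - q\<^sup>2 * u^2 * h) - inverse u * k)"
      by (rule half_theta_algebra[OF nz(2,1)])
    finally show ?thesis by (simp only: 1 h_def k_def)
  qed
  show ?thesis unfolding theta1_exp_pi[OF assms] exp_pi_add q_def[symmetric] u_def[symmetric] eq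
    by (rule mult.left_commute)
qed

lemma theta1_nonzero:
  assumes "Im \<tau> > 0"
  shows "\<exists>z. theta1 \<tau> z \<noteq> 0"
proof -
  obtain v where v: "v \<noteq> 0" "v * half_theta (exp_pi \<tau>) v \<noteq> half_theta (exp_pi \<tau>) (1 / v)"
    using half_theta_not_symmetric[OF norm_exp_pi_less_1[OF assms]] by blast
  \<comment> \<open>chosen so that \<open>exp_pi z ^ 2 = v\<close>\<close>
  define z where "z = Ln v / (2 * of_real pi * \<i>)"
  have "exp_pi z ^ 2 = exp (Ln v)"
    unfolding exp_pi_def z_def exp_of_nat_mult[symmetric] by (simp add: field_simps)
  then have "exp_pi z ^ 2 = v" using v by simp
  then have "exp_pi z * half_theta (exp_pi \<tau>) (exp_pi z ^ 2) - inverse (exp_pi z) * half_theta (exp_pi \<tau>) (inverse (exp_pi z ^ 2)) \<noteq> 0"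
    using v(2) by (auto simp: field_simps power2_eq_square)
  then show ?thesis unfolding theta1_exp_pi[OF assms] by auto
qed

section \<open>A power series with the zeros of an infinite product\<close>

text \<open>Euler's expansion of the product of all \<open>1 - p\<^sup>m w\<close> with \<open>m
  \<ge> 1\<close>. The functional equation of the product and its value at 0, which locate the
  zeros, can be read off the series.\<close>

definition euler_series :: "complex \<Rightarrow> complex \<Rightarrow> complex" where
  "euler_series p w = (\<Sum>m. (\<Prod>k<m. - (p ^ Suc k / (1 - p ^ Suc k))) * w ^ m)"

lemma power_Suc_neq_1: "norm p < 1 \<Longrightarrow> p ^ Suc k \<noteq> 1" for p :: complex
  by (metis norm_one norm_power less_irrefl power_Suc_less_one norm_ge_zero zero_less_norm_iff
      power_0_Suc zero_neq_one)

lemma euler_series_ratio: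
  "(\<Prod>k<Suc m. - (p ^ Suc k / (1 - p ^ Suc k))) =
   - (p ^ Suc m / (1 - p ^ Suc m)) * (\<Prod>k<m. - (p ^ Suc k / (1 - p ^ Suc k)))" for p :: complex
  by simp

lemma euler_series_tendsto:
  fixes p :: complex
  assumes "norm p < 1"
  shows "(\<lambda>m. - (p ^ Suc m / (1 - p ^ Suc m))) \<longlonglongrightarrow> 0"
proof -
  have "(\<lambda>m. - (p ^ Suc m / (1 - p ^ Suc m))) \<longlonglongrightarrow> - (0 / (1 - 0))"
    by (intro tendsto_intros power_Suc_tendsto_0 assms) auto
  then show ?thesis by simp
qed

lemma euler_series_sums:
  "norm p < 1 \<Longrightarrow> (\<lambda>m. (\<Prod>k<m. - (p ^ Suc k / (1 - p ^ Suc k))) * w ^ m) sums euler_series p w" for p w :: complex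
  unfolding euler_series_def by (intro summable_sums summable_if_ratio_tendsto_0[OF euler_series_ratio euler_series_tendsto])

lemma euler_series_holomorphic: "norm p < 1 \<Longrightarrow> euler_series p holomorphic_on A"
  unfolding euler_series_def by (rule holomorphic_if_ratio_tendsto_0[OF euler_series_ratio euler_series_tendsto])

lemma euler_series_0: "euler_series p 0 = 1"
  unfolding euler_series_def using powser_zero[of "\<lambda>m. \<Prod>k<m. - (p ^ Suc k / (1 - p ^ Suc k))"] by simp

text \<open>Comparing coefficients, this is the recursion \<open>c\<^sub>m\<^sub>+\<^sub>1 (1 -
  p\<^sup>m\<^sup>+\<^sup>1) = - p\<^sup>m\<^sup>+\<^sup>1 c\<^sub>m\<close>.\<close>

lemma euler_series_functional_equation:
  assumes p: "norm p < 1"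
  shows "euler_series p w = (1 - p * w) * euler_series p (p * w)"
proof -
  define c where "c m = (\<Prod>k<m. - (p ^ Suc k / (1 - p ^ Suc k)))" for m
  have s: "(\<lambda>m. c m * w ^ m) sums euler_series p w" for w
    unfolding c_def by (rule euler_series_sums[OF p])
  have cS: "c (Suc m) * (1 - p ^ Suc m) = - (p ^ Suc m) * c m" for m
    unfolding c_def euler_series_ratio using power_Suc_neq_1[OF p, of m] by (simp add: field_simps)
  have "(\<lambda>m. c m * w ^ m - c m * (p * w) ^ m) sums (euler_series p w - euler_series p (p * w))"
    by (intro sums_diff s)
  moreover have "c 0 * w ^ 0 - c 0 * (p * w) ^ 0 = 0" by simp
  ultimately have "(\<lambda>m. c (Suc m) * w ^ Suc m - c (Suc m) * (p * w) ^ Suc m) sums (euler_series p w - euler_series p (p * w))"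
    by (subst sums_Suc_iff) simp
  moreover have "c (Suc m) * w ^ Suc m - c (Suc m) * (p * w) ^ Suc m = - (p * w) * (c m * (p * w) ^ m)" for m
  proof -
    have "c (Suc m) * w ^ Suc m - c (Suc m) * (p * w) ^ Suc m = c (Suc m) * (1 - p ^ Suc m) * w ^ Suc m"
      unfolding power_mult_distrib by (simp add: algebra_simps del: power_Suc)
    also have "\<dots> = - (p * w) * (c m * (p * w) ^ m)"
      unfolding cS by (simp add: power_mult_distrib mult_ac)
    finally show ?thesis .
  qed
  ultimately have "(\<lambda>m. - (p * w) * (c m * (p * w) ^ m)) sums (euler_series p w - euler_series p (p * w))"
    by (simp only:)
  moreover have "(\<lambda>m. - (p * w) * (c m * (p * w) ^ m)) sums (- (p * w) * euler_series p (p * w))"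
    by (intro sums_mult s)
  ultimately have "euler_series p w - euler_series p (p * w) = - (p * w) * euler_series p (p * w)" by (rule sums_unique2)
  then show ?thesis by (simp add: algebra_simps)
qed

text \<open>If no factor \<open>1 - p\<^sup>m w\<close> vanished, the functional equation would
  carry a zero at \<open>w\<close> to zeros at all \<open>p\<^sup>m w\<close>, which tend to 0,
  where the series has the value 1.\<close>

lemma euler_series_zero:
  assumes p: "norm p < 1" and z: "euler_series p w = 0"
  shows "\<exists>m. p ^ Suc m * w = 1"
proof (rule ccontr)
  assume no: "\<not> ?thesis"
  have zero: "euler_series p (p ^ m * w) = 0" for m
  proof (induction m)
    case (Suc m)
    have "euler_series p (p ^ m * w) = (1 - p ^ Suc m * w) * euler_series p (p ^ Suc m * w)"
      using euler_series_functional_equation[OF p, of "p ^ m * w"] by (simp add: mult_ac)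
    then show ?case using Suc no by auto
  qed (simp add: z)
  have "isCont (euler_series p) 0"
    using holomorphic_on_imp_continuous_on[OF euler_series_holomorphic[OF p, of UNIV]]
    by (simp add: continuous_on_eq_continuous_at)
  moreover have "(\<lambda>m. p ^ m * w) \<longlonglongrightarrow> 0"
    using tendsto_mult_right[OF LIMSEQ_power_zero[OF p], of w] by simp
  ultimately have "(\<lambda>m. euler_series p (p ^ m * w)) \<longlonglongrightarrow> euler_series p 0" by (rule isCont_tendsto_compose)
  then show False using zero euler_series_0 LIMSEQ_unique[OF tendsto_const] by fastforce
qed

section \<open>Periodic and quasi-periodic entire functions\<close>

definition periods :: "complex \<Rightarrow> complex set" where
  "periods \<tau> = {of_int a + of_int b * \<tau> | a b. True}"

lemma shift_invariant:
  fixes t :: complex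
  assumes "\<And>z. Q (z + t) \<longleftrightarrow> Q z"
  shows "Q (z + of_int a * t) \<longleftrightarrow> Q z"
proof (induction a rule: int_induct[of _ 0])
  case (step1 i) then show ?case using assms[of "z + of_int i * t"] by (simp add: algebra_simps)
next
  case (step2 i) then show ?case using assms[of "z + of_int (i - 1) * t"] by (simp add: algebra_simps)
qed simp

text \<open>Periodicity, the vanishing of a quasi-periodic function and the simplicity of a zero
  are all spread from one point to its translates by this principle.\<close>

lemma lattice_invariant:
  fixes Q :: "complex \<Rightarrow> bool"
  assumes 1: "\<And>z. Q (z + 1) \<longleftrightarrow> Q z" and t: "\<And>z. Q (z + \<tau>) \<longleftrightarrow> Q z"
  shows "Q (z + of_int a + of_int b * \<tau>) \<longleftrightarrow> Q z"
  using shift_invariant[of Q 1 z a, OF 1] shift_invariant[of Q \<tau> "z + of_int a" b, OF t] by simp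

text \<open>Every point can be moved into the compact parallelogram spanned by \<open>1\<close>
  and \<open>\<tau>\<close>.\<close>

lemma periodic_bounded:
  fixes g :: "complex \<Rightarrow> real"
  assumes im: "Im \<tau> > 0" and cont: "continuous_on UNIV g"
    and per: "\<And>z. g (z + 1) = g z" "\<And>z. g (z + \<tau>) = g z"
  shows "\<exists>M. \<forall>z. g z \<le> M"
proof -
  define K where "K = (\<lambda>(s, t). of_real s + of_real t * \<tau>) ` (cbox (0::real, 0::real) (1, 1))"
  have "compact K" unfolding K_def
    by (intro compact_continuous_image compact_cbox) (auto simp: case_prod_beta intro!: continuous_intros)
  then have "compact (g ` K)" by (intro compact_continuous_image continuous_on_subset[OF cont]) auto
  then obtain M where M: "\<And>z. z \<in> K \<Longrightarrow> g z \<le> M"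
    using bounded_imp_bdd_above[OF compact_imp_bounded] by (fastforce simp: bdd_above_def)
  have "g z \<le> M" for z
  proof -
    define t s where "t = Im z / Im \<tau>" and "s = Re (z - of_real t * \<tau>)"
    have z: "z = of_real s + of_real t * \<tau>" using im by (simp add: complex_eq_iff s_def t_def)
    \<comment> \<open>the representative of \<open>z\<close> in the fundamental
      parallelogram\<close>
    define w where "w = of_real (frac s) + of_real (frac t) * \<tau>"
    have "w \<in> K" unfolding w_def K_def
      by (rule image_eqI[of _ _ "(frac s, frac t)"]) (auto simp: frac_lt_1 less_imp_le)
    have "z = w + of_int \<lfloor>s\<rfloor> + of_int \<lfloor>t\<rfloor> * \<tau>"
      unfolding z w_def frac_def by (simp add: algebra_simps)
    then have "g z = g w"
      using lattice_invariant[of "\<lambda>z. g z = g w" \<tau> w "\<lfloor>s\<rfloor>" "\<lfloor>t\<rfloor>"] per by simp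
    then show ?thesis using M[OF \<open>w \<in> K\<close>] by simp
  qed
  then show ?thesis by blast
qed

lemma entire_doubly_periodic_constant:
  assumes im: "Im \<tau> > 0" and hol: "h holomorphic_on UNIV"
    and per: "\<And>z. h (z + 1) = h z" "\<And>z. h (z + \<tau>) = h z"
  shows "\<exists>c. \<forall>z. h z = c"
proof -
  have "continuous_on UNIV (\<lambda>z. norm (h z))"
    by (intro continuous_intros holomorphic_on_imp_continuous_on hol)
  from periodic_bounded[OF im this] obtain M where "\<And>z. norm (h z) \<le> M" using per by auto
  then have "bounded (range h)" by (auto simp: bounded_iff)
  from Liouville_theorem[OF hol this] show ?thesis by (auto simp: constant_on_def)
qed

text \<open>A quotient of entire functions extends over the zeros of the denominator when these
  are simple and also zeros of the numerator. Giving the values there by derivatives makes the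
  extension explicit, so that its periodicity can be computed.\<close>

lemma entire_quotient:
  assumes f: "f holomorphic_on UNIV" and g: "g holomorphic_on UNIV"
    and fz: "\<And>z. g z = 0 \<Longrightarrow> f z = 0" and gz: "\<And>z. g z = 0 \<Longrightarrow> deriv g z \<noteq> 0"
  shows "(\<lambda>z. if g z = 0 then deriv f z / deriv g z else f z / g z) holomorphic_on UNIV"
    (is "?h holomorphic_on UNIV")
proof -
  have an: "f analytic_on {a}" "g analytic_on {a}" for a
    using f g by (auto simp: analytic_on_open intro: analytic_on_subset[of _ UNIV])
  have "?h analytic_on {a}" for a
  proof (cases "g a = 0")
    case False
    have "open {z. g z \<noteq> 0}"
      by (intro open_Collect_neq holomorphic_on_imp_continuous_on[OF g] continuous_intros)
    then have "\<forall>\<^sub>F z in nhds a. g z \<noteq> 0"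
      using False eventually_nhds_in_open[of "{z. g z \<noteq> 0}" a] by simp
    then have ev: "\<forall>\<^sub>F z in nhds a. ?h z = f z / g z" by eventually_elim simp
    have "(\<lambda>z. f z / g z) analytic_on {a}"
      using False by (intro analytic_intros an) auto
    then show ?thesis using analytic_at_cong[OF ev refl] by simp
  next
    case True
    let ?q = "\<lambda>f z. if z = a then deriv f a else (f z - f a) / (z - a)"
    have qf: "?q f holomorphic_on UNIV" and qg: "?q g holomorphic_on UNIV"
      using f g by (auto intro!: pole_lemma_open)
    have "open {z. ?q g z \<noteq> 0}"
      by (rule open_Collect_neq[OF holomorphic_on_imp_continuous_on[OF qg] continuous_on_const])
    then have nz: "\<forall>\<^sub>F z in nhds a. ?q g z \<noteq> 0"
      using gz[OF True] eventually_nhds_in_open[of "{z. ?q g z \<noteq> 0}" a] by simp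
    have ev: "\<forall>\<^sub>F z in nhds a. ?h z = ?q f z / ?q g z"
      using nz by eventually_elim (auto simp: True fz)
    have "?q f analytic_on {a}" "?q g analytic_on {a}"
      using qf qg by (auto simp only: analytic_on_open[OF open_UNIV, symmetric] intro: analytic_on_subset)
    then have "(\<lambda>z. ?q f z / ?q g z) analytic_on {a}"
      using gz[OF True] by (intro analytic_on_divide) auto
    then show ?thesis using analytic_at_cong[OF ev refl] by simp
  qed
  then have "?h analytic_on UNIV" using analytic_on_analytic_at by blast
  then show ?thesis by (rule analytic_imp_holomorphic)
qed

text \<open>At a zero the derivative of the multiplier does not contribute.\<close>

lemma deriv_shift_multiplier:
  fixes f m :: "complex \<Rightarrow> complex"
  assumes f: "f holomorphic_on UNIV" and m: "m holomorphic_on UNIV"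
    and per: "\<And>z. f (z + t) = m z * f z" and z: "f z = 0"
  shows "deriv f (z + t) = m z * deriv f z"
proof -
  have df: "(f has_field_derivative deriv f w) (at w)" for w
    using f by (simp add: holomorphic_derivI)
  have dm: "(m has_field_derivative deriv m w) (at w)" for w
    using m by (simp add: holomorphic_derivI)
  have "((\<lambda>z. f (z + t)) has_field_derivative deriv f (z + t)) (at z)"
    using df[of "z + t"] by (simp add: DERIV_shift)
  moreover have "((\<lambda>z. f (z + t)) has_field_derivative m z * deriv f z) (at z)"
    unfolding per by (auto intro!: derivative_eq_intros df dm simp: z)
  ultimately show ?thesis by (rule DERIV_unique)
qed

text \<open>Two quasi-periodic functions with equal multipliers have an elliptic quotient. If
  the zeros of the denominator are simple and shared by the numerator, the quotient is entire,
  hence constant.\<close>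

lemma theta_functions_proportional:
  assumes im: "Im \<tau> > 0" and f: "f holomorphic_on UNIV" and g: "g holomorphic_on UNIV"
    and m: "m holomorphic_on UNIV" and m': "m' holomorphic_on UNIV"
    and mz: "\<And>z. m z \<noteq> 0" "\<And>z. m' z \<noteq> 0"
    and f1: "\<And>z. f (z + 1) = m z * f z" and ft: "\<And>z. f (z + \<tau>) = m' z * f z"
    and g1: "\<And>z. g (z + 1) = m z * g z" and gt: "\<And>z. g (z + \<tau>) = m' z * g z"
    and zeros: "\<And>z. g z = 0 \<Longrightarrow> f z = 0 \<and> deriv g z \<noteq> 0"
  shows "\<exists>c. \<forall>z. f z = c * g z"
proof -
  define h where "h z = (if g z = 0 then deriv f z / deriv g z else f z / g z)" for z
  have "h holomorphic_on UNIV"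
    unfolding h_def using zeros by (intro entire_quotient f g) auto
  moreover have "h (z + 1) = h z" for z
    using deriv_shift_multiplier[of f m 1, OF f m f1, of z] deriv_shift_multiplier[of g m 1, OF g m g1, of z]
      zeros[of z] mz f1 g1 by (auto simp: h_def)
  moreover have "h (z + \<tau>) = h z" for z
    using deriv_shift_multiplier[of f m' \<tau>, OF f m' ft, of z] deriv_shift_multiplier[of g m' \<tau>, OF g m' gt, of z]
      zeros[of z] mz ft gt by (auto simp: h_def)
  ultimately obtain c where c: "\<And>z. h z = c"
    using entire_doubly_periodic_constant[OF im] by blast
  have "f z = c * g z" for z
    using c[of z] zeros[of z] by (cases "g z = 0") (auto simp: h_def)
  then show ?thesis by blast
qed

section \<open>The zeros of the theta function\<close>

lemma exp_pi_sq_eq_1: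
  assumes "exp_pi x ^ 2 = 1" shows "\<exists>k. x = of_int k"
proof -
  have "exp_pi x = inverse (exp_pi x)" using assms by (simp add: power2_eq_square field_simps)
  then have "sin (of_real pi * x) = 0" by (simp add: sin_exp_pi)
  then obtain k :: int where "of_real pi * x = of_real (of_int k * pi)" by (auto simp: sin_eq_0)
  then have "x = of_int k" by (simp add: mult.commute)
  then show ?thesis by blast
qed

lemma norm_exp_pi_sq_less_1: "Im \<tau> > 0 \<Longrightarrow> norm (exp_pi \<tau> ^ 2) < 1"
  by (intro norm_square_less_1 norm_exp_pi_less_1)

text \<open>The triple product, up to a constant factor. All its zeros are visible in the
  factors.\<close>

definition theta_prod :: "complex \<Rightarrow> complex \<Rightarrow> complex" where
  "theta_prod \<tau> z = sin (of_real pi * z) * (euler_series (exp_pi \<tau> ^ 2) (exp_pi z ^ 2) * euler_series (exp_pi \<tau> ^ 2) (inverse (exp_pi z ^ 2)))"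

lemma theta_prod_factor_holomorphic:
  assumes "Im \<tau> > 0"
  shows "(\<lambda>z. euler_series (exp_pi \<tau> ^ 2) (exp_pi z ^ 2) * euler_series (exp_pi \<tau> ^ 2) (inverse (exp_pi z ^ 2))) holomorphic_on A"
proof -
  have h: "(\<lambda>z. euler_series (exp_pi \<tau> ^ 2) (g z)) holomorphic_on A" if "g holomorphic_on A" for g
    using holomorphic_on_compose[OF that euler_series_holomorphic[OF norm_exp_pi_sq_less_1[OF assms]]] by (simp add: o_def)
  show ?thesis by (intro holomorphic_intros h) (auto simp: exp_pi_def intro!: holomorphic_intros)
qed

lemma theta_prod_holomorphic: "Im \<tau> > 0 \<Longrightarrow> theta_prod \<tau> holomorphic_on A"
  unfolding theta_prod_def by (intro holomorphic_intros theta_prod_factor_holomorphic)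

lemma theta_prod_plus_1: "theta_prod \<tau> (z + 1) = - theta_prod \<tau> z"
proof -
  have "exp_pi (z + 1) - inverse (exp_pi (z + 1)) = - (exp_pi z - inverse (exp_pi z))"
    by (simp add: exp_pi_add)
  then have "sin (of_real pi * (z + 1)) = - sin (of_real pi * z)"
    unfolding sin_exp_pi by (simp only: minus_divide_left)
  moreover have "exp_pi (z + 1) ^ 2 = exp_pi z ^ 2" by (simp add: exp_pi_add)
  ultimately show ?thesis by (simp add: theta_prod_def)
qed

text \<open>Under the shift by \<open>\<tau>\<close>, one Euler factor gains and the other one
  loses a linear factor; together with the sine this gives the multiplier of the theta
  function.\<close>

lemma theta_prod_plus_tau:
  assumes "Im \<tau> > 0"
  shows "theta_prod \<tau> (z + \<tau>) = - inverse (exp_pi \<tau> * exp_pi z ^ 2) * theta_prod \<tau> z"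
proof -
  define q u where "q = exp_pi \<tau>" and "u = exp_pi z"
  have nz: "q \<noteq> 0" "u \<noteq> 0" by (auto simp: q_def u_def)
  have p: "norm (q^2) < 1" unfolding q_def using assms by (rule norm_exp_pi_sq_less_1)
  define h k where "h = euler_series (q^2) (q\<^sup>2 * u^2)" and "k = euler_series (q^2) (inverse (u^2))"
  have 1: "euler_series (q^2) (u^2) = (1 - q\<^sup>2 * u^2) * h"
    unfolding h_def by (rule euler_series_functional_equation[OF p])
  have 3: "(u * q)\<^sup>2 = q\<^sup>2 * u\<^sup>2" by (simp add: power_mult_distrib mult.commute)
  have "q\<^sup>2 * inverse (q\<^sup>2 * u\<^sup>2) = inverse (u\<^sup>2)" using nz by simp
  then have 2: "euler_series (q^2) (inverse (q\<^sup>2 * u\<^sup>2)) = (1 - inverse (u^2)) * k"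
    unfolding k_def using euler_series_functional_equation[OF p, of "inverse (q\<^sup>2 * u\<^sup>2)"] by (simp only:)
  have "(u * q - inverse (u * q)) / (2 * \<i>) * (h * ((1 - inverse (u^2)) * k)) =
     ((u * q - inverse (u * q)) * (1 - inverse (u\<^sup>2))) * (h * k / (2 * \<i>))"
    by (simp only: divide_inverse mult_ac)
  also have "\<dots> = (- inverse (q * u\<^sup>2) * ((u - inverse u) * (1 - q\<^sup>2 * u\<^sup>2))) * (h * k / (2 * \<i>))"
    by (simp only: theta_prod_algebra[OF nz(2,1)])
  also have "\<dots> = - inverse (q * u ^ 2) * ((u - inverse u) / (2 * \<i>) * (((1 - q\<^sup>2 * u^2) * h) * k))"
    by (simp only: divide_inverse mult_ac)
  finally show ?thesis
    unfolding theta_prod_def sin_exp_pi exp_pi_add q_def[symmetric] u_def[symmetric]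
    by (simp only: 3 1 2) (simp only: h_def k_def)
qed

text \<open>Each factor vanishes only if
  \<open>e\<^sup>2\<^sup>\<pi>\<^sup>i\<^sup>(\<^sup>z\<^sup>+\<^sup>m\<^sup>\<tau>\<^sup>) =
  1\<close> for some integer \<open>m\<close>.\<close>

lemma theta_prod_zero:
  assumes im: "Im \<tau> > 0" and z: "theta_prod \<tau> z = 0"
  shows "z \<in> periods \<tau>"
proof -
  note p = norm_exp_pi_sq_less_1[OF im]
  have "exp_pi (of_nat m * \<tau>) = exp_pi \<tau> ^ m" for m
    by (simp add: exp_pi_def exp_of_nat_mult[symmetric] mult_ac)
  then have sq: "exp_pi (w + of_nat m * \<tau>) ^ 2 = (exp_pi \<tau> ^ 2) ^ m * exp_pi w ^ 2" for w m
    by (simp only: exp_pi_add power_mult_distrib power_mult[symmetric] mult.commute)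
  have "\<exists>m :: int. \<exists>k. z + of_int m * \<tau> = of_int k"
  proof -
    consider "sin (of_real pi * z) = 0" | "euler_series (exp_pi \<tau> ^ 2) (exp_pi z ^ 2) = 0"
      | "euler_series (exp_pi \<tau> ^ 2) (inverse (exp_pi z ^ 2)) = 0"
      using z by (auto simp: theta_prod_def)
    then show ?thesis
    proof cases
      case 1
      then have "exp_pi z = inverse (exp_pi z)" unfolding sin_exp_pi by simp
      then have "exp_pi z ^ 2 = 1" by (metis exp_pi_nz power2_eq_square right_inverse)
      from exp_pi_sq_eq_1[OF this] obtain k where "z = of_int k" by blast
      then have "z + of_int 0 * \<tau> = of_int k" by simp
      then show ?thesis by blast
    next
      case 2
      then obtain m where "(exp_pi \<tau> ^ 2) ^ Suc m * exp_pi z ^ 2 = 1" using euler_series_zero[OF p] by blast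
      then have "exp_pi (z + of_nat (Suc m) * \<tau>) ^ 2 = 1"
        by (simp only: sq)
      from exp_pi_sq_eq_1[OF this] show ?thesis by (metis of_int_of_nat_eq)
    next
      case 3
      then obtain m where "(exp_pi \<tau> ^ 2) ^ Suc m * inverse (exp_pi z ^ 2) = 1" using euler_series_zero[OF p] by blast
      then have "exp_pi (- z + of_nat (Suc m) * \<tau>) ^ 2 = 1"
        by (simp only: sq exp_pi_minus power_inverse)
      from exp_pi_sq_eq_1[OF this] obtain k where "- z + of_nat (Suc m) * \<tau> = of_int k" by blast
      then have "z + of_int (- int (Suc m)) * \<tau> = of_int (- k)" by (simp add: algebra_simps)
      then show ?thesis by blast
    qed
  qed
  then obtain m k :: int where "z + of_int m * \<tau> = of_int k" by blast
  then have "z = of_int k + of_int (- m) * \<tau>" by (simp add: algebra_simps)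
  then show ?thesis unfolding periods_def by blast
qed

lemma theta_prod_0 [simp]: "theta_prod \<tau> 0 = 0" by (simp add: theta_prod_def)

lemma deriv_theta_prod_0:
  assumes im: "Im \<tau> > 0"
  shows "deriv (theta_prod \<tau>) 0 \<noteq> 0"
proof -
  note p = norm_exp_pi_sq_less_1[OF im]
  define k where "k z = euler_series (exp_pi \<tau> ^ 2) (exp_pi z ^ 2) * euler_series (exp_pi \<tau> ^ 2) (inverse (exp_pi z ^ 2))" for z
  have "(k has_field_derivative deriv k 0) (at 0)"
    using theta_prod_factor_holomorphic[OF im, of UNIV, folded k_def] by (simp add: holomorphic_derivI)
  then have "(theta_prod \<tau> has_field_derivative (of_real pi * k 0)) (at 0)"
    unfolding theta_prod_def[abs_def] k_def[symmetric] by (auto intro!: derivative_eq_intros)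
  then have "deriv (theta_prod \<tau>) 0 = of_real pi * k 0" by (rule DERIV_imp_deriv)
  moreover have "euler_series (exp_pi \<tau> ^ 2) 1 \<noteq> 0"
    using euler_series_zero[OF p, of 1] power_Suc_neq_1[OF p] by auto
  ultimately show ?thesis by (simp add: k_def)
qed

lemma theta_multiplier_holomorphic: "(\<lambda>z. - inverse (exp_pi \<tau> * exp_pi z ^ 2)) holomorphic_on A"
  by (intro holomorphic_intros) (auto simp: exp_pi_def intro!: holomorphic_intros)

text \<open>The zero at 0 is simple because the Euler factors do not vanish at 1, and the
  multipliers spread this to all lattice points.\<close>

lemma deriv_theta_prod_lattice:
  assumes im: "Im \<tau> > 0" and z: "z \<in> periods \<tau>"
  shows "deriv (theta_prod \<tau>) z \<noteq> 0 \<and> theta_prod \<tau> z = 0"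
proof -
  note hol = theta_prod_holomorphic[OF im, of UNIV]
  define Q where "Q z \<longleftrightarrow> deriv (theta_prod \<tau>) z \<noteq> 0 \<and> theta_prod \<tau> z = 0" for z
  have "Q (z + 1) \<longleftrightarrow> Q z" for z
    using deriv_shift_multiplier[of "theta_prod \<tau>" "\<lambda>_. -1" 1 z, OF hol holomorphic_on_const]
    by (auto simp: Q_def theta_prod_plus_1)
  moreover have "Q (z + \<tau>) \<longleftrightarrow> Q z" for z
    using deriv_shift_multiplier[OF hol theta_multiplier_holomorphic theta_prod_plus_tau[OF im], of z]
    by (auto simp: Q_def theta_prod_plus_tau[OF im])
  ultimately have "Q (0 + of_int a + of_int b * \<tau>) \<longleftrightarrow> Q 0" for a b
    by (rule lattice_invariant)
  moreover have "Q 0" by (simp add: Q_def deriv_theta_prod_0[OF im])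
  ultimately show ?thesis using z unfolding periods_def Q_def by auto
qed

lemma theta1_lattice:
  assumes im: "Im \<tau> > 0" and z: "z \<in> periods \<tau>"
  shows "theta1 \<tau> z = 0"
proof -
  have "theta1 \<tau> (0 + of_int a + of_int b * \<tau>) = 0 \<longleftrightarrow> theta1 \<tau> 0 = 0" for a b
    by (rule lattice_invariant) (simp_all add: theta1_plus_1[OF im] theta1_plus_tau[OF im])
  then show ?thesis using z by (auto simp: periods_def)
qed

text \<open>The Jacobi triple product up to a nonzero constant, which suffices to compare
  zeros.\<close>

lemma theta1_eq_theta_prod:
  assumes im: "Im \<tau> > 0"
  shows "\<exists>c. c \<noteq> 0 \<and> (\<forall>z. theta1 \<tau> z = c * theta_prod \<tau> z)"
proof -
  have "\<exists>c. \<forall>z. theta1 \<tau> z = c * theta_prod \<tau> z"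
  proof (rule theta_functions_proportional[OF im])
    show "theta1 \<tau> holomorphic_on UNIV" "theta_prod \<tau> holomorphic_on UNIV"
      by (rule theta1_holomorphic[OF im], rule theta_prod_holomorphic[OF im])
    show "(\<lambda>_. -1 :: complex) holomorphic_on UNIV" by simp
    show "(\<lambda>z. - inverse (exp_pi \<tau> * exp_pi z ^ 2)) holomorphic_on UNIV"
      by (rule theta_multiplier_holomorphic)
    show "theta1 \<tau> z = 0 \<and> deriv (theta_prod \<tau>) z \<noteq> 0" if "theta_prod \<tau> z = 0" for z
      using theta_prod_zero[OF im that] deriv_theta_prod_lattice[OF im] theta1_lattice[OF im] by blast
    show "theta1 \<tau> (z + 1) = -1 * theta1 \<tau> z" "theta_prod \<tau> (z + 1) = -1 * theta_prod \<tau> z" for z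
      by (simp_all add: theta1_plus_1[OF im] theta_prod_plus_1)
  qed (use theta1_plus_tau[OF im] theta_prod_plus_tau[OF im] in auto)
  then obtain c where c: "\<And>z. theta1 \<tau> z = c * theta_prod \<tau> z" by blast
  obtain z where "theta1 \<tau> z \<noteq> 0" using theta1_nonzero[OF im] by blast
  then have "c \<noteq> 0" using c[of z] by auto
  then show ?thesis using c by blast
qed

lemma theta1_eq_0_iff:
  assumes im: "Im \<tau> > 0"
  shows "theta1 \<tau> z = 0 \<longleftrightarrow> z \<in> periods \<tau>"
proof -
  obtain c where c: "c \<noteq> 0" "\<And>z. theta1 \<tau> z = c * theta_prod \<tau> z"
    using theta1_eq_theta_prod[OF im] by blast
  show ?thesis
    using c(1) c(2)[of z] theta_prod_zero[OF im, of z] theta1_lattice[OF im, of z] by auto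
qed

lemma deriv_theta1_0:
  assumes im: "Im \<tau> > 0"
  shows "deriv (theta1 \<tau>) 0 \<noteq> 0"
proof -
  obtain c where c: "c \<noteq> 0" "\<And>z. theta1 \<tau> z = c * theta_prod \<tau> z"
    using theta1_eq_theta_prod[OF im] by blast
  have "(theta_prod \<tau> has_field_derivative deriv (theta_prod \<tau>) 0) (at 0)"
    using theta_prod_holomorphic[OF im, of UNIV] by (simp add: holomorphic_derivI)
  then have "(theta1 \<tau> has_field_derivative c * deriv (theta_prod \<tau>) 0) (at 0)"
    unfolding c(2)[abs_def] by (rule DERIV_cmult)
  from DERIV_imp_deriv[OF this] show ?thesis using c(1) deriv_theta_prod_0[OF im] by simp
qed

section \<open>Clock and shift matrices\<close>

lemma mult_mat_entry:
  assumes "A \<in> carrier_mat n n" "B \<in> carrier_mat n n" "i < n" "j < n"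
  shows "(A * B) $$ (i, j) = (\<Sum>m<n. A $$ (i, m) * B $$ (m, j))"
  using assms by (simp add: scalar_prod_def atLeast0LessThan)

lemma mtrace_mult:
  assumes "A \<in> carrier_mat n n" "B \<in> carrier_mat n n"
  shows "mtrace (A * B) = (\<Sum>i<n. \<Sum>m<n. A $$ (i, m) * B $$ (m, i))"
  using assms by (simp add: mtrace_def mult_mat_entry del: index_mult_mat(1))

lemma sum_delta_mult:
  fixes f g :: "nat \<Rightarrow> complex"
  assumes "a < n"
  shows "(\<Sum>m<n. (if m = a then f m else 0) * g m) = f a * g a"
    "(\<Sum>m<n. (if a = m then f m else 0) * g m) = f a * g a"
    "(\<Sum>m<n. g m * (if m = a then f m else 0)) = g a * f a"
    "(\<Sum>m<n. g m * (if a = m then f m else 0)) = g a * f a"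
  using assms by (simp_all add: if_distrib[of "\<lambda>x. x * _"] if_distrib[of "\<lambda>x. _ * x"] cong: if_cong)

text \<open>\<open>minv\<close> is defined by Gauss-Jordan elimination; this lemma replaces the
  algorithm by the uniqueness of inverses.\<close>

lemma minv_eqI:
  assumes A: "A \<in> carrier_mat n n" and B: "B \<in> carrier_mat n n"
    and AB: "A * B = 1\<^sub>m n" and BA: "B * A = 1\<^sub>m n"
  shows "minv A = B"
proof (cases "mat_inverse A")
  case None
  have "A \<in> Units (ring_mat TYPE(complex) n ())"
    using A B AB BA by (auto simp: Units_def ring_mat_simps)
  then show ?thesis using mat_inverse(1)[OF A None, where b = "()"] by blast
next
  case (Some C)
  from mat_inverse(2)[OF A Some] have C: "C * A = 1\<^sub>m n" "C \<in> carrier_mat n n" by auto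
  have "C = C * (A * B)" using C by (simp add: AB)
  also have "\<dots> = B" using A B C by (simp add: assoc_mult_mat[symmetric, of _ n n _ n _ n])
  finally show ?thesis by (simp add: minv_def Some)
qed

text \<open>Coprimality of \<open>d\<close> and \<open>n\<close> makes \<open>eps n d\<close> a
  primitive root of unity of order \<open>n\<close>.\<close>

locale root_of_unity =
  fixes n d :: nat
  assumes n: "0 < n" and cop: "coprime d n"
begin

abbreviation "\<epsilon> \<equiv> eps n d"
abbreviation "\<epsilon>' \<equiv> inverse (eps n d)"

lemma eps_nz [simp]: "\<epsilon> \<noteq> 0" by (simp add: eps_def)

lemma eps_norm [simp]: "norm \<epsilon> = 1"
proof -
  have "\<epsilon> = exp (\<i> * of_real (2 * pi * d / n))" by (simp add: eps_def mult_ac)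
  then show ?thesis by (simp only: norm_exp_i_times)
qed

lemma eps_power: "\<epsilon> ^ m = exp (2 * of_real pi * \<i> * of_nat (d * m) / of_nat n)"
  by (simp add: eps_def exp_of_nat_mult[symmetric] mult_ac)

lemma eps_power_eq_1_iff: "\<epsilon> ^ m = 1 \<longleftrightarrow> n dvd m"
proof
  assume "\<epsilon> ^ m = 1"
  then obtain k :: int where k: "2 * pi * real (d * m) / real n = of_int (2 * k) * pi"
    unfolding eps_power exp_eq_1 by auto
  then have "real (d * m) = of_int k * real n" using n by (simp add: field_simps)
  then have "real_of_int (int (d * m)) = real_of_int (k * int n)" by simp
  then have "int (d * m) = k * int n" by (simp only: of_int_eq_iff)
  then have "int n dvd int (d * m)" by simp
  then have "n dvd d * m" by (simp only: int_dvd_int_iff)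
  then show "n dvd m" using cop by (simp add: coprime_commute coprime_dvd_mult_right_iff)
next
  assume "n dvd m"
  then obtain k where m: "m = n * k" by blast
  have "\<epsilon> ^ n = 1" using n by (auto simp: eps_power exp_eq_1 intro!: exI[of _ "int d"])
  then show "\<epsilon> ^ m = 1" by (simp add: m power_mult)
qed

lemma eps_mod: "\<epsilon> ^ (m mod n) = \<epsilon> ^ m"
proof -
  have "\<epsilon> ^ m = \<epsilon> ^ (n * (m div n) + m mod n)" by simp
  also have "\<dots> = \<epsilon> ^ (m mod n)"
    using eps_power_eq_1_iff[of "n * (m div n)"] by (simp only: power_add) simp
  finally show ?thesis by simp
qed

lemma eps_inverse_power: "\<epsilon>' ^ m * \<epsilon> ^ m = 1" "\<epsilon> ^ m * \<epsilon>' ^ m = 1"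
  by (simp_all add: power_mult_distrib[symmetric])

text \<open>Orthogonality of the characters of the cyclic group of order \<open>n\<close>: a
  geometric sum.\<close>

lemma eps_orthogonal:
  assumes "i < n" "j < n"
  shows "(\<Sum>l<n. \<epsilon> ^ (i * l) * \<epsilon>' ^ (j * l)) = (if i = j then of_nat n else 0)"
proof -
  define w where "w = \<epsilon> ^ i * \<epsilon>' ^ j"
  have s: "(\<Sum>l<n. \<epsilon> ^ (i * l) * \<epsilon>' ^ (j * l)) = (\<Sum>l<n. w ^ l)"
    by (simp add: w_def power_mult power_mult_distrib)
  show ?thesis
  proof (cases "i = j")
    case True
    then have "w = 1" by (simp add: w_def eps_inverse_power)
    then show ?thesis using True s by simp
  next
    case False
    have "w ^ n = 1"
      using eps_power_eq_1_iff[of "i * n"] eps_power_eq_1_iff[of "j * n"]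
      by (simp add: w_def power_mult_distrib power_mult[symmetric] power_inverse)
    have ne: "\<epsilon> ^ i \<noteq> \<epsilon> ^ j" if "i < j" "j < n" for i j
    proof
      assume "\<epsilon> ^ i = \<epsilon> ^ j"
      moreover have "\<epsilon> ^ i * \<epsilon> ^ (j - i) = \<epsilon> ^ j"
        using that by (simp flip: power_add)
      ultimately have "\<epsilon> ^ i * \<epsilon> ^ (j - i) = \<epsilon> ^ i * 1" by simp
      then have "\<epsilon> ^ (j - i) = 1" by simp
      then have "n dvd j - i" by (simp add: eps_power_eq_1_iff)
      then show False using that by (auto dest: dvd_imp_le)
    qed
    have "\<epsilon> ^ i \<noteq> \<epsilon> ^ j" using False assms ne[of i j] ne[of j i] by (cases i j rule: linorder_cases) auto
    then have "w \<noteq> 1" by (simp add: w_def field_simps)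
    then show ?thesis using s False \<open>w ^ n = 1\<close> by (simp add: geometric_sum)
  qed
qed

definition X_inv :: "complex mat" where
  "X_inv = mat n n (\<lambda>(i, j). if i = j then \<epsilon>' ^ i else 0)"

definition Y_inv :: "complex mat" where
  "Y_inv = mat n n (\<lambda>(i, j). if i = (j + 1) mod n then 1 else 0)"

lemma mats_carrier [simp]:
  "X_mat n d \<in> carrier_mat n n" "Y_mat n \<in> carrier_mat n n" "X_inv \<in> carrier_mat n n" "Y_inv \<in> carrier_mat n n"
  by (auto simp: X_mat_def Y_mat_def X_inv_def Y_inv_def)

lemma succ_mod_inj: "i < n \<Longrightarrow> j < n \<Longrightarrow> (i + 1) mod n = (j + 1) mod n \<longleftrightarrow> i = j" for i j :: nat
  by (auto simp: mod_Suc split: if_splits)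

lemma succ_mod_surj: "i < n \<Longrightarrow> \<exists>m<n. (m + 1) mod n = i"
proof (cases i)
  case 0
  then show ?thesis using n by (intro exI[of _ "n - 1"]) auto
next
  case (Suc m)
  moreover assume "i < n"
  ultimately show ?thesis by (intro exI[of _ m]) auto
qed

lemma sum_delta_lt: "k < n \<Longrightarrow> (\<Sum>m<n. if m = k then f m else 0) = f k" for f :: "nat \<Rightarrow> complex"
  by simp

lemma Y_mult_left:
  assumes "F \<in> carrier_mat n n" "i < n" "j < n"
  shows "(Y_mat n * F) $$ (i, j) = F $$ ((i + 1) mod n, j)"
proof -
  have "(Y_mat n * F) $$ (i, j) = (\<Sum>m<n. (if m = (i + 1) mod n then 1 else 0) * F $$ (m, j))"
    using assms by (subst mult_mat_entry[of _ n]) (auto simp: Y_mat_def)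
  then show ?thesis using n by (simp only: sum_delta_mult mod_less_divisor mult_1 mult_1_right)
qed

lemma Y_inv_mult_right:
  assumes "F \<in> carrier_mat n n" "i < n" "j < n"
  shows "(F * Y_inv) $$ (i, j) = F $$ (i, (j + 1) mod n)"
proof -
  have "(F * Y_inv) $$ (i, j) = (\<Sum>m<n. F $$ (i, m) * (if m = (j + 1) mod n then 1 else 0))"
    using assms by (subst mult_mat_entry[of _ n]) (auto simp: Y_inv_def)
  then show ?thesis using n by (simp only: sum_delta_mult mod_less_divisor mult_1 mult_1_right)
qed

lemma diag_mult_left:
  fixes F :: "complex mat"
  assumes "F \<in> carrier_mat n n" "i < n" "j < n"
  shows "(mat n n (\<lambda>(i, j). if i = j then f i else 0) * F) $$ (i, j) = f i * F $$ (i, j)"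
proof -
  have "(mat n n (\<lambda>(i, j). if i = j then f i else 0) * F) $$ (i, j) = (\<Sum>m<n. (if i = m then f i else 0) * F $$ (m, j))"
    using assms by (subst mult_mat_entry[of _ n]) auto
  then show ?thesis using assms(2,3) by (simp only: sum_delta_mult)
qed

lemma diag_mult_right:
  fixes F :: "complex mat"
  assumes "F \<in> carrier_mat n n" "i < n" "j < n"
  shows "(F * mat n n (\<lambda>(i, j). if i = j then f i else 0)) $$ (i, j) = F $$ (i, j) * f j"
proof -
  have "(F * mat n n (\<lambda>(i, j). if i = j then f i else 0)) $$ (i, j) = (\<Sum>m<n. F $$ (i, m) * (if m = j then f m else 0))"
    using assms by (subst mult_mat_entry[of _ n]) auto
  then show ?thesis using assms(2,3) by (simp only: sum_delta_mult)
qed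

lemma Y_entry: "i < n \<Longrightarrow> j < n \<Longrightarrow> Y_mat n $$ (i, j) = (if j = (i + 1) mod n then 1 else 0)"
  by (simp add: Y_mat_def)

lemma Y_inv_entry: "i < n \<Longrightarrow> j < n \<Longrightarrow> Y_inv $$ (i, j) = (if i = (j + 1) mod n then 1 else 0)"
  by (simp add: Y_inv_def)

lemma minv_X: "minv (X_mat n d) = X_inv"
proof (rule minv_eqI[of _ n])
  show "X_mat n d * X_inv = 1\<^sub>m n"
  proof (rule eq_matI)
    fix i j assume "i < dim_row (1\<^sub>m n :: complex mat)" "j < dim_col (1\<^sub>m n :: complex mat)"
    then show "(X_mat n d * X_inv) $$ (i, j) = 1\<^sub>m n $$ (i, j)"
      unfolding X_mat_def by (subst diag_mult_left) (auto simp: X_inv_def eps_inverse_power)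
  qed (auto simp: X_mat_def X_inv_def)
  show "X_inv * X_mat n d = 1\<^sub>m n"
  proof (rule eq_matI)
    fix i j assume "i < dim_row (1\<^sub>m n :: complex mat)" "j < dim_col (1\<^sub>m n :: complex mat)"
    then show "(X_inv * X_mat n d) $$ (i, j) = 1\<^sub>m n $$ (i, j)"
      unfolding X_inv_def by (subst diag_mult_left) (auto simp: X_mat_def eps_inverse_power)
  qed (auto simp: X_mat_def X_inv_def)
qed auto

lemma minv_Y: "minv (Y_mat n) = Y_inv"
proof (rule minv_eqI[of _ n])
  show "Y_mat n * Y_inv = 1\<^sub>m n"
  proof (rule eq_matI)
    fix i j assume "i < dim_row (1\<^sub>m n :: complex mat)" "j < dim_col (1\<^sub>m n :: complex mat)"
    then show "(Y_mat n * Y_inv) $$ (i, j) = 1\<^sub>m n $$ (i, j)"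
      using succ_mod_inj n by (subst Y_mult_left) (auto simp: Y_inv_def)
  qed (auto simp: Y_mat_def Y_inv_def)
  show "Y_inv * Y_mat n = 1\<^sub>m n"
  proof (rule eq_matI)
    fix i j assume ij: "i < dim_row (1\<^sub>m n :: complex mat)" "j < dim_col (1\<^sub>m n :: complex mat)"
    then obtain m where m: "m < n" "(m + 1) mod n = i" using succ_mod_surj[of i] by auto
    have "(Y_inv * Y_mat n) $$ (i, j) = (\<Sum>l<n. Y_inv $$ (i, l) * Y_mat n $$ (l, j))"
      using ij by (intro mult_mat_entry) auto
    also have "\<dots> = (\<Sum>l<n. (if l = m then 1 else 0) * (if j = (l + 1) mod n then 1 else 0))"
      using ij m succ_mod_inj by (intro sum.cong refl) (auto simp: Y_entry Y_inv_entry)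
    also have "\<dots> = (if j = (m + 1) mod n then 1 else 0)"
      using m by (subst sum_delta_mult) auto
    also have "\<dots> = 1\<^sub>m n $$ (i, j)" using ij m by simp
    finally show "(Y_inv * Y_mat n) $$ (i, j) = 1\<^sub>m n $$ (i, j)" .
  qed (auto simp: Y_mat_def Y_inv_def)
qed auto

text \<open>Conjugation by \<open>X\<close> and, in \<open>conj_Y_entry\<close>, by
  \<open>Y\<close> act on single entries, so the twisted periodicity conditions can be stated
  for scalar functions.\<close>

lemma conj_X_entry:
  assumes "F \<in> carrier_mat n n" "i < n" "j < n"
  shows "(X_mat n d * F * minv (X_mat n d)) $$ (i, j) = \<epsilon> ^ i * \<epsilon>' ^ j * F $$ (i, j)"
proof -
  have "X_mat n d * F \<in> carrier_mat n n" using assms by (intro mult_carrier_mat) auto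
  then have "(X_mat n d * F * X_inv) $$ (i, j) = (X_mat n d * F) $$ (i, j) * \<epsilon>' ^ j"
    unfolding X_inv_def using assms(2,3) by (rule diag_mult_right)
  also have "(X_mat n d * F) $$ (i, j) = \<epsilon> ^ i * F $$ (i, j)"
    unfolding X_mat_def using assms by (rule diag_mult_left)
  finally show ?thesis by (simp add: minv_X)
qed

lemma conj_Y_entry:
  assumes "F \<in> carrier_mat n n" "i < n" "j < n"
  shows "(Y_mat n * F * minv (Y_mat n)) $$ (i, j) = F $$ ((i + 1) mod n, (j + 1) mod n)"
proof -
  have "Y_mat n * F \<in> carrier_mat n n" using assms by (intro mult_carrier_mat) auto
  then have "(Y_mat n * F * Y_inv) $$ (i, j) = (Y_mat n * F) $$ (i, (j + 1) mod n)"
    using assms by (intro Y_inv_mult_right) auto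
  also have "\<dots> = F $$ ((i + 1) mod n, (j + 1) mod n)"
    using assms by (intro Y_mult_left) auto
  finally show ?thesis by (simp add: minv_Y)
qed

lemma Y_power_entry:
  "i < n \<Longrightarrow> j < n \<Longrightarrow> (Y_mat n ^\<^sub>m k) $$ (i, j) = (if j = (i + k) mod n then 1 else 0)"
proof (induction k arbitrary: i j)
  case (Suc k)
  have "(Y_mat n ^\<^sub>m Suc k) $$ (i, j) = (\<Sum>m<n. (Y_mat n ^\<^sub>m k) $$ (i, m) * Y_mat n $$ (m, j))"
    unfolding pow_mat.simps using Suc by (intro mult_mat_entry pow_carrier_mat) auto
  also have "\<dots> = (\<Sum>m<n. (if m = (i + k) mod n then 1 else 0) * (if j = (m + 1) mod n then 1 else 0))"
    using Suc by (intro sum.cong refl) (simp add: Y_entry)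
  also have "\<dots> = (if j = ((i + k) mod n + 1) mod n then 1 else 0)"
    using n by (subst sum_delta_mult) auto
  finally show ?case by (simp add: mod_simps)
qed (auto simp: Y_mat_def)

lemma Y_inv_power_entry:
  "i < n \<Longrightarrow> j < n \<Longrightarrow> (Y_inv ^\<^sub>m k) $$ (i, j) = (if i = (j + k) mod n then 1 else 0)"
proof (induction k arbitrary: i j)
  case (Suc k)
  have "(Y_inv ^\<^sub>m Suc k) $$ (i, j) = (\<Sum>m<n. (Y_inv ^\<^sub>m k) $$ (i, m) * Y_inv $$ (m, j))"
    unfolding pow_mat.simps using Suc by (intro mult_mat_entry pow_carrier_mat) auto
  also have "\<dots> = (\<Sum>m<n. (if i = (m + k) mod n then 1 else 0) * (if m = (j + 1) mod n then 1 else 0))"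
    using Suc by (intro sum.cong refl) (simp add: Y_inv_entry)
  also have "\<dots> = (if i = ((j + 1) mod n + k) mod n then 1 else 0)"
    using n by (subst sum_delta_mult) auto
  finally show ?case by (simp add: mod_simps add_ac)
qed (auto simp: Y_inv_def)

lemma diag_power:
  "mat n n (\<lambda>(i, j). if i = j then f i else 0) ^\<^sub>m l = mat n n (\<lambda>(i, j). if i = j then f i ^ l else 0)" for f :: "nat \<Rightarrow> complex"
proof (induction l)
  case (Suc l)
  show ?case
    by (rule eq_matI) (auto simp: Suc diag_mult_right simp del: index_mult_mat(1))
qed auto

lemma X_power: "X_mat n d ^\<^sub>m l = mat n n (\<lambda>(i, j). if i = j then \<epsilon> ^ (i * l) else 0)"
  unfolding X_mat_def diag_power power_mult by (rule refl)

lemma X_inv_power: "X_inv ^\<^sub>m l = mat n n (\<lambda>(i, j). if i = j then \<epsilon>' ^ (i * l) else 0)"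
  unfolding X_inv_def diag_power power_mult by (rule refl)

lemma power_mults_carrier:
  "Y_mat n ^\<^sub>m k * X_inv ^\<^sub>m l \<in> carrier_mat n n" "X_mat n d ^\<^sub>m l * Y_inv ^\<^sub>m k \<in> carrier_mat n n"
  by (rule mult_carrier_mat[of _ n n]; rule pow_carrier_mat; simp)+

lemma Z_carrier [simp]: "Z_mat n d k l \<in> carrier_mat n n" "Z_dual n d k l \<in> carrier_mat n n"
  unfolding Z_mat_def Z_dual_def minv_X minv_Y by (simp_all only: smult_carrier_mat power_mults_carrier)

lemma Z_entry:
  assumes "i < n" "j < n"
  shows "Z_mat n d k l $$ (i, j) = (if j = (i + k) mod n then \<epsilon>' ^ (j * l) else 0)"
  unfolding Z_mat_def minv_X X_inv_power using assms
  by (subst diag_mult_right) (auto simp: pow_carrier_mat Y_power_entry)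

lemma Z_dual_entry:
  assumes "i < n" "j < n"
  shows "Z_dual n d k l $$ (i, j) = (if i = (j + k) mod n then \<epsilon> ^ (i * l) / of_nat n else 0)"
proof -
  have "(X_mat n d ^\<^sub>m l * Y_inv ^\<^sub>m k) $$ (i, j) = (if i = (j + k) mod n then \<epsilon> ^ (i * l) else 0)"
    unfolding X_power using assms
    by (subst diag_mult_left) (auto simp: pow_carrier_mat Y_inv_power_entry)
  moreover have "(1 / of_nat n \<cdot>\<^sub>m (X_mat n d ^\<^sub>m l * Y_inv ^\<^sub>m k)) $$ (i, j) =
      1 / of_nat n * (X_mat n d ^\<^sub>m l * Y_inv ^\<^sub>m k) $$ (i, j)"
    using assms carrier_matD[OF power_mults_carrier(2)[of l k]] by (intro index_smult_mat(1)) simp_all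
  ultimately show ?thesis unfolding Z_dual_def minv_Y by simp
qed

lemma I_set_eq: "I_set n = {..<n} \<times> {..<n} - {(0, 0)}"
proof -
  have "{..n - 1} = {..<n}" using n by auto
  then show ?thesis by (simp add: I_set_def)
qed

lemma mtrace_Z_dual_mult:
  assumes "c \<in> carrier_mat n n"
  shows "mtrace (Z_dual n d k l * c) = (\<Sum>j<n. \<epsilon> ^ ((j + k) mod n * l) / of_nat n * c $$ (j, (j + k) mod n))"
proof -
  have "mtrace (Z_dual n d k l * c) =
     (\<Sum>i<n. \<Sum>j<n. if i = (j + k) mod n then \<epsilon> ^ (i * l) / of_nat n * c $$ (j, i) else 0)"
    using assms by (subst mtrace_mult[of _ n]) (auto simp: Z_dual_entry intro!: sum.cong)
  also have "\<dots> = (\<Sum>j<n. \<Sum>i<n. if i = (j + k) mod n then \<epsilon> ^ (i * l) / of_nat n * c $$ (j, i) else 0)"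
    by (rule sum.swap)
  also have "\<dots> = (\<Sum>j<n. \<epsilon> ^ ((j + k) mod n * l) / of_nat n * c $$ (j, (j + k) mod n))"
    using n by (intro sum.cong refl sum_delta_lt) auto
  finally show ?thesis .
qed

lemma mtrace_Z_dual_0: "c \<in> carrier_mat n n \<Longrightarrow> mtrace (Z_dual n d 0 0 * c) = mtrace c / of_nat n"
  by (subst mtrace_Z_dual_mult) (auto simp: mtrace_def sum_divide_distrib)

lemma add_mod_less:
  "a < n \<Longrightarrow> b < n \<Longrightarrow> (a + b) mod n = (if a + b < n then a + b else a + b - n)" for a b :: nat
  by (simp add: mod_if)

text \<open>For a given row and column, exactly one \<open>Y\<^sup>k\<close> with \<open>k <
  n\<close> has a nonzero entry there.\<close>

lemma mod_add_left_bij: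
  assumes "p < n" "q < n"
  shows "\<exists>!k. k < n \<and> (p + k) mod n = q"
proof (rule ex_ex1I)
  show "\<exists>k. k < n \<and> (p + k) mod n = q"
    using assms by (intro exI[of _ "if p \<le> q then q - p else q + n - p"]) (auto simp: add_mod_less)
  fix k k' assume "k < n \<and> (p + k) mod n = q" "k' < n \<and> (p + k') mod n = q"
  then show "k = k'" using assms by (auto simp: add_mod_less split: if_splits)
qed

text \<open>The \<open>Z\<^sub>k\<^sub>l\<close> with all \<open>k, l < n\<close> and the
  \<open>Z\<^sup>\<or>\<^sub>k\<^sub>l\<close> are dual bases of the space of all matrices for
  the trace form, by orthogonality of characters; the term for \<open>(0, 0)\<close> is
  \<open>tr c / n\<close> times the identity, which vanishes for traceless
  \<open>c\<close>.\<close>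

lemma Z_completeness:
  assumes c: "c \<in> sl n" and pq: "p < n" "q < n"
  shows "(\<Sum>(k, l)\<in>I_set n. mtrace (Z_dual n d k l * c) * Z_mat n d k l $$ (p, q)) = c $$ (p, q)"
proof -
  let ?t = "\<lambda>k l. mtrace (Z_dual n d k l * c) * Z_mat n d k l $$ (p, q)"
  have cc: "c \<in> carrier_mat n n" "mtrace c = 0" using c by (auto simp: sl_def)
  obtain k0 where k0: "k0 < n" "(p + k0) mod n = q" and un: "\<And>k. k < n \<Longrightarrow> (p + k) mod n = q \<Longrightarrow> k = k0"
    using mod_add_left_bij[OF pq] by blast
  have inner: "(\<Sum>l<n. ?t k l) = (if k = k0 then c $$ (p, q) else 0)" if "k < n" for k
  proof (cases "k = k0")
    case False
    then have "q \<noteq> (p + k) mod n" using un[OF that] by auto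
    then show ?thesis using False pq by (simp add: Z_entry)
  next
    case True
    have "(\<Sum>l<n. ?t k l) = (\<Sum>l<n. \<Sum>j<n. (\<epsilon> ^ ((j + k) mod n * l) * \<epsilon>' ^ (q * l)) * (c $$ (j, (j + k) mod n) / of_nat n))"
      using True pq k0 by (simp add: Z_entry mtrace_Z_dual_mult[OF cc(1)] sum_distrib_left sum_distrib_right mult_ac)
    also have "\<dots> = (\<Sum>j<n. (\<Sum>l<n. \<epsilon> ^ ((j + k) mod n * l) * \<epsilon>' ^ (q * l)) * (c $$ (j, (j + k) mod n) / of_nat n))"
      by (subst sum.swap) (simp only: sum_distrib_right)
    also have "\<dots> = (\<Sum>j<n. if j = p then c $$ (j, (j + k) mod n) else 0)"
    proof (intro sum.cong refl)
      fix j assume j: "j \<in> {..<n}"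
      have "j < n" using j by simp
      then have "(j + k) mod n = q \<longleftrightarrow> j = p"
        using add_mod_less[of j k] add_mod_less[of p k] pq k0 unfolding True
        by (auto split: if_splits)
      then show "(\<Sum>l<n. \<epsilon> ^ ((j + k) mod n * l) * \<epsilon>' ^ (q * l)) * (c $$ (j, (j + k) mod n) / of_nat n) =
          (if j = p then c $$ (j, (j + k) mod n) else 0)"
        using n pq by (subst eps_orthogonal) auto
    qed
    also have "\<dots> = c $$ (p, q)" using pq True k0 by simp
    finally show ?thesis using True by simp
  qed
  have "(\<Sum>(k, l)\<in>{..<n} \<times> {..<n}. ?t k l) = (\<Sum>k<n. \<Sum>l<n. ?t k l)"
    by (simp add: sum.cartesian_product)
  also have "\<dots> = (\<Sum>k<n. if k = k0 then c $$ (p, q) else 0)"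
    using inner by (intro sum.cong) auto
  also have "\<dots> = c $$ (p, q)" using k0 by simp
  finally have "(\<Sum>(k, l)\<in>{..<n} \<times> {..<n}. ?t k l) = c $$ (p, q)" .
  moreover have "?t 0 0 = 0" using mtrace_Z_dual_0[OF cc(1)] cc(2) by simp
  ultimately show ?thesis unfolding I_set_eq using n by (subst sum_diff1) auto
qed

lemma Z_in_sl:
  assumes "(k, l) \<in> I_set n"
  shows "Z_mat n d k l \<in> sl n" "Z_dual n d k l \<in> sl n"
proof -
  have kl: "k < n" "l < n" "k \<noteq> 0 \<or> l \<noteq> 0" using assms by (auto simp: I_set_eq)
  have diag: "i = (i + k) mod n \<longleftrightarrow> k = 0" if "i < n" for i
    using that kl(1) by (auto simp: add_mod_less)
  have 1: "(\<Sum>i<n. if i = (i + k) mod n then \<epsilon>' ^ (i * l) else 0) = 0"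
  proof (cases "k = 0")
    case True
    then show ?thesis using eps_orthogonal[of 0 l] kl n by (simp add: mult.commute)
  qed (use diag in simp)
  have 2: "(\<Sum>i<n. if i = (i + k) mod n then \<epsilon> ^ (i * l) / of_nat n else 0) = 0"
  proof (cases "k = 0")
    case True
    then show ?thesis using eps_orthogonal[of l 0] kl n by (simp add: mult.commute sum_divide_distrib[symmetric])
  qed (use diag in simp)
  show "Z_mat n d k l \<in> sl n" "Z_dual n d k l \<in> sl n"
    using 1 2 by (simp_all add: sl_def mtrace_def carrier_matD[OF Z_carrier(1)] carrier_matD[OF Z_carrier(2)]
        Z_entry Z_dual_entry)
qed

end

section \<open>Tensors as endomorphisms\<close>

lemma tensor_index_less: "i < n \<Longrightarrow> p < n \<Longrightarrow> i * n + p < n * n" for n :: nat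
proof -
  assume "i < n" "p < n"
  then have "i * n + p < (i + 1) * n" by simp
  also have "\<dots> \<le> n * n" using \<open>i < n\<close> by (intro mult_right_mono) auto
  finally show ?thesis .
qed

lemma tensor_to_End_entry:
  "p < n \<Longrightarrow> q < n \<Longrightarrow> tensor_to_End n T c $$ (p, q) = (\<Sum>i<n. \<Sum>j<n. T $$ (i * n + p, j * n + q) * c $$ (j, i))"
  by (simp add: tensor_to_End_def)

lemma mat_sum_carrier [simp]: "mat_sum N F K \<in> carrier_mat N N"
  by (simp add: mat_sum_def)

lemma mat_sum_entry: "i < N \<Longrightarrow> j < N \<Longrightarrow> mat_sum N F K $$ (i, j) = (\<Sum>k\<in>K. F k $$ (i, j))"
  by (simp add: mat_sum_def)

lemma tensor_to_End_mat_sum: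
  "tensor_to_End n (mat_sum (n * n) F K) c = mat_sum n (\<lambda>k. tensor_to_End n (F k) c) K"
proof (rule eq_matI)
  fix p q assume "p < dim_row (mat_sum n (\<lambda>k. tensor_to_End n (F k) c) K)"
    "q < dim_col (mat_sum n (\<lambda>k. tensor_to_End n (F k) c) K)"
  then have pq: "p < n" "q < n" by (auto simp: mat_sum_def)
  have "tensor_to_End n (mat_sum (n * n) F K) c $$ (p, q) =
      (\<Sum>i<n. \<Sum>j<n. \<Sum>k\<in>K. F k $$ (i * n + p, j * n + q) * c $$ (j, i))"
    using pq by (simp add: tensor_to_End_entry mat_sum_entry tensor_index_less sum_distrib_right)
  also have "\<dots> = (\<Sum>i<n. \<Sum>k\<in>K. \<Sum>j<n. F k $$ (i * n + p, j * n + q) * c $$ (j, i))"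
    by (intro sum.cong refl sum.swap)
  also have "\<dots> = (\<Sum>k\<in>K. \<Sum>i<n. \<Sum>j<n. F k $$ (i * n + p, j * n + q) * c $$ (j, i))"
    by (rule sum.swap)
  finally show "tensor_to_End n (mat_sum (n * n) F K) c $$ (p, q) =
      mat_sum n (\<lambda>k. tensor_to_End n (F k) c) K $$ (p, q)"
    using pq by (simp add: tensor_to_End_entry mat_sum_entry)
qed (auto simp: mat_sum_def tensor_to_End_def)

lemma tensor_carrier [simp]: "tensor n A B \<in> carrier_mat (n * n) (n * n)"
  by (simp add: tensor_def)

lemma tensor_to_End_smult:
  assumes "T \<in> carrier_mat (n * n) (n * n)"
  shows "tensor_to_End n (a \<cdot>\<^sub>m T) c = a \<cdot>\<^sub>m tensor_to_End n T c"
  using assms by (intro eq_matI) (auto simp: tensor_to_End_def tensor_index_less sum_distrib_left mult_ac intro!: sum.cong)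

lemma tensor_smult_left:
  assumes "A \<in> carrier_mat n n"
  shows "tensor n (a \<cdot>\<^sub>m A) B = a \<cdot>\<^sub>m tensor n A B"
  using assms by (intro eq_matI) (auto simp: tensor_def less_mult_imp_div_less mult_ac)

lemma smult_sl: "A \<in> sl n \<Longrightarrow> a \<cdot>\<^sub>m A \<in> sl n"
  by (auto simp: sl_def mtrace_def sum_distrib_left[symmetric])

lemma mat_sum_tensor_in_sl_tensor_sl:
  fixes K :: "'a set"
  assumes fin: "finite K" and ab: "\<And>k. k \<in> K \<Longrightarrow> a k \<in> sl n" "\<And>k. k \<in> K \<Longrightarrow> b k \<in> sl n"
  shows "mat_sum (n * n) (\<lambda>k. tensor n (a k) (b k)) K \<in> sl_tensor_sl n"
proof -
  obtain h where h: "bij_betw h {..<card K} K"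
    using ex_bij_betw_nat_finite[OF fin] by (auto simp: atLeast0LessThan)
  have "mat_sum (n * n) (\<lambda>k. tensor n (a k) (b k)) K = mat_sum (n * n) (\<lambda>m. tensor n (a (h m)) (b (h m))) {..<card K}"
  proof -
    have "(\<Sum>k\<in>K. g k) = (\<Sum>m<card K. g (h m))" for g :: "'a \<Rightarrow> complex"
      using sum.reindex_bij_betw[OF h, of g] by simp
    then show ?thesis unfolding mat_sum_def by (simp only:)
  qed
  moreover have "h m \<in> K" if "m < card K" for m using h that by (auto simp: bij_betw_def)
  ultimately show ?thesis
    unfolding sl_tensor_sl_def mem_Collect_eq using ab
    by (intro exI[of _ "card K"] exI[of _ "\<lambda>m. a (h m)"] exI[of _ "\<lambda>m. b (h m)"]) simp
qed

text \<open>The first tensor factors are traceless, that is, orthogonal to the identity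
  matrix.\<close>

lemma sl_tensor_sl_one:
  assumes "T \<in> sl_tensor_sl n"
  shows "tensor_to_End n T (1\<^sub>m n) = 0\<^sub>m n n"
proof -
  obtain m a b where ab: "\<And>k. k < m \<Longrightarrow> a k \<in> sl n" "\<And>k. k < m \<Longrightarrow> b k \<in> sl n"
    and T: "T = mat_sum (n * n) (\<lambda>k. tensor n (a k) (b k)) {..<(m::nat)}"
    using assms unfolding sl_tensor_sl_def by blast
  have "tensor_to_End n (tensor n (a k) (b k)) (1\<^sub>m n) = 0 \<cdot>\<^sub>m b k" if "k < m" for k
    using ab[OF that] by (subst tensor_to_End_tensor) (auto simp: sl_def)
  moreover have "(0 \<cdot>\<^sub>m b k) $$ (i, j) = 0" if "k < m" "i < n" "j < n" for i j k
    using ab(2)[OF that(1)] that by (auto simp: sl_def)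
  ultimately show ?thesis unfolding T tensor_to_End_mat_sum
    by (intro eq_matI) (auto simp: mat_sum_def intro!: sum.neutral)
qed

text \<open>Elements of the tensor square of \<open>sl n\<close> kill the identity, so knowing
  them on traceless matrices is knowing them on all matrices; matrix units then give all
  entries.\<close>

lemma sl_tensor_sl_eqI:
  assumes n: "0 < n" and T: "T \<in> sl_tensor_sl n" "T' \<in> sl_tensor_sl n"
    and eq: "\<And>c. c \<in> sl n \<Longrightarrow> tensor_to_End n T c = tensor_to_End n T' c"
  shows "T = T'"
proof -
  have carr: "T \<in> carrier_mat (n * n) (n * n)" "T' \<in> carrier_mat (n * n) (n * n)"
    using T by (auto simp: sl_tensor_sl_def)
  have lin: "tensor_to_End n T (A - s \<cdot>\<^sub>m 1\<^sub>m n) $$ (p, q) = tensor_to_End n T A $$ (p, q) - s * tensor_to_End n T (1\<^sub>m n) $$ (p, q)"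
    if "A \<in> carrier_mat n n" "p < n" "q < n" for A s p q and T :: "complex mat"
    using that by (simp add: tensor_to_End_entry algebra_simps sum_subtractf sum_distrib_left)
  have all: "tensor_to_End n T A $$ (p, q) = tensor_to_End n T' A $$ (p, q)"
    if A: "A \<in> carrier_mat n n" and pq: "p < n" "q < n" for A p q
  proof -
    \<comment> \<open>the traceless part of \<open>A\<close>\<close>
    let ?c = "A - (mtrace A / of_nat n) \<cdot>\<^sub>m 1\<^sub>m n"
    have "?c \<in> sl n" using A n by (auto simp: sl_def mtrace_def sum_subtractf)
    then have "tensor_to_End n T ?c $$ (p, q) = tensor_to_End n T' ?c $$ (p, q)" using eq by simp
    then show ?thesis
      unfolding lin[OF A pq] sl_tensor_sl_one[OF T(1)] sl_tensor_sl_one[OF T(2)] using pq by simp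
  qed
  show ?thesis
  proof (rule eq_matI)
    fix r s assume "r < dim_row T'" "s < dim_col T'"
    then have rs: "r < n * n" "s < n * n" using carr by auto
    define i p j q where "i = r div n" "p = r mod n" "j = s div n" "q = s mod n"
    have b: "i < n" "p < n" "j < n" "q < n" and rs': "r = i * n + p" "s = j * n + q"
      using rs n by (auto simp: i_p_j_q_def less_mult_imp_div_less)
    define A :: "complex mat" where "A = mat n n (\<lambda>(x, y). if y = i then (if x = j then 1 else 0) else 0)"
    have "tensor_to_End n T A $$ (p, q) = T $$ (i * n + p, j * n + q)" for T
    proof -
      have "tensor_to_End n T A $$ (p, q) = (\<Sum>y<n. \<Sum>x<n. if x = j then (if y = i then T $$ (y * n + p, x * n + q) else 0) else 0)"
        using b unfolding tensor_to_End_entry[OF b(2,4)] by (intro sum.cong refl) (auto simp: A_def)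
      then show ?thesis using b by simp
    qed
    then show "T $$ (r, s) = T' $$ (r, s)"
      using all[of A p q] b unfolding rs' by (simp add: A_def)
  qed (use carr in auto)
qed

section \<open>The torus and its local coordinates\<close>

locale complex_torus =
  fixes \<tau> :: complex
  assumes im: "Im \<tau> > 0"
begin

abbreviation "\<pi> \<equiv> tproj \<tau>"

lemma mem_tproj: "w \<in> \<pi> z \<longleftrightarrow> w - z \<in> periods \<tau>"
  unfolding tproj_def periods_def by (auto simp: algebra_simps)

lemma lattice_0 [simp]: "0 \<in> periods \<tau>"
  unfolding periods_def by (auto intro!: exI[of _ "0 :: int"])

lemma lattice_add: "a \<in> periods \<tau> \<Longrightarrow> b \<in> periods \<tau> \<Longrightarrow> a + b \<in> periods \<tau>"
proof -
  assume "a \<in> periods \<tau>" "b \<in> periods \<tau>"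
  then obtain k l k' l' :: int where "a = of_int k + of_int l * \<tau>" "b = of_int k' + of_int l' * \<tau>"
    unfolding periods_def by blast
  then have "a + b = of_int (k + k') + of_int (l + l') * \<tau>" by (simp add: algebra_simps)
  then show ?thesis unfolding periods_def by blast
qed

lemma lattice_minus: "a \<in> periods \<tau> \<Longrightarrow> - a \<in> periods \<tau>"
proof -
  assume "a \<in> periods \<tau>"
  then obtain k l :: int where "a = of_int k + of_int l * \<tau>" unfolding periods_def by blast
  then have "- a = of_int (- k) + of_int (- l) * \<tau>" by (simp add: algebra_simps)
  then show ?thesis unfolding periods_def by blast
qed

lemma lattice_diff: "a \<in> periods \<tau> \<Longrightarrow> b \<in> periods \<tau> \<Longrightarrow> a - b \<in> periods \<tau>"
  using lattice_add[of a "- b"] lattice_minus[of b] by simp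

lemma tproj_eq_iff: "\<pi> z = \<pi> w \<longleftrightarrow> z - w \<in> periods \<tau>"
proof
  assume "\<pi> z = \<pi> w"
  then have "z \<in> \<pi> w" by (metis mem_tproj diff_self lattice_0)
  then show "z - w \<in> periods \<tau>" by (simp add: mem_tproj)
next
  assume zw: "z - w \<in> periods \<tau>"
  show "\<pi> z = \<pi> w"
  proof (intro equalityI subsetI)
    fix u assume "u \<in> \<pi> z"
    then show "u \<in> \<pi> w" using lattice_add[OF _ zw, of "u - z"] by (simp add: mem_tproj)
  next
    fix u assume "u \<in> \<pi> w"
    then show "u \<in> \<pi> z" using lattice_diff[OF _ zw, of "u - w"] by (simp add: mem_tproj)
  qed
qed

lemma one_in_lattice: "1 \<in> periods \<tau>" and tau_in_lattice: "\<tau> \<in> periods \<tau>"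
proof -
  have "1 = of_int 1 + of_int 0 * \<tau>" "\<tau> = of_int 0 + of_int 1 * \<tau>" by auto
  then show "1 \<in> periods \<tau>" "\<tau> \<in> periods \<tau>" unfolding periods_def by blast+
qed

lemma tproj_plus_lattice [simp]: "\<omega> \<in> periods \<tau> \<Longrightarrow> \<pi> (z + \<omega>) = \<pi> z"
  by (simp add: tproj_eq_iff)

lemma tproj_plus_1 [simp]: "\<pi> (z + 1) = \<pi> z"
  by (intro tproj_plus_lattice one_in_lattice)

lemma tproj_plus_tau [simp]: "\<pi> (z + \<tau>) = \<pi> z"
  by (intro tproj_plus_lattice tau_in_lattice)

text \<open>Nonzero periods have length at least \<open>2 \<rho>\<close>, so the projection to
  the torus is injective on balls of radius \<open>\<rho>\<close>.\<close>

definition \<rho> :: real where "\<rho> = min 1 (Im \<tau>) / 2"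

lemma rho_pos: "0 < \<rho>" using im by (simp add: \<rho>_def)

lemma lattice_small:
  assumes "\<omega> \<in> periods \<tau>" and small: "norm \<omega> < 2 * \<rho>"
  shows "\<omega> = 0"
proof -
  obtain a b :: int where ab: "\<omega> = of_int a + of_int b * \<tau>"
    using assms unfolding periods_def by blast
  have s: "norm \<omega> < 1" "norm \<omega> < Im \<tau>" using small by (auto simp: \<rho>_def)
  have "b = 0"
  proof (rule ccontr)
    assume "b \<noteq> 0"
    then have "1 * Im \<tau> \<le> abs (of_int b) * Im \<tau>" using im by (intro mult_right_mono) linarith+
    also have "\<dots> = abs (Im \<omega>)" using im by (simp add: ab abs_mult)
    also have "\<dots> \<le> norm \<omega>" by (rule abs_Im_le_cmod)
    finally show False using s by simp
  qed
  then have "norm \<omega> = abs (of_int a)" by (simp add: ab)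
  then have "a = 0" using s by (simp add: abs_if split: if_splits)
  then show ?thesis using \<open>b = 0\<close> by (simp add: ab)
qed

lemma tproj_inj_ball: "w \<in> ball x \<rho> \<Longrightarrow> w' \<in> ball x \<rho> \<Longrightarrow> \<pi> w = \<pi> w' \<Longrightarrow> w = w'"
proof -
  assume w: "w \<in> ball x \<rho>" "w' \<in> ball x \<rho>" and eq: "\<pi> w = \<pi> w'"
  have "norm (w - w') < 2 * \<rho>"
    using w dist_triangle_less_add[of w x \<rho> w' \<rho>] by (auto simp: dist_norm[symmetric] dist_commute)
  then have "w - w' = 0" using eq by (intro lattice_small) (auto simp: tproj_eq_iff)
  then show ?thesis by simp
qed

lemma closed_lattice: "closed (periods \<tau>)"
proof (rule discrete_imp_closed[of \<rho>])
  show "\<forall>x\<in>periods \<tau>. \<forall>y\<in>periods \<tau>. dist y x < \<rho> \<longrightarrow> y = x"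
  proof (intro ballI impI)
    fix x y assume "x \<in> periods \<tau>" "y \<in> periods \<tau>" "dist y x < \<rho>"
    then have "y - x = 0" using rho_pos by (intro lattice_small lattice_diff) (auto simp: dist_norm)
    then show "y = x" by simp
  qed
qed (rule rho_pos)

lemma open_tproj_neq: "open {z. \<pi> z \<noteq> \<pi> x}"
proof -
  have "{z. \<pi> z \<noteq> \<pi> x} = (\<lambda>z. z - x) -` (- periods \<tau>)" by (auto simp: tproj_eq_iff)
  also have "open \<dots>" using closed_lattice by (intro continuous_open_vimage) (auto intro!: continuous_intros)
  finally show ?thesis .
qed

lemma eventually_tproj_neq: "\<forall>\<^sub>F z in at x. \<pi> z \<noteq> \<pi> x"
proof -
  have "\<forall>\<^sub>F z in at x. z \<in> ball x \<rho> - {x}"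
    using rho_pos by (intro eventually_at_in_open) auto
  then show ?thesis
    by eventually_elim (use tproj_inj_ball[of _ x x] rho_pos in auto)
qed

lemma torus_open_torus [simp]: "torus_open \<tau> (torus \<tau>)"
  by (simp add: torus_open_def torus_def vimage_def)

lemma tproj_in_torus [simp]: "\<pi> z \<in> torus \<tau>" by (simp add: torus_def)

lemma torus_open_Int: "torus_open \<tau> U \<Longrightarrow> torus_open \<tau> V \<Longrightarrow> torus_open \<tau> (U \<inter> V)"
  by (auto simp: torus_open_def)

lemma torus_open_minus: "torus_open \<tau> U \<Longrightarrow> torus_open \<tau> (U - {\<pi> x})"
proof -
  assume U: "torus_open \<tau> U"
  have "\<pi> -` (U - {\<pi> x}) = \<pi> -` U \<inter> {z. \<pi> z \<noteq> \<pi> x}" by auto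
  moreover have "open (\<pi> -` U \<inter> {z. \<pi> z \<noteq> \<pi> x})"
    using U by (intro open_Int open_tproj_neq) (simp add: torus_open_def)
  ultimately have "open (\<pi> -` (U - {\<pi> x}))" by simp
  moreover have "U - {\<pi> x} \<subseteq> torus \<tau>" using U unfolding torus_open_def by blast
  ultimately show ?thesis unfolding torus_open_def by (rule conjI[rotated])
qed

lemma torus_open_preimage: "torus_open \<tau> U \<Longrightarrow> open (\<pi> -` U)"
  by (simp add: torus_open_def)

lemma eventually_in_punctured:
  assumes W: "torus_open \<tau> W" and z: "\<pi> z = \<pi> x" "\<pi> x \<in> W"
  shows "\<forall>\<^sub>F w in at z. \<pi> w \<in> W - {\<pi> x}"
proof -
  have "\<forall>\<^sub>F w in at z. w \<in> \<pi> -` W"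
    using z torus_open_preimage[OF W] by (intro eventually_at_in_open') auto
  then show ?thesis using eventually_tproj_neq[of z] by eventually_elim (use z in auto)
qed

lemma analytic_shift:
  assumes "g analytic_on {x}"
  shows "(\<lambda>z. g (z - \<omega>)) analytic_on {x + \<omega>}"
proof -
  have "(g \<circ> (\<lambda>z. z - \<omega>)) analytic_on {x + \<omega>}"
    using assms by (intro analytic_on_compose) (auto intro!: analytic_intros)
  then show ?thesis by (simp add: o_def)
qed

lemma holomorphic_iff_analytic_at:
  "open S \<Longrightarrow> f holomorphic_on S \<longleftrightarrow> (\<forall>z\<in>S. f analytic_on {z})"
  using analytic_on_open analytic_on_analytic_at by blast

lemma analytic_at_transform:
  "\<forall>\<^sub>F w in nhds z. f w = g w \<Longrightarrow> g analytic_on {z} \<Longrightarrow> f analytic_on {z}"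
  by (simp add: analytic_at_cong[OF _ refl])

lemma holomorphic_on_preimageI:
  assumes "torus_open \<tau> W" "\<And>z. \<pi> z \<in> W \<Longrightarrow> f analytic_on {z}"
  shows "f holomorphic_on \<pi> -` W"
  using assms(2) by (intro iffD2[OF holomorphic_iff_analytic_at[OF torus_open_preimage[OF assms(1)]]]) auto

lemma holomorphic_on_preimageD:
  assumes "torus_open \<tau> W" "f holomorphic_on \<pi> -` W" "\<pi> z \<in> W"
  shows "f analytic_on {z}"
  using iffD1[OF holomorphic_iff_analytic_at[OF torus_open_preimage[OF assms(1)]] assms(2)] assms(3) by auto

text \<open>On the torus \<open>x\<close> is one point, but its preimage is a whole translate of
  the lattice; a function extending at \<open>x\<close> extends at all these points because it
  is periodic.\<close>

lemma torus_removable_singularity: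
  assumes W: "torus_open \<tau> W"
    and g: "(\<lambda>z. g (\<pi> z)) holomorphic_on \<pi> -` (W - {\<pi> x})"
    and h: "h analytic_on {x}" and ev: "\<forall>\<^sub>F z in at x. g (\<pi> z) = h z"
  shows "(\<lambda>z. (g(\<pi> x := h x)) (\<pi> z)) holomorphic_on \<pi> -` W"
proof -
  let ?g = "\<lambda>z. (g(\<pi> x := h x)) (\<pi> z)"
  have "\<forall>\<^sub>F z in at x. ?g z = h z"
    using ev eventually_tproj_neq[of x] by eventually_elim simp
  then have "\<forall>\<^sub>F z in nhds x. ?g z = h z"
    by (auto simp: eventually_nhds_conv_at)
  from analytic_at_transform[OF this h] have atx: "?g analytic_on {x}" .
  have "?g analytic_on {z}" if z: "\<pi> z \<in> W" for z
  proof (cases "\<pi> z = \<pi> x")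
    case True
    define \<omega> where "\<omega> = z - x"
    have l: "\<omega> \<in> periods \<tau>" using True by (simp add: \<omega>_def tproj_eq_iff)
    have "\<pi> (w - \<omega>) = \<pi> w" for w using tproj_plus_lattice[OF l, of "w - \<omega>"] by simp
    then show ?thesis using analytic_shift[OF atx, of \<omega>] by (simp add: \<omega>_def)
  next
    case False
    have "\<forall>\<^sub>F w in nhds z. \<pi> w \<noteq> \<pi> x"
      using eventually_nhds_in_open[OF open_tproj_neq[of x], of z] False by simp
    then have "\<forall>\<^sub>F w in nhds z. ?g w = g (\<pi> w)" by eventually_elim simp
    moreover have "(\<lambda>z. g (\<pi> z)) analytic_on {z}"
      using z False by (intro holomorphic_on_preimageD[OF torus_open_minus[OF W] g]) auto
    ultimately show ?thesis by (rule analytic_at_transform)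
  qed
  then show ?thesis by (rule holomorphic_on_preimageI[OF W])
qed

text \<open>The coordinate is normalised to be \<open>z - x\<close> near \<open>x\<close>, so
  that multiplying a simple pole by it leaves the residue as the value at
  \<open>x\<close>.\<close>

definition is_coordinate :: "complex \<Rightarrow> (tpoint \<Rightarrow> complex) \<Rightarrow> tpoint set \<Rightarrow> bool" where
  "is_coordinate x f D \<longleftrightarrow> torus_open \<tau> D \<and> \<pi> x \<in> D \<and> torus_holomorphic_on \<tau> f D \<and>
     (\<forall>p\<in>D. f p = 0 \<longleftrightarrow> p = \<pi> x) \<and> (\<forall>\<^sub>F z in nhds x. f (\<pi> z) = z - x)"

lemma is_coordinate_D:
  assumes "is_coordinate x f W"
  shows "torus_open \<tau> W" "\<pi> x \<in> W"
    "torus_holomorphic_on \<tau> f W" "torus_holomorphic_on \<tau> f (W - {\<pi> x})"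
    "p \<in> W \<Longrightarrow> f p = 0 \<longleftrightarrow> p = \<pi> x" "\<forall>\<^sub>F z in at x. f (\<pi> z) = z - x"
  using assms unfolding is_coordinate_def torus_holomorphic_on_def
  by (auto simp: eventually_nhds_conv_at elim: holomorphic_on_subset)

lemma is_coordinate_Int:
  "is_coordinate x f D \<Longrightarrow> torus_open \<tau> U \<Longrightarrow> \<pi> x \<in> U \<Longrightarrow> is_coordinate x f (D \<inter> U)"
  unfolding is_coordinate_def torus_holomorphic_on_def
  by (auto intro: torus_open_Int elim: holomorphic_on_subset)

lemma inverse_coordinate_holomorphic:
  assumes "is_coordinate x f W"
  shows "torus_holomorphic_on \<tau> (\<lambda>p. inverse (f p)) (W - {\<pi> x})"
  using assms unfolding is_coordinate_def torus_holomorphic_on_def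
  by (auto intro!: holomorphic_on_inverse elim: holomorphic_on_subset)

text \<open>The local inverse of the projection on a small ball around \<open>x\<close>.\<close>

lemma coordinate_exists: "\<exists>f D. is_coordinate x f D"
proof -
  define D where "D = \<pi> ` ball x \<rho>"
  define f where "f p = (THE w. w \<in> ball x \<rho> \<and> \<pi> w = p) - x" for p
  have f: "f (\<pi> w) = w - x" if "w \<in> ball x \<rho>" for w
    using that tproj_inj_ball[of _ x w] unfolding f_def by (subst the_equality[of _ w]) auto
  \<comment> \<open>the preimage of \<open>D\<close> consists of translates of the ball\<close>
  have vim: "\<exists>\<omega>\<in>periods \<tau>. z - \<omega> \<in> ball x \<rho>" if z: "\<pi> z \<in> D" for z
  proof -
    obtain w where w: "w \<in> ball x \<rho>" "\<pi> z = \<pi> w" using z by (auto simp: D_def)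
    then show ?thesis by (intro bexI[of _ "z - w"]) (auto simp: tproj_eq_iff)
  qed
  have shift: "\<pi> (w - \<omega>) = \<pi> w" if "\<omega> \<in> periods \<tau>" for w \<omega>
    using tproj_plus_lattice[OF that, of "w - \<omega>"] by simp
  have "open (\<pi> -` D)"
  proof (subst open_subopen, intro ballI)
    fix z assume "z \<in> \<pi> -` D"
    then obtain \<omega> where l: "\<omega> \<in> periods \<tau>" "z - \<omega> \<in> ball x \<rho>" using vim by auto
    have "ball (x + \<omega>) \<rho> \<subseteq> \<pi> -` D"
    proof
      fix w assume "w \<in> ball (x + \<omega>) \<rho>"
      then have "w - \<omega> \<in> ball x \<rho>" by (simp add: dist_norm algebra_simps)
      then have "\<pi> (w - \<omega>) \<in> D" by (auto simp: D_def)
      then show "w \<in> \<pi> -` D" by (simp add: shift[OF l(1)])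
    qed
    moreover have "z \<in> ball (x + \<omega>) \<rho>" using l by (simp add: dist_norm algebra_simps)
    ultimately show "\<exists>T. open T \<and> z \<in> T \<and> T \<subseteq> \<pi> -` D" by blast
  qed
  then have D: "torus_open \<tau> D" by (auto simp: torus_open_def D_def)
  have an: "(\<lambda>z. f (\<pi> z)) analytic_on {z}" if z: "\<pi> z \<in> D" for z
  proof -
    obtain \<omega> where l: "\<omega> \<in> periods \<tau>" "z - \<omega> \<in> ball x \<rho>" using vim[OF z] by blast
    have "z \<in> ball (x + \<omega>) \<rho>" using l by (simp add: dist_norm algebra_simps)
    then have "\<forall>\<^sub>F w in nhds z. w \<in> ball (x + \<omega>) \<rho>" by (intro eventually_nhds_in_open) auto
    then have "\<forall>\<^sub>F w in nhds z. f (\<pi> w) = w - \<omega> - x"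
    proof eventually_elim
      case (elim w)
      then have "w - \<omega> \<in> ball x \<rho>" by (simp add: dist_norm algebra_simps)
      from f[OF this] show ?case by (simp add: shift[OF l(1)])
    qed
    moreover have "(\<lambda>w. w - \<omega> - x) analytic_on {z}" by (intro analytic_intros)
    ultimately show ?thesis by (rule analytic_at_transform)
  qed
  have "torus_holomorphic_on \<tau> f D"
    unfolding torus_holomorphic_on_def by (rule holomorphic_on_preimageI[OF D an])
  moreover have "\<forall>\<^sub>F z in nhds x. z \<in> ball x \<rho>"
    using rho_pos by (intro eventually_nhds_in_open) auto
  then have "\<forall>\<^sub>F z in nhds x. f (\<pi> z) = z - x" by eventually_elim (rule f)
  moreover have "f p = 0 \<longleftrightarrow> p = \<pi> x" if "p \<in> D" for p
    using that f rho_pos f[of x] by (auto simp: D_def)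
  moreover have "\<pi> x \<in> D" using rho_pos by (auto simp: D_def)
  ultimately show ?thesis unfolding is_coordinate_def using D by blast
qed

end

section \<open>Holomorphic matrix functions\<close>

lemma mat_holomorphic_on_cong:
  assumes "\<And>z. z \<in> S \<Longrightarrow> F z = G z"
  shows "mat_holomorphic_on n F S \<longleftrightarrow> mat_holomorphic_on n G S"
  unfolding mat_holomorphic_on_def using assms by (auto intro!: holomorphic_cong cong: holomorphic_cong)

lemma mat_holomorphic_on_subset:
  "mat_holomorphic_on n F S \<Longrightarrow> T \<subseteq> S \<Longrightarrow> mat_holomorphic_on n F T"
  unfolding mat_holomorphic_on_def by (meson holomorphic_on_subset)

lemma mat_holomorphic_on_mult:
  assumes F: "mat_holomorphic_on n F S" "\<And>z. z \<in> S \<Longrightarrow> F z \<in> carrier_mat n n"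
    and G: "mat_holomorphic_on n G S" "\<And>z. z \<in> S \<Longrightarrow> G z \<in> carrier_mat n n"
  shows "mat_holomorphic_on n (\<lambda>z. F z * G z) S"
  unfolding mat_holomorphic_on_def
proof (intro allI impI)
  fix i j assume ij: "i < n" "j < n"
  have "(\<lambda>z. \<Sum>m<n. F z $$ (i, m) * G z $$ (m, j)) holomorphic_on S"
    using F(1) G(1) ij unfolding mat_holomorphic_on_def by (intro holomorphic_intros) auto
  then show "(\<lambda>z. (F z * G z) $$ (i, j)) holomorphic_on S"
    by (rule holomorphic_transform) (simp only: mult_mat_entry[OF F(2) G(2) ij])
qed

lemma mat_holomorphic_on_smult:
  assumes f: "f holomorphic_on S" and F: "mat_holomorphic_on n F S" "\<And>z. z \<in> S \<Longrightarrow> F z \<in> carrier_mat n n"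
  shows "mat_holomorphic_on n (\<lambda>z. f z \<cdot>\<^sub>m F z) S"
  unfolding mat_holomorphic_on_def
proof (intro allI impI)
  fix i j assume ij: "i < n" "j < n"
  have "(\<lambda>z. f z * F z $$ (i, j)) holomorphic_on S"
    using f F(1) ij unfolding mat_holomorphic_on_def by (intro holomorphic_intros) auto
  then show "(\<lambda>z. (f z \<cdot>\<^sub>m F z) $$ (i, j)) holomorphic_on S"
  proof (rule holomorphic_transform)
    fix z assume "z \<in> S"
    from carrier_matD[OF F(2)[OF this]] ij show "f z * F z $$ (i, j) = (f z \<cdot>\<^sub>m F z) $$ (i, j)" by simp
  qed
qed

lemma mat_holomorphic_on_add:
  assumes F: "mat_holomorphic_on n F S" and G: "mat_holomorphic_on n G S" "\<And>z. z \<in> S \<Longrightarrow> G z \<in> carrier_mat n n"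
  shows "mat_holomorphic_on n (\<lambda>z. F z + G z) S"
  unfolding mat_holomorphic_on_def
proof (intro allI impI)
  fix i j assume ij: "i < n" "j < n"
  have "(\<lambda>z. F z $$ (i, j) + G z $$ (i, j)) holomorphic_on S"
    using F(1) G(1) ij unfolding mat_holomorphic_on_def by (intro holomorphic_intros) auto
  then show "(\<lambda>z. (F z + G z) $$ (i, j)) holomorphic_on S"
  proof (rule holomorphic_transform)
    fix z assume "z \<in> S"
    from carrier_matD[OF G(2)[OF this]] ij show "F z $$ (i, j) + G z $$ (i, j) = (F z + G z) $$ (i, j)" by simp
  qed
qed

lemma slD: "A \<in> sl n \<Longrightarrow> A \<in> carrier_mat n n" "A \<in> sl n \<Longrightarrow> mtrace A = 0"
  by (auto simp: sl_def)

lemma sl_iff: "A \<in> carrier_mat n n \<Longrightarrow> A \<in> sl n \<longleftrightarrow> (\<Sum>i<n. A $$ (i, i)) = 0"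
  by (auto simp: sl_def mtrace_def)

lemma add_sl: "A \<in> sl n \<Longrightarrow> B \<in> sl n \<Longrightarrow> A + B \<in> sl n"
  by (auto simp: sl_def mtrace_def sum.distrib)

lemma zero_sl [simp]: "0\<^sub>m n n \<in> sl n"
  by (auto simp: sl_def mtrace_def)

lemma eventually_at_shift:
  fixes a :: complex
  shows "eventually (\<lambda>w. R (w - a)) (at (z + a)) \<longleftrightarrow> eventually R (at z)"
  using eventually_filtermap[of R "\<lambda>w. w - a" "at (z + a)"] by (simp add: filtermap_at_shift)

lemma divided_zero_removable:
  assumes f: "f analytic_on {x :: complex}" and 0: "f x = 0"
  shows "\<exists>h. h analytic_on {x} \<and> (\<forall>\<^sub>F z in at x. f z / (z - x) = h z)"
proof -
  obtain S where S: "open S" "x \<in> S" "f holomorphic_on S" using f analytic_at by blast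
  let ?h = "\<lambda>z. if z = x then deriv f x else (f z - f x) / (z - x)"
  have "?h holomorphic_on S" by (rule pole_lemma_open[OF S(3,1)])
  then have "?h analytic_on {x}" using S analytic_at by blast
  moreover have "\<forall>\<^sub>F z in at x. f z / (z - x) = ?h z"
    using eventually_neq_at_within[of x x UNIV] by eventually_elim (simp add: 0)
  ultimately show ?thesis by blast
qed

section \<open>Twisted matrix functions\<close>

locale twisted_sheaf = complex_torus \<tau> + root_of_unity n d for \<tau> :: complex and n d :: nat
begin

abbreviation "twisted_sec \<equiv> sections (quotient_sheaf \<tau> n d)"

text \<open>Periodicity conditions on single entries can be carried through limits and used with
  Liouville's theorem for scalar functions.\<close>

lemma twisted_iff:
  "F \<in> twisted_sec U \<longleftrightarrow>
    (\<forall>z. \<pi> z \<in> U \<longrightarrow> F z \<in> sl n) \<and> (\<forall>z. \<pi> z \<notin> U \<longrightarrow> F z = 0\<^sub>m n n) \<and> mat_holomorphic_on n F (\<pi> -` U) \<and>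
    (\<forall>z. \<pi> z \<in> U \<longrightarrow> (\<forall>i<n. \<forall>j<n. F (z + 1) $$ (i, j) = \<epsilon> ^ i * \<epsilon>' ^ j * F z $$ (i, j) \<and>
        F (z + \<tau>) $$ (i, j) = F z $$ ((i + 1) mod n, (j + 1) mod n)))"
proof -
  have eqs: "F (z + 1) = X_mat n d * F z * minv (X_mat n d) \<longleftrightarrow>
        (\<forall>i<n. \<forall>j<n. F (z + 1) $$ (i, j) = \<epsilon> ^ i * \<epsilon>' ^ j * F z $$ (i, j))"
      "F (z + \<tau>) = Y_mat n * F z * minv (Y_mat n) \<longleftrightarrow>
        (\<forall>i<n. \<forall>j<n. F (z + \<tau>) $$ (i, j) = F z $$ ((i + 1) mod n, (j + 1) mod n))"
    if sl: "\<And>z. \<pi> z \<in> U \<Longrightarrow> F z \<in> sl n" and z: "\<pi> z \<in> U" for z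
  proof -
    have c: "F z \<in> carrier_mat n n" "F (z + 1) \<in> carrier_mat n n" "F (z + \<tau>) \<in> carrier_mat n n"
      using sl[of z] sl[of "z + 1"] sl[of "z + \<tau>"] z by (simp_all add: sl_def)
    have c': "X_mat n d * F z * minv (X_mat n d) \<in> carrier_mat n n" "Y_mat n * F z * minv (Y_mat n) \<in> carrier_mat n n"
      using c(1) by (auto simp: minv_X minv_Y intro!: mult_carrier_mat)
    have eq: "A = B \<longleftrightarrow> (\<forall>i<n. \<forall>j<n. A $$ (i, j) = B $$ (i, j))"
      if "A \<in> carrier_mat n n" "B \<in> carrier_mat n n" for A B :: "complex mat"
      using that by (auto intro: eq_matI)
    show "F (z + 1) = X_mat n d * F z * minv (X_mat n d) \<longleftrightarrow>
        (\<forall>i<n. \<forall>j<n. F (z + 1) $$ (i, j) = \<epsilon> ^ i * \<epsilon>' ^ j * F z $$ (i, j))"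
      unfolding eq[OF c(2) c'(1)] using conj_X_entry[OF c(1)] by simp
    show "F (z + \<tau>) = Y_mat n * F z * minv (Y_mat n) \<longleftrightarrow>
        (\<forall>i<n. \<forall>j<n. F (z + \<tau>) $$ (i, j) = F z $$ ((i + 1) mod n, (j + 1) mod n))"
      unfolding eq[OF c(3) c'(2)] using conj_Y_entry[OF c(1)] by simp
  qed
  show ?thesis
  proof (cases "\<forall>z. \<pi> z \<in> U \<longrightarrow> F z \<in> sl n")
    case True
    then have sl: "\<And>z. \<pi> z \<in> U \<Longrightarrow> F z \<in> sl n" by blast
    have E: "(\<pi> z \<in> U \<longrightarrow> F (z + 1) = X_mat n d * F z * minv (X_mat n d) \<and> F (z + \<tau>) = Y_mat n * F z * minv (Y_mat n)) \<longleftrightarrow>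
      (\<pi> z \<in> U \<longrightarrow> (\<forall>i<n. \<forall>j<n. F (z + 1) $$ (i, j) = \<epsilon> ^ i * \<epsilon>' ^ j * F z $$ (i, j) \<and>
        F (z + \<tau>) $$ (i, j) = F z $$ ((i + 1) mod n, (j + 1) mod n)))" for z
      using eqs[OF sl, of z] by blast
    show ?thesis unfolding quotient_sheaf_def lie_sheaf.select_convs mem_Collect_eq E using sl by auto
  next
    case False
    then show ?thesis unfolding quotient_sheaf_def lie_sheaf.select_convs mem_Collect_eq by auto
  qed
qed

lemma twisted_D:
  assumes "F \<in> twisted_sec U"
  shows "\<pi> z \<in> U \<Longrightarrow> F z \<in> sl n" "\<pi> z \<notin> U \<Longrightarrow> F z = 0\<^sub>m n n" "mat_holomorphic_on n F (\<pi> -` U)"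
    "\<pi> z \<in> U \<Longrightarrow> i < n \<Longrightarrow> j < n \<Longrightarrow> F (z + 1) $$ (i, j) = \<epsilon> ^ i * \<epsilon>' ^ j * F z $$ (i, j)"
    "\<pi> z \<in> U \<Longrightarrow> i < n \<Longrightarrow> j < n \<Longrightarrow> F (z + \<tau>) $$ (i, j) = F z $$ ((i + 1) mod n, (j + 1) mod n)"
  using assms unfolding twisted_iff by blast+

lemma twisted_carrier: "F \<in> twisted_sec U \<Longrightarrow> F z \<in> carrier_mat n n"
  by (cases "\<pi> z \<in> U") (auto dest: twisted_D(1) slD simp: twisted_D(2))

lemma twisted_I:
  assumes "\<And>z. \<pi> z \<in> U \<Longrightarrow> F z \<in> sl n" "\<And>z. \<pi> z \<notin> U \<Longrightarrow> F z = 0\<^sub>m n n" "mat_holomorphic_on n F (\<pi> -` U)"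
    "\<And>z i j. \<pi> z \<in> U \<Longrightarrow> i < n \<Longrightarrow> j < n \<Longrightarrow> F (z + 1) $$ (i, j) = \<epsilon> ^ i * \<epsilon>' ^ j * F z $$ (i, j)"
    "\<And>z i j. \<pi> z \<in> U \<Longrightarrow> i < n \<Longrightarrow> j < n \<Longrightarrow> F (z + \<tau>) $$ (i, j) = F z $$ ((i + 1) mod n, (j + 1) mod n)"
  shows "F \<in> twisted_sec U"
  unfolding twisted_iff using assms by blast

lemma twisted_restrict:
  assumes F: "F \<in> twisted_sec U" and V: "V \<subseteq> U"
  shows "(\<lambda>z. if \<pi> z \<in> V then F z else 0\<^sub>m n n) \<in> twisted_sec V"
proof (rule twisted_I)
  have "mat_holomorphic_on n F (\<pi> -` V)"
    using twisted_D(3)[OF F] by (rule mat_holomorphic_on_subset) (use V in auto)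
  then show "mat_holomorphic_on n (\<lambda>z. if \<pi> z \<in> V then F z else 0\<^sub>m n n) (\<pi> -` V)"
    by (subst mat_holomorphic_on_cong[of _ _ F]) auto
qed (use twisted_D[OF F] V in auto)

lemma twisted_smult:
  assumes F: "F \<in> twisted_sec U" and f: "torus_holomorphic_on \<tau> f U"
  shows "(\<lambda>z. f (\<pi> z) \<cdot>\<^sub>m F z) \<in> twisted_sec U"
proof (rule twisted_I)
  show "mat_holomorphic_on n (\<lambda>z. f (\<pi> z) \<cdot>\<^sub>m F z) (\<pi> -` U)"
    using f twisted_D(3)[OF F] twisted_carrier[OF F] unfolding torus_holomorphic_on_def by (intro mat_holomorphic_on_smult)
  fix z
  note dims = carrier_matD[OF twisted_carrier[OF F]]
  show "\<pi> z \<in> U \<Longrightarrow> f (\<pi> z) \<cdot>\<^sub>m F z \<in> sl n" by (intro smult_sl twisted_D(1)[OF F])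
  show "\<pi> z \<notin> U \<Longrightarrow> f (\<pi> z) \<cdot>\<^sub>m F z = 0\<^sub>m n n" by (simp add: twisted_D(2)[OF F])
  fix i j assume z: "\<pi> z \<in> U" "i < n" "j < n"
  show "(f (\<pi> (z + 1)) \<cdot>\<^sub>m F (z + 1)) $$ (i, j) = \<epsilon> ^ i * \<epsilon>' ^ j * (f (\<pi> z) \<cdot>\<^sub>m F z) $$ (i, j)"
    using z dims by (simp add: twisted_D(4)[OF F] mult_ac)
  show "(f (\<pi> (z + \<tau>)) \<cdot>\<^sub>m F (z + \<tau>)) $$ (i, j) = (f (\<pi> z) \<cdot>\<^sub>m F z) $$ ((i + 1) mod n, (j + 1) mod n)"
    using z dims twisted_D(5)[OF F z] n by simp
qed

lemma twisted_add:
  assumes F: "F \<in> twisted_sec U" and G: "G \<in> twisted_sec U"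
  shows "(\<lambda>z. F z + G z) \<in> twisted_sec U"
proof (rule twisted_I)
  show "mat_holomorphic_on n (\<lambda>z. F z + G z) (\<pi> -` U)"
    using twisted_D(3)[OF F] twisted_D(3)[OF G] twisted_carrier[OF G] by (intro mat_holomorphic_on_add)
  fix z
  note dims = carrier_matD[OF twisted_carrier[OF F]] carrier_matD[OF twisted_carrier[OF G]]
  show "\<pi> z \<in> U \<Longrightarrow> F z + G z \<in> sl n" by (intro add_sl twisted_D(1)[OF F] twisted_D(1)[OF G])
  show "\<pi> z \<notin> U \<Longrightarrow> F z + G z = 0\<^sub>m n n" by (simp add: twisted_D(2)[OF F] twisted_D(2)[OF G])
  fix i j assume z: "\<pi> z \<in> U" "i < n" "j < n"
  show "(F (z + 1) + G (z + 1)) $$ (i, j) = \<epsilon> ^ i * \<epsilon>' ^ j * (F z + G z) $$ (i, j)"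
    using z dims twisted_D(4)[OF F z] twisted_D(4)[OF G z] by (simp add: distrib_left)
  show "(F (z + \<tau>) + G (z + \<tau>)) $$ (i, j) = (F z + G z) $$ ((i + 1) mod n, (j + 1) mod n)"
    using z dims twisted_D(5)[OF F z] twisted_D(5)[OF G z] n by simp
qed

lemma twisted_analytic:
  assumes "torus_open \<tau> U" "F \<in> twisted_sec U" "\<pi> z \<in> U" "i < n" "j < n"
  shows "(\<lambda>w. F w $$ (i, j)) analytic_on {z}"
  using twisted_D(3)[OF assms(2)] assms(3-5)
  by (intro holomorphic_on_preimageD[OF assms(1)]) (auto simp: mat_holomorphic_on_def)

text \<open>As for functions on the torus, an extension at \<open>x\<close> yields extensions at
  all translates; here the shifts mix the entries, so the extensions of all entries are
  transported together. \<open>remove_sings\<close> gives the extended values without choices,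
  and they inherit the twisted periodicity because they are limits.\<close>

lemma twisted_removable_singularity:
  assumes W: "torus_open \<tau> W" "\<pi> x \<in> W" and F: "F \<in> twisted_sec (W - {\<pi> x})"
    and h: "\<And>i j. i < n \<Longrightarrow> j < n \<Longrightarrow> h i j analytic_on {x}"
    and ev: "\<And>i j. i < n \<Longrightarrow> j < n \<Longrightarrow> \<forall>\<^sub>F z in at x. F z $$ (i, j) = h i j z"
  shows "\<exists>T. T \<in> twisted_sec W \<and> (\<forall>z. \<pi> z \<noteq> \<pi> x \<longrightarrow> T z = F z) \<and> T x = mat n n (\<lambda>(i, j). h i j x)"
proof -
  note W' = torus_open_minus[OF W(1), of x]
  note punct = eventually_in_punctured[OF W(1) _ W(2)]
  \<comment> \<open>\<open>Q z\<close>: if \<open>z\<close> lies over \<open>x\<close>, all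
    entries extend at \<open>z\<close>. The maps \<open>I\<close> and \<open>J\<close> below
    describe how a shift by \<open>t\<close> permutes the entries, so that both periods are
    covered by one argument.\<close>
  define Q where "Q z \<longleftrightarrow> (\<pi> z = \<pi> x \<longrightarrow> (\<forall>i<n. \<forall>j<n. \<exists>h. h analytic_on {z} \<and> (\<forall>\<^sub>F w in at z. F w $$ (i, j) = h w)))" for z
  have shift: "Q (z + t) \<longleftrightarrow> Q z"
    if t: "t \<in> periods \<tau>"
      and i': "\<And>i j. i < n \<Longrightarrow> j < n \<Longrightarrow> I i < n \<and> J j < n"
      and surj: "\<And>i. i < n \<Longrightarrow> (\<exists>i'<n. I i' = i) \<and> (\<exists>i'<n. J i' = i)"
      and c: "\<And>i j. c i j \<noteq> 0"
      and eq: "\<And>z i j. \<pi> z \<in> W - {\<pi> x} \<Longrightarrow> i < n \<Longrightarrow> j < n \<Longrightarrow> F (z + t) $$ (i, j) = c i j * F z $$ (I i, J j)"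
    for t z I J c
  proof
    have pz: "\<pi> (z + t) = \<pi> z" using t by simp
    assume Qz: "Q z"
    show "Q (z + t)" unfolding Q_def
    proof (intro impI allI)
      fix i j assume x: "\<pi> (z + t) = \<pi> x" and ij: "i < n" "j < n"
      have "\<pi> z = \<pi> x" "I i < n" "J j < n" using x pz i'[OF ij] by simp_all
      then obtain h where h: "h analytic_on {z}" "\<forall>\<^sub>F w in at z. F w $$ (I i, J j) = h w"
        using Qz unfolding Q_def by blast
      have "\<forall>\<^sub>F w in at z. F (w + t) $$ (i, j) = c i j * h w"
        using h(2) punct[OF trans[OF pz[symmetric] x]] by eventually_elim (simp add: eq[OF _ ij])
      then have "\<forall>\<^sub>F w in at (z + t). F w $$ (i, j) = c i j * h (w - t)"
        using eventually_at_shift[of "\<lambda>w. F (w + t) $$ (i, j) = c i j * h w" t z] by simp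
      moreover have "(\<lambda>w. c i j * h (w - t)) analytic_on {z + t}"
        by (intro analytic_intros analytic_shift h)
      ultimately show "\<exists>h. h analytic_on {z + t} \<and> (\<forall>\<^sub>F w in at (z + t). F w $$ (i, j) = h w)" by blast
    qed
  next
    have pz: "\<pi> (z + t) = \<pi> z" using t by simp
    assume Qz: "Q (z + t)"
    show "Q z" unfolding Q_def
    proof (intro impI allI)
      fix i0 j0 assume x: "\<pi> z = \<pi> x" and ij0: "i0 < n" "j0 < n"
      obtain i j where ij: "i < n" "j < n" "I i = i0" "J j = j0" using surj[of i0] surj[of j0] ij0 by blast
      have "\<pi> (z + t) = \<pi> x" using x pz by simp
      then obtain h where h: "h analytic_on {z + t}" "\<forall>\<^sub>F w in at (z + t). F w $$ (i, j) = h w"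
        using Qz ij(1,2) unfolding Q_def by blast
      have "\<forall>\<^sub>F w in at z. F (w + t) $$ (i, j) = h (w + t)"
        using h(2) eventually_at_shift[of "\<lambda>w. F (w + t) $$ (i, j) = h (w + t)" t z] by simp
      then have "\<forall>\<^sub>F w in at z. F w $$ (i0, j0) = h (w + t) / c i j"
        using punct[OF x] by eventually_elim (use eq[OF _ ij(1,2)] ij(3,4) c[of i j] in \<open>auto simp: field_simps\<close>)
      moreover have "(\<lambda>w. h (w + t) / c i j) analytic_on {z}"
        using analytic_shift[OF h(1), of "- t"] c by (intro analytic_intros) auto
      ultimately show "\<exists>h. h analytic_on {z} \<and> (\<forall>\<^sub>F w in at z. F w $$ (i0, j0) = h w)" by blast
    qed
  qed
  have "Q (z + 1) \<longleftrightarrow> Q z" for z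
    by (rule shift[of 1 "\<lambda>i. i" "\<lambda>j. j" "\<lambda>i j. \<epsilon> ^ i * \<epsilon>' ^ j"]) (auto simp: one_in_lattice twisted_D(4)[OF F])
  moreover have "Q (z + \<tau>) \<longleftrightarrow> Q z" for z
    using n succ_mod_surj twisted_D(5)[OF F]
    by (intro shift[of \<tau> "\<lambda>i. (i + 1) mod n" "\<lambda>j. (j + 1) mod n" "\<lambda>i j. 1"]) (auto simp: tau_in_lattice)
  ultimately have inv: "Q (x + of_int a + of_int b * \<tau>) \<longleftrightarrow> Q x" for a b
    by (rule lattice_invariant)
  have Qx: "Q x" unfolding Q_def using h ev by blast
  have Q: "Q z" for z
  proof (cases "\<pi> z = \<pi> x")
    case True
    then obtain a b where "z - x = of_int a + of_int b * \<tau>" unfolding tproj_eq_iff periods_def by blast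
    then have "z = x + of_int a + of_int b * \<tau>" by (simp add: algebra_simps)
    then show ?thesis using inv Qx by simp
  qed (simp add: Q_def)
  \<comment> \<open>the extension of the entry \<open>(i, j)\<close>\<close>
  define L where "L i j z = remove_sings (\<lambda>w. F w $$ (i, j)) z" for i j z
  have L_off: "L i j z = F z $$ (i, j)" if "\<pi> z \<in> W - {\<pi> x}" "i < n" "j < n" for i j z
    unfolding L_def using twisted_analytic[OF W' F that] by (rule remove_sings_at_analytic)
  have ext: "\<exists>h. h analytic_on {z} \<and> (\<forall>\<^sub>F w in at z. F w $$ (i, j) = h w)"
    if "\<pi> z \<in> W" "i < n" "j < n" for z i j
  proof (cases "\<pi> z = \<pi> x")
    case True
    then show ?thesis using Q[of z] that by (auto simp: Q_def)
  next
    case False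
    then show ?thesis using that twisted_analytic[OF W' F, of z i j] by (intro exI[of _ "\<lambda>w. F w $$ (i, j)"]) auto
  qed
  have L_eq: "L i j z = h' z" if "h' analytic_on {z}" "\<forall>\<^sub>F w in at z. F w $$ (i, j) = h' w" for h' z i j
    using that remove_sings_cong[OF that(2) refl] by (simp add: L_def)
  have L_analytic: "L i j analytic_on {z}" if z: "\<pi> z \<in> W" and ij: "i < n" "j < n" for z i j
  proof -
    obtain h' where h': "h' analytic_on {z}" "\<forall>\<^sub>F w in at z. F w $$ (i, j) = h' w" using ext[OF z ij] by blast
    have "\<forall>\<^sub>F w in at z. \<pi> w \<in> W - {\<pi> x}"
    proof (cases "\<pi> z = \<pi> x")
      case True then show ?thesis by (rule punct)
    next
      case False
      then show ?thesis using z torus_open_preimage[OF W'] eventually_at_in_open'[of "\<pi> -` (W - {\<pi> x})" z] by simp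
    qed
    with h'(2) have "\<forall>\<^sub>F w in at z. L i j w = h' w"
      by eventually_elim (simp add: L_off[OF _ ij])
    then have "\<forall>\<^sub>F w in nhds z. L i j w = h' w"
      using L_eq[OF h'] by (simp add: eventually_nhds_conv_at)
    then show ?thesis using h'(1) by (rule analytic_at_transform)
  qed
  have L_tendsto: "(\<lambda>w. F w $$ (i, j)) \<midarrow>z\<rightarrow> L i j z" if z: "\<pi> z \<in> W" and ij: "i < n" "j < n" for z i j
  proof -
    obtain h' where h': "h' analytic_on {z}" "\<forall>\<^sub>F w in at z. F w $$ (i, j) = h' w" using ext[OF z ij] by blast
    have "h' \<midarrow>z\<rightarrow> h' z" using analytic_at_imp_isCont[OF h'(1)] by (simp add: isCont_def)
    then show ?thesis unfolding L_eq[OF h'] by (subst tendsto_cong[OF h'(2)])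
  qed
  have L_shift: "L i j (z + t) = c * L i' j' z"
    if t: "t \<in> periods \<tau>" and z: "\<pi> z \<in> W" and ij: "i < n" "j < n" "i' < n" "j' < n"
      and eq: "\<And>z. \<pi> z \<in> W - {\<pi> x} \<Longrightarrow> F (z + t) $$ (i, j) = c * F z $$ (i', j')" for i j i' j' t c z
  proof (cases "\<pi> z = \<pi> x")
    case False
    then show ?thesis using z t ij eq[of z] by (simp add: L_off)
  next
    case True
    have "(\<lambda>w. c * F w $$ (i', j')) \<midarrow>z\<rightarrow> c * L i' j' z"
      by (intro tendsto_intros L_tendsto z ij)
    then have "(\<lambda>w. F (w + t) $$ (i, j)) \<midarrow>z\<rightarrow> c * L i' j' z"
      by (rule Lim_transform_eventually) (use punct[OF True] in \<open>eventually_elim, simp add: eq\<close>)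
    then have "(\<lambda>w. F (w + (- t) + t) $$ (i, j)) \<midarrow>z - (- t)\<rightarrow> c * L i' j' z"
      by (rule LIM_offset)
    then have "(\<lambda>w. F w $$ (i, j)) \<midarrow>z + t\<rightarrow> c * L i' j' z" by simp
    then show ?thesis unfolding L_def by (rule remove_sings_eqI)
  qed
  define T where "T z = (if \<pi> z \<in> W then mat n n (\<lambda>(i, j). L i j z) else 0\<^sub>m n n)" for z
  have T_off: "T z = F z" if "\<pi> z \<noteq> \<pi> x" for z
    using that twisted_D(2)[OF F, of z] carrier_matD[OF twisted_carrier[OF F, of z]] L_off[of z]
    by (auto simp: T_def intro!: eq_matI)
  have "T \<in> twisted_sec W"
  proof (rule twisted_I)
    have "L i j holomorphic_on \<pi> -` W" if "i < n" "j < n" for i j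
      using L_analytic that by (intro holomorphic_on_preimageI[OF W(1)])
    then have "mat_holomorphic_on n (\<lambda>z. mat n n (\<lambda>(i, j). L i j z)) (\<pi> -` W)"
      by (simp add: mat_holomorphic_on_def)
    then show "mat_holomorphic_on n T (\<pi> -` W)"
      by (subst mat_holomorphic_on_cong[of _ _ "\<lambda>z. mat n n (\<lambda>(i, j). L i j z)"]) (auto simp: T_def)
    fix z
    show "\<pi> z \<notin> W \<Longrightarrow> T z = 0\<^sub>m n n" by (simp add: T_def)
    assume z: "\<pi> z \<in> W"
    have "(\<Sum>i<n. L i i z) = 0"
    proof (cases "\<pi> z = \<pi> x")
      case False
      then show ?thesis using z twisted_D(1)[OF F, of z] twisted_carrier[OF F, of z] by (simp add: L_off sl_iff)
    next
      case True
      have "(\<lambda>w. \<Sum>i<n. F w $$ (i, i)) \<midarrow>z\<rightarrow> (\<Sum>i<n. L i i z)"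
        using L_tendsto[OF z] by (intro tendsto_sum) auto
      moreover have "\<forall>\<^sub>F w in at z. (\<Sum>i<n. F w $$ (i, i)) = 0"
        using punct[OF True] by eventually_elim (use twisted_D(1)[OF F] sl_iff[OF twisted_carrier[OF F]] in simp)
      then have "(\<lambda>w. \<Sum>i<n. F w $$ (i, i)) \<midarrow>z\<rightarrow> 0" by (rule tendsto_eventually)
      ultimately show ?thesis by (rule LIM_unique)
    qed
    then show "T z \<in> sl n" using z by (auto simp: T_def sl_def mtrace_def)
    fix i j assume ij: "i < n" "j < n"
    show "T (z + 1) $$ (i, j) = \<epsilon> ^ i * \<epsilon>' ^ j * T z $$ (i, j)"
      using L_shift[of 1 z i j i j "\<epsilon> ^ i * \<epsilon>' ^ j", OF one_in_lattice z ij ij] twisted_D(4)[OF F _ ij] z ij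
      by (simp add: T_def)
    show "T (z + \<tau>) $$ (i, j) = T z $$ ((i + 1) mod n, (j + 1) mod n)"
      using L_shift[of \<tau> z i j "(i + 1) mod n" "(j + 1) mod n" 1, OF tau_in_lattice z ij] twisted_D(5)[OF F _ ij] z ij n
      by (simp add: T_def)
  qed
  moreover have "T x = mat n n (\<lambda>(i, j). h i j x)"
    using W(2) L_eq[OF h ev] by (auto simp: T_def intro!: eq_matI)
  ultimately show ?thesis using T_off by blast
qed

text \<open>By continuity, since the translates of \<open>x\<close> are isolated.\<close>

lemma twisted_eqI:
  assumes W: "torus_open \<tau> W" and F: "F \<in> twisted_sec W" and G: "G \<in> twisted_sec W"
    and eq: "\<And>z. \<pi> z \<noteq> \<pi> x \<Longrightarrow> F z = G z"
  shows "F = G"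
proof
  fix z
  show "F z = G z"
  proof (cases "\<pi> z \<in> W \<and> \<pi> z = \<pi> x")
    case False
    then show ?thesis using eq[of z] twisted_D(2)[OF F, of z] twisted_D(2)[OF G, of z] by auto
  next
    case True
    then have zW: "\<pi> z \<in> W" and zx: "\<pi> z = \<pi> x" by blast+
    have "F z $$ (i, j) = G z $$ (i, j)" if ij: "i < n" "j < n" for i j
    proof (rule LIM_unique)
      show "(\<lambda>w. F w $$ (i, j)) \<midarrow>z\<rightarrow> F z $$ (i, j)"
        using analytic_at_imp_isCont[OF twisted_analytic[OF W F zW ij]] by (simp only: isCont_def)
      have "(\<lambda>w. G w $$ (i, j)) \<midarrow>z\<rightarrow> G z $$ (i, j)"
        using analytic_at_imp_isCont[OF twisted_analytic[OF W G zW ij]] by (simp only: isCont_def)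
      moreover have "\<forall>\<^sub>F w in at z. G w $$ (i, j) = F w $$ (i, j)"
        using eventually_tproj_neq[of z] by eventually_elim (use eq zx in simp)
      ultimately show "(\<lambda>w. F w $$ (i, j)) \<midarrow>z\<rightarrow> G z $$ (i, j)"
        by (rule Lim_transform_eventually)
    qed
    then show ?thesis
      using carrier_matD[OF twisted_carrier[OF F, of z]] carrier_matD[OF twisted_carrier[OF G, of z]] by (intro eq_matI) auto
  qed
qed

text \<open>Dividing by the coordinate leaves a removable singularity, so the sections vanishing
  at \<open>x\<close> are the multiples of the coordinate.\<close>

lemma twisted_divide:
  assumes f: "is_coordinate x f W" and F: "F \<in> twisted_sec W" and F0: "F x = 0\<^sub>m n n"
  shows "\<exists>T \<in> twisted_sec W. \<forall>z. F z = f (\<pi> z) \<cdot>\<^sub>m T z"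
proof -
  note W = is_coordinate_D(1,2)[OF f]
    and fz = is_coordinate_D(5)[OF f]
    and ev = is_coordinate_D(6)[OF f]
  define G where "G = (\<lambda>z. inverse (f (\<pi> z)) \<cdot>\<^sub>m (if \<pi> z \<in> W - {\<pi> x} then F z else 0\<^sub>m n n))"
  have G: "G \<in> twisted_sec (W - {\<pi> x})"
    unfolding G_def by (intro twisted_smult[where f = "\<lambda>p. inverse (f p)"] twisted_restrict[OF F] inverse_coordinate_holomorphic[OF f]) auto
  have "\<exists>h. h analytic_on {x} \<and> (\<forall>\<^sub>F z in at x. F z $$ (i, j) / (z - x) = h z)" if "i < n" "j < n" for i j
    using that by (intro divided_zero_removable twisted_analytic[OF W(1) F W(2)]) (auto simp: F0)
  then obtain h where h: "\<And>i j. i < n \<Longrightarrow> j < n \<Longrightarrow> h i j analytic_on {x}"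
    "\<And>i j. i < n \<Longrightarrow> j < n \<Longrightarrow> \<forall>\<^sub>F z in at x. F z $$ (i, j) / (z - x) = h i j z"
    by metis
  have "\<forall>\<^sub>F z in at x. G z $$ (i, j) = h i j z" if ij: "i < n" "j < n" for i j
  proof -
    from ev h(2)[OF ij] eventually_in_punctured[OF W(1) refl W(2)] show ?thesis
    proof eventually_elim
      case (elim z)
      then show ?case using carrier_matD[OF twisted_carrier[OF F, of z]] ij by (simp add: G_def divide_inverse mult.commute)
    qed
  qed
  from twisted_removable_singularity[OF W G h(1) this] obtain T where
    T: "T \<in> twisted_sec W" "\<And>z. \<pi> z \<noteq> \<pi> x \<Longrightarrow> T z = G z" by blast
  have "F = (\<lambda>z. f (\<pi> z) \<cdot>\<^sub>m T z)"
  proof (rule twisted_eqI[OF W(1) F])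
    show "(\<lambda>z. f (\<pi> z) \<cdot>\<^sub>m T z) \<in> twisted_sec W"
      using f by (intro twisted_smult T(1)) (simp add: is_coordinate_def)
    fix z assume z: "\<pi> z \<noteq> \<pi> x"
    show "F z = f (\<pi> z) \<cdot>\<^sub>m T z"
      using fz[of "\<pi> z"] T(2)[OF z] z carrier_matD[OF twisted_carrier[OF F, of z]] twisted_D(2)[OF F, of z]
      by (auto simp: G_def intro!: eq_matI)
  qed
  then have "\<forall>z. F z = f (\<pi> z) \<cdot>\<^sub>m T z" by (rule fun_cong[THEN allI])
  then show ?thesis using T(1) by blast
qed

end

section \<open>Traceless endomorphisms of a bundle\<close>

text \<open>Makes tracelessness independent of the chart.\<close>

lemma mtrace_conj:
  assumes A: "A \<in> carrier_mat n n" and M: "M \<in> carrier_mat n n" and B: "B \<in> carrier_mat n n"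
    and BA: "B * A = 1\<^sub>m n"
  shows "mtrace (A * M * B) = mtrace M"
proof -
  have comm: "mtrace (C * D) = mtrace (D * C)" if "C \<in> carrier_mat n n" "D \<in> carrier_mat n n" for C D
    unfolding mtrace_mult[OF that] mtrace_mult[OF that(2,1)] by (subst sum.swap) (simp add: mult.commute)
  have "mtrace (A * M * B) = mtrace (B * (A * M))" using A M B by (intro comm) auto
  also have "B * (A * M) = B * A * M" using A M B by (simp add: assoc_mult_mat[of _ n n _ n _ n])
  also have "\<dots> = M" using M by (simp add: BA)
  finally show ?thesis .
qed

locale torus_bundle = complex_torus \<tau> for \<tau> :: complex +
  fixes n :: nat and P :: "'i vbundle"
  assumes vb: "vector_bundle \<tau> n P"
begin

abbreviation "Ad_sec \<equiv> sections (Ad_sheaf \<tau> n P)"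
abbreviation "g \<equiv> transition P"

lemma chart_open: "torus_open \<tau> (chart P i)"
  using vb by (auto simp: vector_bundle_def)

lemma chart_cover: "\<exists>i. \<pi> x \<in> chart P i"
proof -
  have "(\<Union>i. chart P i) = torus \<tau>" using vb by (auto simp: vector_bundle_def)
  then have "\<pi> x \<in> (\<Union>i. chart P i)" by simp
  then show ?thesis by blast
qed

lemma g_carrier: "p \<in> chart P i \<Longrightarrow> p \<in> chart P j \<Longrightarrow> g i j p \<in> carrier_mat n n"
  using vb by (auto simp: vector_bundle_def)

lemma g_cocycle: "p \<in> chart P i \<Longrightarrow> p \<in> chart P j \<Longrightarrow> p \<in> chart P k \<Longrightarrow> g i j p * g j k p = g i k p"
  using vb unfolding vector_bundle_def by blast

lemma g_holomorphic: "mat_holomorphic_on n (\<lambda>z. g i j (\<pi> z)) (\<pi> -` (chart P i \<inter> chart P j))"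
  using vb unfolding vector_bundle_def by blast

lemma g_self: assumes "p \<in> chart P i" shows "g i i p = 1\<^sub>m n"
proof -
  have c: "g i i p \<in> carrier_mat n n" using g_carrier assms by blast
  have "invertible_mat (g i i p)" using vb assms unfolding vector_bundle_def by blast
  then obtain B where B: "B * g i i p = 1\<^sub>m (dim_row B)" "g i i p * B = 1\<^sub>m n"
    using c unfolding invertible_mat_def inverts_mat_def by auto
  have "dim_row B = n" using arg_cong[OF B(1), of dim_col] c by simp
  moreover have "dim_col B = n" using arg_cong[OF B(2), of dim_col] by simp
  ultimately have Bc: "B \<in> carrier_mat n n" by auto
  have "g i i p = B * g i i p * g i i p" using c B(1) \<open>dim_row B = n\<close> by simp
  also have "\<dots> = B * (g i i p * g i i p)" using c Bc by (simp add: assoc_mult_mat[of _ n n _ n _ n])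
  also have "\<dots> = 1\<^sub>m n" using g_cocycle assms B(1) \<open>dim_row B = n\<close> by simp
  finally show ?thesis .
qed

lemma g_inverse: "p \<in> chart P i \<Longrightarrow> p \<in> chart P j \<Longrightarrow> g i j p * g j i p = 1\<^sub>m n"
  using g_cocycle[of p i j i] g_self[of p i] by simp

lemma Ad_iff:
  "s \<in> Ad_sec U \<longleftrightarrow>
    (\<forall>i p. p \<in> U \<longrightarrow> p \<in> chart P i \<longrightarrow> s i p \<in> sl n) \<and> (\<forall>i p. p \<notin> U \<inter> chart P i \<longrightarrow> s i p = 0\<^sub>m n n) \<and>
    (\<forall>i. mat_holomorphic_on n (\<lambda>z. s i (\<pi> z)) (\<pi> -` (U \<inter> chart P i))) \<and>
    (\<forall>i j p. p \<in> U \<longrightarrow> p \<in> chart P i \<longrightarrow> p \<in> chart P j \<longrightarrow> s i p * g i j p = g i j p * s j p)"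
  (is "_ \<longleftrightarrow> ?R")
proof
  assume s: "s \<in> Ad_sec U"
  then have s': "s \<in> end_sections \<tau> n P U" and tr: "\<And>i p. mtrace (s i p) = 0"
    unfolding Ad_sheaf_def by simp_all
  have val: "if p \<in> U \<inter> chart P i then s i p \<in> carrier_mat n n else s i p = 0\<^sub>m n n" for i p
    using s' unfolding end_sections_def by blast
  have hol: "mat_holomorphic_on n (\<lambda>z. s i (\<pi> z)) (\<pi> -` (U \<inter> chart P i))" for i
    using s' unfolding end_sections_def by blast
  have eq: "s i p * g i j p = g i j p * s j p" if "p \<in> U \<inter> chart P i \<inter> chart P j" for i j p
    using s' that unfolding end_sections_def by blast
  show ?R using val hol eq tr by (auto simp: sl_def split: if_splits)
next
  assume R: ?R
  have tr: "mtrace (s i p) = 0" for i p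
    using R slD(2)[of "s i p" n] slD(2)[OF zero_sl, of n] by (cases "p \<in> U \<inter> chart P i") auto
  have "s \<in> end_sections \<tau> n P U"
    unfolding end_sections_def mem_Collect_eq using R by (auto dest: slD(1))
  then show "s \<in> Ad_sec U" using tr unfolding Ad_sheaf_def by simp
qed

lemma Ad_D:
  assumes "s \<in> Ad_sec U"
  shows "p \<in> U \<Longrightarrow> p \<in> chart P i \<Longrightarrow> s i p \<in> sl n" "p \<notin> U \<or> p \<notin> chart P i \<Longrightarrow> s i p = 0\<^sub>m n n"
    "mat_holomorphic_on n (\<lambda>z. s i (\<pi> z)) (\<pi> -` (U \<inter> chart P i))"
    "p \<in> U \<Longrightarrow> p \<in> chart P i \<Longrightarrow> p \<in> chart P j \<Longrightarrow> s i p * g i j p = g i j p * s j p"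
  using assms unfolding Ad_iff by blast+

lemma Ad_I:
  assumes "\<And>i p. p \<in> U \<Longrightarrow> p \<in> chart P i \<Longrightarrow> s i p \<in> sl n"
    "\<And>i p. p \<notin> U \<or> p \<notin> chart P i \<Longrightarrow> s i p = 0\<^sub>m n n"
    "\<And>i. mat_holomorphic_on n (\<lambda>z. s i (\<pi> z)) (\<pi> -` (U \<inter> chart P i))"
    "\<And>i j p. p \<in> U \<Longrightarrow> p \<in> chart P i \<Longrightarrow> p \<in> chart P j \<Longrightarrow> s i p * g i j p = g i j p * s j p"
  shows "s \<in> Ad_sec U"
  unfolding Ad_iff using assms by blast

lemma Ad_carrier: "s \<in> Ad_sec U \<Longrightarrow> s i p \<in> carrier_mat n n"
  by (cases "p \<in> U \<and> p \<in> chart P i") (auto dest: Ad_D(1) slD simp: Ad_D(2))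

lemma Ad_in_sl: "s \<in> Ad_sec U \<Longrightarrow> s i p \<in> sl n"
  by (cases "p \<in> U \<and> p \<in> chart P i") (auto dest: Ad_D(1) simp: Ad_D(2))

lemma Ad_transport:
  assumes s: "s \<in> Ad_sec U" and p: "p \<in> U" "p \<in> chart P i" "p \<in> chart P j"
  shows "s i p = g i j p * s j p * g j i p"
proof -
  note c = Ad_carrier[OF s, of i p] Ad_carrier[OF s, of j p] g_carrier[OF p(2,3)] g_carrier[OF p(3,2)]
  have "s i p = s i p * (g i j p * g j i p)" using c by (simp add: g_inverse[OF p(2,3)])
  also have "\<dots> = s i p * g i j p * g j i p" using c by (simp add: assoc_mult_mat[of _ n n _ n _ n])
  finally show ?thesis using Ad_D(4)[OF s p] by simp
qed

lemma Ad_eqI: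
  assumes s: "s \<in> Ad_sec U" and t: "t \<in> Ad_sec U" and U: "U \<subseteq> chart P i0"
    and eq: "\<And>p. p \<in> U \<Longrightarrow> s i0 p = t i0 p"
  shows "s = t"
proof (intro ext)
  fix i p
  show "s i p = t i p"
  proof (cases "p \<in> U \<and> p \<in> chart P i")
    case True
    then have p: "p \<in> U" "p \<in> chart P i" "p \<in> chart P i0" using U by auto
    show ?thesis unfolding Ad_transport[OF s p] Ad_transport[OF t p] by (simp add: eq[OF p(1)])
  next
    case False
    then have "p \<notin> U \<or> p \<notin> chart P i" by blast
    then show ?thesis using Ad_D(2)[OF s] Ad_D(2)[OF t] by simp
  qed
qed

lemma Ad_restrict:
  assumes s: "s \<in> Ad_sec U" and V: "V \<subseteq> U"
  shows "(\<lambda>i p. if p \<in> V then s i p else 0\<^sub>m n n) \<in> Ad_sec V"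
proof (rule Ad_I)
  fix i
  have "mat_holomorphic_on n (\<lambda>z. s i (\<pi> z)) (\<pi> -` (V \<inter> chart P i))"
    using Ad_D(3)[OF s] by (rule mat_holomorphic_on_subset) (use V in auto)
  then show "mat_holomorphic_on n (\<lambda>z. if \<pi> z \<in> V then s i (\<pi> z) else 0\<^sub>m n n) (\<pi> -` (V \<inter> chart P i))"
    by (subst mat_holomorphic_on_cong[of _ _ "\<lambda>z. s i (\<pi> z)"]) auto
next
  fix i j p assume p: "p \<in> V" "p \<in> chart P i" "p \<in> chart P j"
  then have "p \<in> U" using V by blast
  from Ad_D(4)[OF s this p(2,3)] p(1)
  show "(if p \<in> V then s i p else 0\<^sub>m n n) * g i j p = g i j p * (if p \<in> V then s j p else 0\<^sub>m n n)" by simp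
next
  fix i p assume "p \<in> V" "p \<in> chart P i"
  then show "(if p \<in> V then s i p else 0\<^sub>m n n) \<in> sl n" using Ad_D(1)[OF s] V by auto
next
  fix i p assume "p \<notin> V \<or> p \<notin> chart P i"
  then show "(if p \<in> V then s i p else 0\<^sub>m n n) = 0\<^sub>m n n" using Ad_D(2)[OF s, of p i] by auto
qed

lemma Ad_smult:
  assumes s: "s \<in> Ad_sec U" and f: "torus_holomorphic_on \<tau> f U"
  shows "(\<lambda>i p. f p \<cdot>\<^sub>m s i p) \<in> Ad_sec U"
proof (rule Ad_I)
  fix i
  have "(\<lambda>z. f (\<pi> z)) holomorphic_on \<pi> -` (U \<inter> chart P i)"
    using f unfolding torus_holomorphic_on_def by (rule holomorphic_on_subset) auto
  then show "mat_holomorphic_on n (\<lambda>z. f (\<pi> z) \<cdot>\<^sub>m s i (\<pi> z)) (\<pi> -` (U \<inter> chart P i))"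
    by (rule mat_holomorphic_on_smult[OF _ Ad_D(3)[OF s] Ad_carrier[OF s]])
next
  fix i j p assume p: "p \<in> U" "p \<in> chart P i" "p \<in> chart P j"
  note c = Ad_carrier[OF s, of i p] Ad_carrier[OF s, of j p] g_carrier[OF p(2,3)]
  show "(f p \<cdot>\<^sub>m s i p) * g i j p = g i j p * (f p \<cdot>\<^sub>m s j p)"
    unfolding mult_smult_distrib[OF c(3,2)] mult_smult_assoc_mat[OF c(1,3)] Ad_D(4)[OF s p] ..
next
  fix i p assume "p \<in> U" "p \<in> chart P i"
  then show "f p \<cdot>\<^sub>m s i p \<in> sl n" by (intro smult_sl Ad_D(1)[OF s])
next
  fix i p assume "p \<notin> U \<or> p \<notin> chart P i"
  then show "f p \<cdot>\<^sub>m s i p = 0\<^sub>m n n" using Ad_D(2)[OF s] by simp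
qed

lemma Ad_add:
  assumes s: "s \<in> Ad_sec U" and t: "t \<in> Ad_sec U"
  shows "(\<lambda>i p. s i p + t i p) \<in> Ad_sec U"
proof (rule Ad_I)
  fix i
  show "mat_holomorphic_on n (\<lambda>z. s i (\<pi> z) + t i (\<pi> z)) (\<pi> -` (U \<inter> chart P i))"
    by (rule mat_holomorphic_on_add[OF Ad_D(3)[OF s] Ad_D(3)[OF t] Ad_carrier[OF t]])
next
  fix i j p assume p: "p \<in> U" "p \<in> chart P i" "p \<in> chart P j"
  note c = Ad_carrier[OF s, of i p] Ad_carrier[OF s, of j p] Ad_carrier[OF t, of i p] Ad_carrier[OF t, of j p] g_carrier[OF p(2,3)]
  show "(s i p + t i p) * g i j p = g i j p * (s j p + t j p)"
    unfolding add_mult_distrib_mat[OF c(1,3,5)] mult_add_distrib_mat[OF c(5,2,4)] Ad_D(4)[OF s p] Ad_D(4)[OF t p] ..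
next
  fix i p assume "p \<in> U" "p \<in> chart P i"
  then show "s i p + t i p \<in> sl n" by (intro add_sl Ad_D(1)[OF s] Ad_D(1)[OF t])
next
  fix i p assume "p \<notin> U \<or> p \<notin> chart P i"
  then show "s i p + t i p = 0\<^sub>m n n" using Ad_D(2)[OF s] Ad_D(2)[OF t] by simp
qed

text \<open>Conversely to \<open>Ad_eqI\<close>, every holomorphic traceless matrix function on
  a subset of a chart is the representative of a section, those in the other charts being its
  conjugates under the cocycle.\<close>

lemma Ad_from_chart:
  assumes W: "W \<subseteq> chart P i0" and M: "\<And>p. p \<in> W \<Longrightarrow> M p \<in> sl n"
    and hol: "mat_holomorphic_on n (\<lambda>z. M (\<pi> z)) (\<pi> -` W)"
  shows "\<exists>t \<in> Ad_sec W. \<forall>p \<in> W. t i0 p = M p"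
proof -
  define t where "t i p = (if p \<in> W \<inter> chart P i then g i i0 p * M p * g i0 i p else 0\<^sub>m n n)" for i p
  have Mc: "M p \<in> carrier_mat n n" if "p \<in> W" for p using M[OF that] by (rule slD)
  have "t \<in> Ad_sec W"
  proof (rule Ad_I)
    fix i
    have sub: "\<pi> -` (W \<inter> chart P i) \<subseteq> \<pi> -` (chart P i \<inter> chart P i0)"
      "\<pi> -` (W \<inter> chart P i) \<subseteq> \<pi> -` (chart P i0 \<inter> chart P i)" using W by auto
    have c: "g i i0 (\<pi> z) \<in> carrier_mat n n" "g i0 i (\<pi> z) \<in> carrier_mat n n" "M (\<pi> z) \<in> carrier_mat n n"
      if "z \<in> \<pi> -` (W \<inter> chart P i)" for z
      using that W Mc by (auto intro: g_carrier)
    have "mat_holomorphic_on n (\<lambda>z. g i i0 (\<pi> z) * M (\<pi> z) * g i0 i (\<pi> z)) (\<pi> -` (W \<inter> chart P i))"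
    proof (intro mat_holomorphic_on_mult)
      show "mat_holomorphic_on n (\<lambda>z. M (\<pi> z)) (\<pi> -` (W \<inter> chart P i))"
        using hol by (rule mat_holomorphic_on_subset) auto
      show "mat_holomorphic_on n (\<lambda>z. g i i0 (\<pi> z)) (\<pi> -` (W \<inter> chart P i))"
        using g_holomorphic sub(1) by (rule mat_holomorphic_on_subset)
      show "mat_holomorphic_on n (\<lambda>z. g i0 i (\<pi> z)) (\<pi> -` (W \<inter> chart P i))"
        using g_holomorphic sub(2) by (rule mat_holomorphic_on_subset)
    qed (use c in \<open>auto intro: mult_carrier_mat\<close>)
    then show "mat_holomorphic_on n (\<lambda>z. t i (\<pi> z)) (\<pi> -` (W \<inter> chart P i))"
      by (subst mat_holomorphic_on_cong[of _ _ "\<lambda>z. g i i0 (\<pi> z) * M (\<pi> z) * g i0 i (\<pi> z)"]) (auto simp: t_def)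
  next
    fix i j p assume p: "p \<in> W" "p \<in> chart P i" "p \<in> chart P j"
    then have p0: "p \<in> chart P i0" using W by blast
    note c = g_carrier[OF p(2) p0] g_carrier[OF p0 p(2)] g_carrier[OF p0 p(3)] g_carrier[OF p(3) p0] g_carrier[OF p(2,3)] Mc[OF p(1)]
    have "t i p * g i j p = g i i0 p * M p * (g i0 i p * g i j p)"
      using p c by (simp add: t_def assoc_mult_mat[of _ n n _ n _ n])
    also have "g i0 i p * g i j p = g i0 j p" by (rule g_cocycle[OF p0 p(2,3)])
    finally have 1: "t i p * g i j p = g i i0 p * M p * g i0 j p" .
    have "g i j p * t j p = (g i j p * g j i0 p) * M p * g i0 j p"
      using p c by (simp add: t_def assoc_mult_mat[of _ n n _ n _ n])
    also have "g i j p * g j i0 p = g i i0 p" by (rule g_cocycle[OF p(2,3) p0])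
    finally show "t i p * g i j p = g i j p * t j p" using 1 by simp
  next
    fix i p assume p: "p \<in> W" "p \<in> chart P i"
    then have p0: "p \<in> chart P i0" using W by blast
    note c = g_carrier[OF p(2) p0] g_carrier[OF p0 p(2)] Mc[OF p(1)]
    have "mtrace (t i p) = 0"
      using p mtrace_conj[OF c(1,3,2) g_inverse[OF p0 p(2)]] slD(2)[OF M[OF p(1)]] by (simp add: t_def)
    then show "t i p \<in> sl n" using p c by (auto simp: sl_def t_def intro!: mult_carrier_mat)
  qed (auto simp: t_def)
  moreover have "t i0 p = M p" if p: "p \<in> W" for p
  proof -
    have p0: "p \<in> chart P i0" using W p by blast
    show ?thesis using p p0 Mc[OF p] by (simp add: t_def g_self[OF p0])
  qed
  ultimately show ?thesis by blast
qed

lemma Ad_analytic: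
  assumes "torus_open \<tau> U" "s \<in> Ad_sec U" "\<pi> z \<in> U" "\<pi> z \<in> chart P i" "a < n" "b < n"
  shows "(\<lambda>w. s i (\<pi> w) $$ (a, b)) analytic_on {z}"
  using Ad_D(3)[OF assms(2), of i] assms(3-6)
  by (intro holomorphic_on_preimageD[OF torus_open_Int[OF assms(1) chart_open[of i]]]) (auto simp: mat_holomorphic_on_def)

text \<open>Inside one chart this is the removable singularity theorem for functions on the
  torus; the values at \<open>x\<close> are traceless by continuity.\<close>

lemma Ad_removable_singularity:
  assumes W: "torus_open \<tau> W" "\<pi> x \<in> W" "W \<subseteq> chart P i0" and s: "s \<in> Ad_sec (W - {\<pi> x})"
    and h: "\<And>a b. a < n \<Longrightarrow> b < n \<Longrightarrow> h a b analytic_on {x}"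
    and ev: "\<And>a b. a < n \<Longrightarrow> b < n \<Longrightarrow> \<forall>\<^sub>F z in at x. s i0 (\<pi> z) $$ (a, b) = h a b z"
  shows "\<exists>t \<in> Ad_sec W. (\<forall>i p. p \<noteq> \<pi> x \<longrightarrow> t i p = s i p) \<and> t i0 (\<pi> x) = mat n n (\<lambda>(a, b). h a b x)"
proof -
  define M where "M = (s i0)(\<pi> x := mat n n (\<lambda>(a, b). h a b x))"
  have "mat_holomorphic_on n (\<lambda>z. M (\<pi> z)) (\<pi> -` W)"
    unfolding mat_holomorphic_on_def
  proof (intro allI impI)
    fix a b assume ab: "a < n" "b < n"
    have "(W - {\<pi> x}) \<inter> chart P i0 = W - {\<pi> x}" using W(3) by blast
    then have "(\<lambda>z. s i0 (\<pi> z) $$ (a, b)) holomorphic_on \<pi> -` (W - {\<pi> x})"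
      using Ad_D(3)[OF s, of i0] ab by (simp add: mat_holomorphic_on_def)
    from torus_removable_singularity[OF W(1) this h[OF ab] ev[OF ab]]
    have "(\<lambda>z. ((\<lambda>p. s i0 p $$ (a, b))(\<pi> x := h a b x)) (\<pi> z)) holomorphic_on \<pi> -` W" .
    then show "(\<lambda>z. M (\<pi> z) $$ (a, b)) holomorphic_on \<pi> -` W"
      by (rule holomorphic_transform) (use ab in \<open>auto simp: M_def\<close>)
  qed
  moreover have "M p \<in> sl n" if "p \<in> W" for p
  proof (cases "p = \<pi> x")
    case False
    then show ?thesis using Ad_in_sl[OF s] by (simp add: M_def)
  next
    case True
    have "(\<lambda>w. \<Sum>a<n. h a a w) \<midarrow>x\<rightarrow> (\<Sum>a<n. h a a x)"
      using analytic_at_imp_isCont[OF h] by (intro tendsto_sum) (simp add: isCont_def)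
    moreover have "\<forall>\<^sub>F w in at x. (\<Sum>a<n. h a a w) = 0"
    proof -
      have "\<forall>\<^sub>F w in at x. \<forall>a\<in>{..<n}. s i0 (\<pi> w) $$ (a, a) = h a a w"
        using ev by (intro eventually_ball_finite) auto
      then show ?thesis
      proof eventually_elim
        case (elim w)
        then have "(\<Sum>a<n. h a a w) = (\<Sum>a<n. s i0 (\<pi> w) $$ (a, a))" by simp
        then show ?case using Ad_in_sl[OF s, of i0 "\<pi> w"] sl_iff[OF Ad_carrier[OF s, of i0 "\<pi> w"]] by simp
      qed
    qed
    then have "(\<lambda>w. \<Sum>a<n. h a a w) \<midarrow>x\<rightarrow> 0" by (rule tendsto_eventually)
    ultimately have "(\<Sum>a<n. h a a x) = 0" by (rule LIM_unique)
    then show ?thesis using True by (simp add: M_def sl_iff)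
  qed
  ultimately obtain t where t: "t \<in> Ad_sec W" "\<And>p. p \<in> W \<Longrightarrow> t i0 p = M p"
    using Ad_from_chart[OF W(3)] by blast
  have "(\<lambda>i p. if p \<in> W - {\<pi> x} then t i p else 0\<^sub>m n n) = s"
  proof (rule Ad_eqI[OF Ad_restrict[OF t(1)] s])
    show "W - {\<pi> x} \<subseteq> chart P i0" using W(3) by blast
    fix p assume "p \<in> W - {\<pi> x}"
    then show "(if p \<in> W - {\<pi> x} then t i0 p else 0\<^sub>m n n) = s i0 p" using t(2)[of p] by (simp add: M_def)
  qed blast
  then have ts: "(if p \<in> W - {\<pi> x} then t i p else 0\<^sub>m n n) = s i p" for i p by (rule fun_cong[THEN fun_cong])
  have "t i p = s i p" if "p \<noteq> \<pi> x" for i p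
    using ts[of p i] that Ad_D(2)[OF t(1), of p i] by (auto split: if_splits)
  moreover have "t i0 (\<pi> x) = mat n n (\<lambda>(a, b). h a b x)" using t(2)[OF W(2)] by (simp add: M_def)
  ultimately show ?thesis using t(1) by blast
qed

text \<open>The counterpart of \<open>twisted_divide\<close> for sections of
  \<open>Ad\<close>.\<close>

lemma Ad_divide:
  assumes f: "is_coordinate x f W" and Wc: "W \<subseteq> chart P i0" and s: "s \<in> Ad_sec W" and s0: "s i0 (\<pi> x) = 0\<^sub>m n n"
  shows "\<exists>t \<in> Ad_sec W. s = (\<lambda>i p. f p \<cdot>\<^sub>m t i p)"
proof -
  note W = is_coordinate_D(1,2)[OF f]
    and fz = is_coordinate_D(5)[OF f] and hol = is_coordinate_D(3)[OF f]
    and ev = is_coordinate_D(6)[OF f]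
  define u where "u = (\<lambda>i p. inverse (f p) \<cdot>\<^sub>m (if p \<in> W - {\<pi> x} then s i p else 0\<^sub>m n n))"
  have u: "u \<in> Ad_sec (W - {\<pi> x})"
    unfolding u_def by (rule Ad_smult[OF Ad_restrict[OF s] inverse_coordinate_holomorphic[OF f]]) blast
  have "\<exists>h. h analytic_on {x} \<and> (\<forall>\<^sub>F z in at x. s i0 (\<pi> z) $$ (a, b) / (z - x) = h z)" if "a < n" "b < n" for a b
    using that W(2) Wc by (intro divided_zero_removable Ad_analytic[OF W(1) s]) (auto simp: s0)
  then obtain h where h: "\<And>a b. a < n \<Longrightarrow> b < n \<Longrightarrow> h a b analytic_on {x}"
    "\<And>a b. a < n \<Longrightarrow> b < n \<Longrightarrow> \<forall>\<^sub>F z in at x. s i0 (\<pi> z) $$ (a, b) / (z - x) = h a b z"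
    by metis
  have "\<forall>\<^sub>F z in at x. u i0 (\<pi> z) $$ (a, b) = h a b z" if ab: "a < n" "b < n" for a b
  proof -
    from ev h(2)[OF ab] eventually_in_punctured[OF W(1) refl W(2)] show ?thesis
    proof eventually_elim
      case (elim z)
      then show ?case using carrier_matD[OF Ad_carrier[OF s, of i0 "\<pi> z"]] ab by (simp add: u_def divide_inverse mult.commute)
    qed
  qed
  from Ad_removable_singularity[OF W Wc u h(1) this] obtain t where
    t: "t \<in> Ad_sec W" "\<And>i p. p \<noteq> \<pi> x \<Longrightarrow> t i p = u i p" by blast
  have "s = (\<lambda>i p. f p \<cdot>\<^sub>m t i p)"
  proof (rule Ad_eqI[OF s Ad_smult[OF t(1) hol] Wc])
    fix p assume p: "p \<in> W"
    show "s i0 p = f p \<cdot>\<^sub>m t i0 p"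
    proof (cases "p = \<pi> x")
      case True
      then show ?thesis using fz[OF W(2)] s0 carrier_matD[OF Ad_carrier[OF t(1), of i0 p]] by (auto intro!: eq_matI)
    next
      case False
      then show ?thesis using fz[OF p] t(2)[OF False] p carrier_matD[OF Ad_carrier[OF s, of i0 p]]
        by (auto simp: u_def intro!: eq_matI)
    qed
  qed
  then show ?thesis using t(1) by blast
qed

lemma fibre_D:
  assumes "v \<in> Ad_fibre n P p"
  shows "p \<in> chart P i \<Longrightarrow> v i \<in> sl n" "p \<notin> chart P i \<Longrightarrow> v i = 0\<^sub>m n n"
    "p \<in> chart P i \<Longrightarrow> p \<in> chart P j \<Longrightarrow> v i * g i j p = g i j p * v j"
proof -
  have "if p \<in> chart P i then v i \<in> sl n else v i = 0\<^sub>m n n"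
    using assms unfolding Ad_fibre_def by blast
  then show "p \<in> chart P i \<Longrightarrow> v i \<in> sl n" "p \<notin> chart P i \<Longrightarrow> v i = 0\<^sub>m n n" by simp_all
  show "p \<in> chart P i \<Longrightarrow> p \<in> chart P j \<Longrightarrow> v i * g i j p = g i j p * v j"
    using assms unfolding Ad_fibre_def by blast
qed

lemma ev_in_fibre: "s \<in> Ad_sec U \<Longrightarrow> \<pi> x \<in> U \<Longrightarrow> ev_map \<tau> x s \<in> Ad_fibre n P (\<pi> x)"
  unfolding ev_map_def Ad_fibre_def mem_Collect_eq
  by (intro conjI allI impI) (simp_all add: Ad_D(1) Ad_D(2) Ad_D(4))

lemma fibre_eqI:
  assumes v: "v \<in> Ad_fibre n P p" and w: "w \<in> Ad_fibre n P p" and p: "p \<in> chart P i0" and eq: "v i0 = w i0"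
  shows "v = w"
proof
  fix i
  show "v i = w i"
  proof (cases "p \<in> chart P i")
    case False
    then show ?thesis using fibre_D(2)[OF v] fibre_D(2)[OF w] by simp
  next
    case True
    have tr: "v i = g i i0 p * v i0 * g i0 i p" if v: "v \<in> Ad_fibre n P p" for v
    proof -
      have vi: "v i \<in> carrier_mat n n" by (rule slD(1)[OF fibre_D(1)[OF v True]])
      note c = vi g_carrier[OF True p] g_carrier[OF p True]
      have "v i = v i * (g i i0 p * g i0 i p)" using c by (simp add: g_inverse[OF True p])
      also have "\<dots> = v i * g i i0 p * g i0 i p" using c by (simp add: assoc_mult_mat[of _ n n _ n _ n])
      also have "v i * g i i0 p = g i i0 p * v i0" by (rule fibre_D(3)[OF v True p])
      finally show ?thesis .
    qed
    show ?thesis unfolding tr[OF v] tr[OF w] eq ..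
  qed
qed

text \<open>A vector of the fibre extends to the section that is constant in one chart.\<close>

lemma fibre_extends:
  assumes v: "v \<in> Ad_fibre n P (\<pi> x)"
  shows "\<exists>U s. torus_open \<tau> U \<and> \<pi> x \<in> U \<and> s \<in> Ad_sec U \<and> ev_map \<tau> x s = v"
proof -
  obtain i0 where i0: "\<pi> x \<in> chart P i0" using chart_cover by blast
  have vi: "v i0 \<in> sl n" by (rule fibre_D(1)[OF v i0])
  have "\<exists>t\<in>Ad_sec (chart P i0). \<forall>p\<in>chart P i0. t i0 p = v i0"
    by (rule Ad_from_chart) (use vi in \<open>simp_all add: mat_holomorphic_on_def\<close>)
  then obtain s where s: "s \<in> Ad_sec (chart P i0)" "s i0 (\<pi> x) = v i0" using i0 by blast
  have "ev_map \<tau> x s = v"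
    using ev_in_fibre[OF s(1) i0] v i0 by (rule fibre_eqI) (simp only: ev_map_def s(2))
  then show ?thesis
    by (intro exI[of _ "chart P i0"] exI[of _ s] conjI chart_open i0 s(1))
qed

end

section \<open>Twisted functions are determined by their residue\<close>

context twisted_sheaf
begin

lemma succ_mod_bij: "bij_betw (\<lambda>i. (i + 1) mod n) {..<n} {..<n}"
proof (rule bij_betwI')
  fix i j assume "i \<in> {..<n}" "j \<in> {..<n}"
  then show "((i + 1) mod n = (j + 1) mod n) = (i = j)" using succ_mod_inj by simp
next
  fix i assume "i \<in> {..<n}"
  then show "(i + 1) mod n \<in> {..<n}" using n by simp
next
  fix j assume "j \<in> {..<n}"
  then obtain m where "m < n" "(m + 1) mod n = j" using succ_mod_surj[of j] by auto
  then show "\<exists>i\<in>{..<n}. j = (i + 1) mod n" by (intro bexI[of _ m]) auto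
qed

text \<open>The sum of the absolute values of all entries is doubly periodic, hence bounded, and
  Liouville's theorem makes every entry constant. The shift by 1 kills the entries off the
  diagonal, since \<open>\<epsilon>\<^sup>i \<noteq> \<epsilon>\<^sup>j\<close> for \<open>i
  \<noteq> j\<close>; the shift by \<open>\<tau>\<close> makes the diagonal entries equal, and
  their sum is 0.\<close>

lemma twisted_global_zero:
  assumes H: "H \<in> twisted_sec (torus \<tau>)"
  shows "H z = 0\<^sub>m n n"
proof -
  have entire: "(\<lambda>z. H z $$ (i, j)) holomorphic_on UNIV" if "i < n" "j < n" for i j
  proof -
    have "\<pi> -` torus \<tau> = UNIV" by auto
    then show ?thesis using twisted_D(3)[OF H] that by (simp add: mat_holomorphic_on_def)
  qed
  have s1: "H (z + 1) $$ (i, j) = \<epsilon> ^ i * \<epsilon>' ^ j * H z $$ (i, j)" if "i < n" "j < n" for z i j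
    using twisted_D(4)[OF H] that by simp
  have st: "H (z + \<tau>) $$ (i, j) = H z $$ ((i + 1) mod n, (j + 1) mod n)" if "i < n" "j < n" for z i j
    using twisted_D(5)[OF H] that by simp
  define N where "N z = (\<Sum>i<n. \<Sum>j<n. norm (H z $$ (i, j)))" for z
  have N1: "N (z + 1) = N z" for z
    unfolding N_def by (intro sum.cong refl) (simp add: s1 norm_mult norm_power norm_inverse)
  have Nt: "N (z + \<tau>) = N z" for z
  proof -
    have "N (z + \<tau>) = (\<Sum>i<n. \<Sum>j<n. norm (H z $$ ((i + 1) mod n, (j + 1) mod n)))"
      unfolding N_def by (intro sum.cong refl) (simp add: st)
    also have "\<dots> = (\<Sum>i<n. \<Sum>j<n. norm (H z $$ ((i + 1) mod n, j)))"
      by (intro sum.cong refl sum.reindex_bij_betw[OF succ_mod_bij])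
    also have "\<dots> = N z"
      unfolding N_def by (rule sum.reindex_bij_betw[OF succ_mod_bij])
    finally show ?thesis .
  qed
  have "continuous_on UNIV N"
    unfolding N_def by (intro continuous_intros holomorphic_on_imp_continuous_on entire) auto
  from periodic_bounded[OF im this N1 Nt] obtain M where M: "\<And>z. N z \<le> M" by blast
  have le_N: "norm (H z $$ (i, j)) \<le> N z" if ij: "i < n" "j < n" for z i j
  proof -
    have "norm (H z $$ (i, j)) \<le> (\<Sum>j<n. norm (H z $$ (i, j)))"
      by (rule member_le_sum) (use ij in auto)
    also have "\<dots> \<le> N z"
      unfolding N_def by (rule member_le_sum[where f = "\<lambda>i. \<Sum>j<n. norm (H z $$ (i, j))"]) (use ij in \<open>auto intro: sum_nonneg\<close>)
    finally show ?thesis .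
  qed
  have const: "H z $$ (i, j) = H w $$ (i, j)" if ij: "i < n" "j < n" for z w i j
  proof -
    have "bounded (range (\<lambda>z. H z $$ (i, j)))"
      unfolding bounded_iff using order_trans[OF le_N[OF ij] M] by blast
    from Liouville_theorem[OF entire[OF ij] this] show ?thesis by (auto simp: constant_on_def)
  qed
  have off: "H z $$ (i, j) = 0" if ij: "i < n" "j < n" "i \<noteq> j" for i j
  proof -
    have "\<epsilon> ^ i * \<epsilon>' ^ j \<noteq> 1"
    proof
      assume "\<epsilon> ^ i * \<epsilon>' ^ j = 1"
      then have "\<epsilon> ^ (i * l) * \<epsilon>' ^ (j * l) = 1" for l
        by (simp add: power_mult power_mult_distrib[symmetric])
      then have "(\<Sum>l<n. \<epsilon> ^ (i * l) * \<epsilon>' ^ (j * l)) = of_nat n" by simp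
      then show False using eps_orthogonal[OF ij(1,2)] ij n by simp
    qed
    moreover have "H z $$ (i, j) = \<epsilon> ^ i * \<epsilon>' ^ j * H z $$ (i, j)"
      using s1[OF ij(1,2), of z] const[OF ij(1,2), of "z + 1" z] by simp
    ultimately show ?thesis by simp
  qed
  have diag: "H z $$ (i, i) = H z $$ (0, 0)" if "i < n" for i
    using that
  proof (induction i)
    case (Suc i)
    then have "H z $$ (Suc i, Suc i) = H (z + \<tau>) $$ (i, i)" using st[of i i z] by simp
    also have "\<dots> = H z $$ (i, i)" using Suc by (intro const) auto
    finally show ?case using Suc by simp
  qed simp
  have "(\<Sum>i<n. H z $$ (i, i)) = (\<Sum>i<n. H z $$ (0, 0))"
    by (intro sum.cong refl diag) simp
  then have "(\<Sum>i<n. H z $$ (i, i)) = of_nat n * H z $$ (0, 0)" by simp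
  moreover have "(\<Sum>i<n. H z $$ (i, i)) = 0"
    by (rule iffD1[OF sl_iff[OF twisted_carrier[OF H]] twisted_D(1)[OF H tproj_in_torus]])
  ultimately have "H z $$ (0, 0) = 0" using n by simp
  then have "H z $$ (i, j) = 0" if "i < n" "j < n" for i j
    using that off[of i j] diag[of i] by (cases "i = j") simp_all
  then show ?thesis using carrier_matD[OF twisted_carrier[OF H, of z]] by (intro eq_matI) auto
qed

lemma twisted_minus:
  assumes F: "F \<in> twisted_sec U" and G: "G \<in> twisted_sec U"
  shows "(\<lambda>z. F z + (-1) \<cdot>\<^sub>m G z) \<in> twisted_sec U"
  using twisted_add[OF F twisted_smult[OF G, of "\<lambda>_. -1"]] by (simp add: torus_holomorphic_on_def)

lemma minus_eq_zero_iff: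
  assumes A: "A \<in> carrier_mat n n" and B: "B \<in> carrier_mat n n"
  shows "A + (-1) \<cdot>\<^sub>m B = 0\<^sub>m n n \<longleftrightarrow> A = (B :: complex mat)"
proof
  assume eq: "A + (-1) \<cdot>\<^sub>m B = 0\<^sub>m n n"
  show "A = B"
  proof (rule eq_matI)
    fix i j assume "i < dim_row B" "j < dim_col B"
    then show "A $$ (i, j) = B $$ (i, j)" using arg_cong[OF eq, of "\<lambda>M. M $$ (i, j)"] A B by simp
  qed (use A B in auto)
qed (use B in \<open>auto intro!: eq_matI\<close>)

text \<open>The values at \<open>x\<close> of \<open>S\<close> and \<open>T\<close> are the
  residues of \<open>F\<close> and \<open>G\<close>. If they agree, the difference of
  \<open>F\<close> and \<open>G\<close> extends over \<open>x\<close> to a global section, which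
  is zero.\<close>

lemma twisted_residue_unique:
  assumes f: "is_coordinate x f W"
    and F: "F \<in> twisted_sec (torus \<tau> - {\<pi> x})" and G: "G \<in> twisted_sec (torus \<tau> - {\<pi> x})"
    and S: "S \<in> twisted_sec W" "\<And>z. \<pi> z \<in> W - {\<pi> x} \<Longrightarrow> S z = f (\<pi> z) \<cdot>\<^sub>m F z"
    and T: "T \<in> twisted_sec W" "\<And>z. \<pi> z \<in> W - {\<pi> x} \<Longrightarrow> T z = f (\<pi> z) \<cdot>\<^sub>m G z"
    and eq: "S x = T x"
  shows "F = G"
proof -
  note W = is_coordinate_D(1,2)[OF f]
    and fz = is_coordinate_D(5)[OF f]
  define D where "D = (\<lambda>z. F z + (-1) \<cdot>\<^sub>m G z)"
  have D: "D \<in> twisted_sec (torus \<tau> - {\<pi> x})" unfolding D_def by (rule twisted_minus[OF F G])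
  define V where "V = (\<lambda>z. S z + (-1) \<cdot>\<^sub>m T z)"
  \<comment> \<open>\<open>V = f D\<close> away from \<open>x\<close>, and \<open>V\<close>
    vanishes at \<open>x\<close>, so dividing by \<open>f\<close> extends
    \<open>D\<close>\<close>
  have V: "V \<in> twisted_sec W" unfolding V_def by (rule twisted_minus[OF S(1) T(1)])
  have "V x = 0\<^sub>m n n"
    unfolding V_def minus_eq_zero_iff[OF twisted_carrier[OF S(1)] twisted_carrier[OF T(1)]] by (rule eq)
  then obtain R where R: "R \<in> twisted_sec W" "\<And>z. V z = f (\<pi> z) \<cdot>\<^sub>m R z"
    using twisted_divide[OF f V] by blast
  have DR: "D z = R z" if z: "\<pi> z \<in> W - {\<pi> x}" for z
  proof (rule eq_matI)
    note dims = carrier_matD[OF twisted_carrier[OF F, of z]] carrier_matD[OF twisted_carrier[OF G, of z]]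
      carrier_matD[OF twisted_carrier[OF R(1), of z]]
    fix i j assume "i < dim_row (R z)" "j < dim_col (R z)"
    then have ij: "i < n" "j < n" using dims by auto
    have "f (\<pi> z) \<cdot>\<^sub>m R z = f (\<pi> z) \<cdot>\<^sub>m F z + (-1) \<cdot>\<^sub>m (f (\<pi> z) \<cdot>\<^sub>m G z)"
      using R(2)[of z] S(2)[OF z] T(2)[OF z] by (simp add: V_def)
    from arg_cong[OF this, of "\<lambda>M. M $$ (i, j)"]
    have "f (\<pi> z) * R z $$ (i, j) = f (\<pi> z) * D z $$ (i, j)"
      using ij dims by (simp add: D_def algebra_simps)
    then show "D z $$ (i, j) = R z $$ (i, j)" using fz[of "\<pi> z"] z by simp
  qed (use carrier_matD[OF twisted_carrier[OF D, of z]] carrier_matD[OF twisted_carrier[OF R(1), of z]] in auto)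
  have "\<forall>\<^sub>F z in at x. D z $$ (i, j) = R z $$ (i, j)" for i j
    using eventually_in_punctured[OF W(1) refl W(2)] by eventually_elim (simp add: DR)
  then obtain H where H: "H \<in> twisted_sec (torus \<tau>)" "\<And>z. \<pi> z \<noteq> \<pi> x \<Longrightarrow> H z = D z"
    using twisted_removable_singularity[OF torus_open_torus tproj_in_torus D, of "\<lambda>i j z. R z $$ (i, j)"]
      twisted_analytic[OF W(1) R(1) W(2)] by blast
  show "F = G"
  proof
    fix z
    show "F z = G z"
    proof (cases "\<pi> z = \<pi> x")
      case True
      then show ?thesis using twisted_D(2)[OF F, of z] twisted_D(2)[OF G, of z] by simp
    next
      case False
      then have "D z = 0\<^sub>m n n" using H(2)[OF False] twisted_global_zero[OF H(1), of z] by simp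
      then show ?thesis unfolding D_def minus_eq_zero_iff[OF twisted_carrier[OF F] twisted_carrier[OF G]] .
    qed
  qed
qed

section \<open>The kernel of Belavin\<close>

text \<open>The scalar coefficient of \<open>Z\<^sup>\<or>\<^sub>k\<^sub>l \<otimes>
  Z\<^sub>k\<^sub>l\<close> in Belavin's r-matrix.\<close>

definition belavin_coeff :: "nat \<Rightarrow> nat \<Rightarrow> complex \<Rightarrow> complex" where
  "belavin_coeff k l z = exp (- (2 * of_real pi * \<i> * of_nat d / of_nat n) * of_nat k * z) *
     kronecker_sigma \<tau> (of_nat d / of_nat n * (of_nat l - of_nat k * \<tau>)) z"

lemma sigma_plus_1: "kronecker_sigma \<tau> a (z + 1) = kronecker_sigma \<tau> a z"
  using theta1_plus_1[OF im, of "a + z"] theta1_plus_1[OF im, of z]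
  by (simp add: kronecker_sigma_def add.assoc)

lemma sigma_plus_tau: "kronecker_sigma \<tau> a (z + \<tau>) = inverse (exp_pi a ^ 2) * kronecker_sigma \<tau> a z"
proof -
  define u v q where "u = exp_pi a" and "v = exp_pi z" and "q = exp_pi \<tau>"
  have nz: "u \<noteq> 0" "v \<noteq> 0" "q \<noteq> 0" by (simp_all add: u_def v_def q_def)
  have 1: "theta1 \<tau> (a + (z + \<tau>)) = - inverse (q * (u * v) ^ 2) * theta1 \<tau> (a + z)"
    using theta1_plus_tau[OF im, of "a + z"] by (simp add: exp_pi_add add.assoc u_def v_def q_def)
  have 2: "theta1 \<tau> (z + \<tau>) = - inverse (q * v ^ 2) * theta1 \<tau> z"
    using theta1_plus_tau[OF im, of z] by (simp add: v_def q_def)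
  have "D * (- inverse (q * (u * v) ^ 2) * A) / (B * (- inverse (q * v ^ 2) * C)) = inverse (u ^ 2) * (D * A / (B * C))"
    for A B C D :: complex
  proof -
    have "inverse (q * (u * v) ^ 2) = inverse (u ^ 2) * inverse (q * v ^ 2)"
      by (simp add: power_mult_distrib mult_ac)
    moreover have "inverse (q * v ^ 2) \<noteq> 0" using nz by simp
    ultimately show ?thesis by (simp add: divide_inverse mult_ac)
  qed
  then show ?thesis unfolding kronecker_sigma_def 1 2 u_def by (rule trans) (rule refl)
qed

lemma eps_inverse_power_exp: "\<epsilon>' ^ m = exp (- (2 * of_real pi * \<i> * of_nat d / of_nat n) * of_nat m)"
  by (simp add: eps_def exp_minus[symmetric] exp_of_nat_mult[symmetric] mult_ac)

lemma belavin_coeff_plus_1: "belavin_coeff k l (z + 1) = \<epsilon>' ^ k * belavin_coeff k l z"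
proof -
  define c where "c = 2 * of_real pi * \<i> * of_nat d / of_nat n"
  have "- c * of_nat k * (z + 1) = - c * of_nat k + (- c * of_nat k * z)"
    by (simp add: algebra_simps)
  then have "exp (- c * of_nat k * (z + 1)) = exp (- c * of_nat k) * exp (- c * of_nat k * z)"
    by (simp only: exp_add)
  then show ?thesis
    unfolding belavin_coeff_def sigma_plus_1 eps_inverse_power_exp c_def[symmetric] by (simp only: mult.assoc)
qed

text \<open>The exponential in front of \<open>\<sigma>\<close> removes the factor with \<open>k
  \<tau>\<close> from the quasi-period of \<open>\<sigma>\<close> and leaves the root of unity
  by which conjugation by \<open>Y\<close> acts on \<open>Z\<^sub>k\<^sub>l\<close>.\<close>

lemma belavin_coeff_plus_tau: "belavin_coeff k l (z + \<tau>) = \<epsilon>' ^ l * belavin_coeff k l z"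
proof -
  define c where "c = 2 * of_real pi * \<i> * of_nat d / of_nat n"
  define a where "a = of_nat d / of_nat n * (of_nat l - of_nat k * \<tau>)"
  have "inverse (exp_pi a ^ 2) = exp (- (c * (of_nat l - of_nat k * \<tau>)))"
    unfolding exp_pi_def exp_minus exp_of_nat_mult[symmetric] by (simp add: c_def a_def mult_ac)
  then have "exp (- c * of_nat k * (z + \<tau>)) * inverse (exp_pi a ^ 2) = exp (- c * of_nat k * (z + \<tau>) - c * (of_nat l - of_nat k * \<tau>))"
    by (simp add: exp_add[symmetric])
  also have "- c * of_nat k * (z + \<tau>) - c * (of_nat l - of_nat k * \<tau>) = - c * of_nat l + (- c * of_nat k * z)"
    by (simp add: algebra_simps)
  finally have "exp (- c * of_nat k * (z + \<tau>)) * inverse (exp_pi a ^ 2) = exp (- c * of_nat l) * exp (- c * of_nat k * z)"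
    by (simp only: exp_add)
  then show ?thesis
    unfolding belavin_coeff_def sigma_plus_tau eps_inverse_power_exp c_def[symmetric] a_def[symmetric]
    by (metis mult.assoc)
qed

lemma entire_analytic: "f holomorphic_on UNIV \<Longrightarrow> f analytic_on S"
  using analytic_on_open[of UNIV f] analytic_on_subset[of f UNIV S] by simp

lemma theta1_analytic: "theta1 \<tau> analytic_on S"
  by (rule entire_analytic[OF theta1_holomorphic[OF im]])

lemma exp_linear_analytic: "(\<lambda>z. exp (c * z)) analytic_on S" for c :: complex
  by (rule entire_analytic) (intro holomorphic_intros)

lemma theta1_add_analytic: "(\<lambda>z. theta1 \<tau> (a + z)) analytic_on S"
proof -
  have "(theta1 \<tau> \<circ> (\<lambda>z. a + z)) analytic_on S"
    by (intro analytic_on_compose theta1_analytic) (auto intro!: analytic_intros)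
  then show ?thesis by (simp add: o_def)
qed

lemma belavin_coeff_analytic:
  assumes "z \<notin> periods \<tau>"
  shows "belavin_coeff k l analytic_on {z}"
proof -
  define a where "a = of_nat d / of_nat n * (of_nat l - of_nat k * \<tau>)"
  have t: "theta1 \<tau> z \<noteq> 0" using assms by (simp add: theta1_eq_0_iff[OF im])
  have "(\<lambda>z. exp (- (2 * of_real pi * \<i> * of_nat d / of_nat n) * of_nat k * z) *
     ((deriv (theta1 \<tau>) 0 / theta1 \<tau> a) * theta1 \<tau> (a + z) / theta1 \<tau> z)) analytic_on {z}"
    using t by (intro analytic_on_mult analytic_on_divide analytic_on_const theta1_add_analytic theta1_analytic exp_linear_analytic) auto
  moreover have "belavin_coeff k l = (\<lambda>z. exp (- (2 * of_real pi * \<i> * of_nat d / of_nat n) * of_nat k * z) *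
     ((deriv (theta1 \<tau>) 0 / theta1 \<tau> a) * theta1 \<tau> (a + z) / theta1 \<tau> z))"
    by (rule ext) (simp add: belavin_coeff_def kronecker_sigma_def a_def divide_inverse mult_ac)
  ultimately show ?thesis by simp
qed

text \<open>If \<open>d (l - k \<tau>) / n\<close> were a period, \<open>n\<close> would divide
  \<open>d k\<close> and \<open>d l\<close>, hence \<open>k\<close> and \<open>l\<close>. So the
  value of the theta function in the denominator of the coefficient is not 0.\<close>

lemma torsion_not_period:
  assumes "(k, l) \<in> I_set n"
  shows "of_nat d / of_nat n * (of_nat l - of_nat k * \<tau>) \<notin> periods \<tau>"
proof
  assume "of_nat d / of_nat n * (of_nat l - of_nat k * \<tau>) \<in> periods \<tau>"
  then obtain a b :: int where ab: "of_nat d / of_nat n * (of_nat l - of_nat k * \<tau>) = of_int a + of_int b * \<tau>"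
    unfolding periods_def by blast
  have kl: "k < n" "l < n" "k \<noteq> 0 \<or> l \<noteq> 0" using assms by (auto simp: I_set_eq)
  have "of_nat d * (of_nat l - of_nat k * \<tau>) = of_nat n * (of_int a + of_int b * \<tau>)"
    using ab n by (simp add: field_simps)
  then have z: "of_real (real d * real l - real n * of_int a) = of_real (real d * real k + real n * of_int b) * \<tau>"
    by (simp add: algebra_simps)
  have "(real d * real k + real n * of_int b) * Im \<tau> = 0" using arg_cong[OF z, of Im] by simp
  then have k: "real d * real k + real n * of_int b = 0" using im by simp
  then have l: "real d * real l - real n * of_int a = 0" using arg_cong[OF z, of Re] by simp
  have dvd: "n dvd m" if "real d * real m = real n * of_int c" for m and c :: int
  proof -
    have "real_of_int (int (d * m)) = real_of_int (int n * c)" using that by simp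
    then have "int (d * m) = int n * c" by (simp only: of_int_eq_iff)
    then have "int n dvd int (d * m)" by simp
    then have "n dvd d * m" by (simp only: int_dvd_int_iff)
    then show "n dvd m" using cop by (simp add: coprime_commute coprime_dvd_mult_right_iff)
  qed
  have "n dvd k" using dvd[of k "- b"] k by simp
  moreover have "n dvd l" using dvd[of l a] l by simp
  ultimately show False using kl by (auto dest: dvd_imp_le)
qed

text \<open>The theta function is \<open>z\<close> times a function with value
  \<open>\<theta>'(0) \<noteq> 0\<close> at 0, and in the remaining quotient everything cancels
  at 0.\<close>

lemma belavin_coeff_simple_pole:
  assumes kl: "(k, l) \<in> I_set n"
  shows "\<exists>h. h analytic_on {0} \<and> h 0 = 1 \<and> (\<forall>z. z \<noteq> 0 \<longrightarrow> z * belavin_coeff k l z = h z)"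
proof -
  define a where "a = of_nat d / of_nat n * (of_nat l - of_nat k * \<tau>)"
  have ta: "theta1 \<tau> a \<noteq> 0"
    using torsion_not_period[OF kl] by (simp add: theta1_eq_0_iff[OF im] a_def)
  \<comment> \<open>the theta function divided by \<open>z\<close>\<close>
  define \<Theta> where "\<Theta> z = (if z = 0 then deriv (theta1 \<tau>) 0 else (theta1 \<tau> z - theta1 \<tau> 0) / (z - 0))" for z
  have "\<Theta> holomorphic_on UNIV"
    unfolding \<Theta>_def[abs_def] by (rule pole_lemma_open[OF theta1_holomorphic[OF im] open_UNIV])
  then have \<Theta>: "\<Theta> analytic_on {0}" by (rule entire_analytic)
  have d0: "deriv (theta1 \<tau>) 0 \<noteq> 0" by (rule deriv_theta1_0[OF im])
  define h where "h z = exp (- (2 * of_real pi * \<i> * of_nat d / of_nat n) * of_nat k * z) *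
     ((deriv (theta1 \<tau>) 0 / theta1 \<tau> a) * theta1 \<tau> (a + z) / \<Theta> z)" for z
  have "h analytic_on {0}"
    unfolding h_def[abs_def] using d0
    by (intro analytic_on_mult analytic_on_divide analytic_on_const theta1_add_analytic \<Theta> exp_linear_analytic)
      (auto simp: \<Theta>_def)
  moreover have "h 0 = 1" using ta d0 by (simp add: h_def \<Theta>_def)
  moreover have "z * belavin_coeff k l z = h z" if "z \<noteq> 0" for z
  proof -
    have "belavin_coeff k l z = exp (- (2 * of_real pi * \<i> * of_nat d / of_nat n) * of_nat k * z) *
        (deriv (theta1 \<tau>) 0 * theta1 \<tau> (a + z) / (theta1 \<tau> a * theta1 \<tau> z))"
      by (simp only: belavin_coeff_def kronecker_sigma_def a_def)
    then show ?thesis using that by (simp add: h_def \<Theta>_def divide_inverse mult_ac)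
  qed
  ultimately show ?thesis by blast
qed

text \<open>The value at \<open>z\<close> of the section with a simple pole at \<open>x\<close>
  and residue \<open>c\<close>, set to zero on the translates of \<open>x\<close>, as sections
  are outside their domain.\<close>

definition kernel :: "complex \<Rightarrow> complex mat \<Rightarrow> complex \<Rightarrow> complex mat" where
  "kernel x c z = (if \<pi> z = \<pi> x then 0\<^sub>m n n
     else mat_sum n (\<lambda>(k, l). (belavin_coeff k l (z - x) * mtrace (Z_dual n d k l * c)) \<cdot>\<^sub>m Z_mat n d k l) (I_set n))"

lemma kernel_entry:
  assumes "\<pi> z \<noteq> \<pi> x" "i < n" "j < n"
  shows "kernel x c z $$ (i, j) =
    (\<Sum>(k, l)\<in>I_set n. belavin_coeff k l (z - x) * (mtrace (Z_dual n d k l * c) * Z_mat n d k l $$ (i, j)))"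
  using assms carrier_matD[OF Z_carrier(1)]
  by (simp add: kernel_def mat_sum_entry case_prod_beta mult.assoc)

lemma kernel_carrier: "kernel x c z \<in> carrier_mat n n"
  by (simp add: kernel_def)

text \<open>For every \<open>(k, l)\<close>, the multipliers of the coefficient are the
  eigenvalues of conjugation by \<open>X\<close> and \<open>Y\<close> on
  \<open>Z\<^sub>k\<^sub>l\<close>.\<close>

lemma kernel_twisted:
  "kernel x c \<in> twisted_sec (torus \<tau> - {\<pi> x})"
proof (rule twisted_I)
  have open': "torus_open \<tau> (torus \<tau> - {\<pi> x})" by (intro torus_open_minus torus_open_torus)
  show "mat_holomorphic_on n (kernel x c) (\<pi> -` (torus \<tau> - {\<pi> x}))"
    unfolding mat_holomorphic_on_def
  proof (intro allI impI)
    fix i j assume ij: "i < n" "j < n"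
    have "(\<lambda>z. \<Sum>(k, l)\<in>I_set n. belavin_coeff k l (z - x) * (mtrace (Z_dual n d k l * c) * Z_mat n d k l $$ (i, j)))
        holomorphic_on \<pi> -` (torus \<tau> - {\<pi> x})"
    proof (rule holomorphic_on_preimageI[OF open'])
      fix z assume "\<pi> z \<in> torus \<tau> - {\<pi> x}"
      then have "z - x \<notin> periods \<tau>" by (simp add: tproj_eq_iff)
      then have "belavin_coeff k l analytic_on {z - x}" for k l by (rule belavin_coeff_analytic)
      from analytic_shift[OF this, of _ _ x] have "(\<lambda>w. belavin_coeff k l (w - x)) analytic_on {z}" for k l by simp
      then show "(\<lambda>z. \<Sum>(k, l)\<in>I_set n. belavin_coeff k l (z - x) * (mtrace (Z_dual n d k l * c) * Z_mat n d k l $$ (i, j)))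
        analytic_on {z}"
        unfolding case_prod_beta by (intro analytic_on_sum analytic_on_mult analytic_on_const)
    qed
    then show "(\<lambda>z. kernel x c z $$ (i, j)) holomorphic_on \<pi> -` (torus \<tau> - {\<pi> x})"
      by (rule holomorphic_transform) (use ij in \<open>simp add: kernel_entry\<close>)
  qed
  fix z
  show "\<pi> z \<notin> torus \<tau> - {\<pi> x} \<Longrightarrow> kernel x c z = 0\<^sub>m n n" by (simp add: kernel_def)
  assume "\<pi> z \<in> torus \<tau> - {\<pi> x}"
  then have z: "\<pi> z \<noteq> \<pi> x" by simp
  show "kernel x c z \<in> sl n"
  proof -
    have "(\<Sum>i<n. kernel x c z $$ (i, i)) =
      (\<Sum>i<n. \<Sum>(k, l)\<in>I_set n. belavin_coeff k l (z - x) * (mtrace (Z_dual n d k l * c) * Z_mat n d k l $$ (i, i)))"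
      using z by (intro sum.cong refl) (simp add: kernel_entry)
    also have "\<dots> = (\<Sum>(k, l)\<in>I_set n. \<Sum>i<n. belavin_coeff k l (z - x) * (mtrace (Z_dual n d k l * c) * Z_mat n d k l $$ (i, i)))"
      unfolding case_prod_beta by (rule sum.swap)
    also have "\<dots> = 0"
    proof (rule sum.neutral, clarify)
      fix k l assume "(k, l) \<in> I_set n"
      then have "(\<Sum>i<n. Z_mat n d k l $$ (i, i)) = 0" using Z_in_sl(1) sl_iff[OF Z_carrier(1)] by blast
      then show "(\<Sum>i<n. belavin_coeff k l (z - x) * (mtrace (Z_dual n d k l * c) * Z_mat n d k l $$ (i, i))) = 0"
        by (simp add: sum_distrib_left[symmetric])
    qed
    finally show ?thesis using sl_iff[OF kernel_carrier] by blast
  qed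
  fix i j assume ij: "i < n" "j < n"
  show "kernel x c (z + 1) $$ (i, j) = \<epsilon> ^ i * \<epsilon>' ^ j * kernel x c z $$ (i, j)"
  proof -
    have *: "belavin_coeff k l (z + 1 - x) * (t * Z_mat n d k l $$ (i, j)) =
        \<epsilon> ^ i * \<epsilon>' ^ j * (belavin_coeff k l (z - x) * (t * Z_mat n d k l $$ (i, j)))" for k l t
    proof (cases "j = (i + k) mod n")
      case True
      have "\<epsilon>' ^ j = \<epsilon>' ^ i * \<epsilon>' ^ k"
        unfolding True power_inverse eps_mod power_add by simp
      then have "\<epsilon> ^ i * \<epsilon>' ^ j = \<epsilon>' ^ k" using eps_inverse_power(2)[of i] by (simp only: mult.assoc[symmetric] mult_1)
      moreover have "belavin_coeff k l (z + 1 - x) = \<epsilon>' ^ k * belavin_coeff k l (z - x)"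
        using belavin_coeff_plus_1[of k l "z - x"] by (simp add: algebra_simps)
      ultimately show ?thesis by (simp only: mult.assoc)
    qed (simp add: Z_entry ij)
    show ?thesis
      using z ij by (simp add: kernel_entry sum_distrib_left case_prod_beta *)
  qed
  show "kernel x c (z + \<tau>) $$ (i, j) = kernel x c z $$ ((i + 1) mod n, (j + 1) mod n)"
  proof -
    have *: "belavin_coeff k l (z + \<tau> - x) * (t * Z_mat n d k l $$ (i, j)) =
        belavin_coeff k l (z - x) * (t * Z_mat n d k l $$ ((i + 1) mod n, (j + 1) mod n))" for k l t
    proof -
      have iff: "(j + 1) mod n = ((i + 1) mod n + k) mod n \<longleftrightarrow> j = (i + k) mod n"
        using succ_mod_inj[of j "(i + k) mod n"] ij n by (simp add: mod_simps add_ac)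
      have pow: "\<epsilon>' ^ ((j + 1) mod n * l) = \<epsilon>' ^ (j * l) * \<epsilon>' ^ l"
        unfolding power_mult power_inverse eps_mod by (simp add: power_mult_distrib mult.commute)
      have coe: "belavin_coeff k l (z + \<tau> - x) = \<epsilon>' ^ l * belavin_coeff k l (z - x)"
        using belavin_coeff_plus_tau[of k l "z - x"] by (simp add: algebra_simps)
      have "Z_mat n d k l $$ ((i + 1) mod n, (j + 1) mod n) = \<epsilon>' ^ l * Z_mat n d k l $$ (i, j)"
        using n by (simp only: Z_entry ij mod_less_divisor iff pow) (simp add: mult.commute)
      then show ?thesis by (simp only: coe mult_ac)
    qed
    show ?thesis using z ij n by (simp add: kernel_entry case_prod_beta *[unfolded Suc_eq_plus1[symmetric]])
  qed
qed

text \<open>\<open>T\<close> is the regular section obtained by multiplying the pole away; its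
  value at \<open>x\<close> is the residue, which is \<open>c\<close> by completeness of the
  \<open>Z\<^sub>k\<^sub>l\<close>.\<close>

lemma kernel_residue:
  assumes f: "is_coordinate x f W" and c: "c \<in> sl n"
  shows "\<exists>T \<in> twisted_sec W. T x = c \<and> (\<forall>z. \<pi> z \<in> W - {\<pi> x} \<longrightarrow> T z = f (\<pi> z) \<cdot>\<^sub>m kernel x c z)"
proof -
  note W = is_coordinate_D(1,2)[OF f] and hol = is_coordinate_D(3)[OF f]
    and ev = is_coordinate_D(6)[OF f]
  have sub: "W - {\<pi> x} \<subseteq> torus \<tau> - {\<pi> x}" using W(1) by (auto simp: torus_open_def)
  note hol' = is_coordinate_D(4)[OF f]
  define F where "F = (\<lambda>z. f (\<pi> z) \<cdot>\<^sub>m (if \<pi> z \<in> W - {\<pi> x} then kernel x c z else 0\<^sub>m n n))"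
  have F: "F \<in> twisted_sec (W - {\<pi> x})"
    unfolding F_def by (rule twisted_smult[OF twisted_restrict[OF kernel_twisted sub] hol'])
  define h where "h k l = (SOME h. h analytic_on {0} \<and> h 0 = 1 \<and> (\<forall>z. z \<noteq> 0 \<longrightarrow> z * belavin_coeff k l z = h z))" for k l
  have h: "h k l analytic_on {0}" "h k l 0 = 1" "\<And>z. z \<noteq> 0 \<Longrightarrow> z * belavin_coeff k l z = h k l z"
    if "(k, l) \<in> I_set n" for k l
    using someI_ex[OF belavin_coeff_simple_pole[OF that]] unfolding h_def by blast+
  define H where "H i j z = (\<Sum>(k, l)\<in>I_set n. h k l (z - x) * (mtrace (Z_dual n d k l * c) * Z_mat n d k l $$ (i, j)))" for i j z
  have H_an: "H i j analytic_on {x}" for i j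
  proof -
    have "(\<lambda>w. h k l (w - x)) analytic_on {x}" if "(k, l) \<in> I_set n" for k l
      using analytic_shift[OF h(1)[OF that], of x] by simp
    then show ?thesis
      unfolding H_def[abs_def] case_prod_beta by (intro analytic_on_sum analytic_on_mult analytic_on_const) auto
  qed
  have ev': "\<forall>\<^sub>F z in at x. F z $$ (i, j) = H i j z" if ij: "i < n" "j < n" for i j
  proof -
    from ev eventually_in_punctured[OF W(1) refl W(2)] eventually_neq_at_within[of x x UNIV] show ?thesis
    proof eventually_elim
      case (elim z)
      have "F z $$ (i, j) = (z - x) * kernel x c z $$ (i, j)"
        using elim ij carrier_matD[OF kernel_carrier[of x c z]] by (simp add: F_def)
      also have "\<dots> = (\<Sum>(k, l)\<in>I_set n. ((z - x) * belavin_coeff k l (z - x)) * (mtrace (Z_dual n d k l * c) * Z_mat n d k l $$ (i, j)))"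
        using elim ij by (simp add: kernel_entry sum_distrib_left case_prod_beta mult.assoc)
      also have "\<dots> = H i j z"
        unfolding H_def using elim by (intro sum.cong refl) (auto simp: h(3))
      finally show ?case .
    qed
  qed
  obtain T where T: "T \<in> twisted_sec W" "\<And>z. \<pi> z \<noteq> \<pi> x \<Longrightarrow> T z = F z" "T x = mat n n (\<lambda>(i, j). H i j x)"
    using twisted_removable_singularity[OF W F H_an ev'] by blast
  have "H i j x = c $$ (i, j)" if ij: "i < n" "j < n" for i j
  proof -
    have "H i j x = (\<Sum>(k, l)\<in>I_set n. mtrace (Z_dual n d k l * c) * Z_mat n d k l $$ (i, j))"
      unfolding H_def by (intro sum.cong refl) (auto simp: h(2))
    then show ?thesis using Z_completeness[OF c ij] by simp
  qed
  then have "T x = c" using slD(1)[OF c] unfolding T(3) by (intro eq_matI) auto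
  moreover have "T z = f (\<pi> z) \<cdot>\<^sub>m kernel x c z" if "\<pi> z \<in> W - {\<pi> x}" for z
    using T(2)[of z] that by (simp add: F_def)
  ultimately show ?thesis using T(1) by blast
qed

end

section \<open>Comparing fibres through the isomorphism\<close>

locale trivialized_bundle = twisted_sheaf \<tau> n d + torus_bundle \<tau> n P
  for \<tau> :: complex and n d :: nat and P :: "'i vbundle" +
  fixes \<phi> :: "tpoint set \<Rightarrow> ('i \<Rightarrow> tpoint \<Rightarrow> complex mat) \<Rightarrow> complex \<Rightarrow> complex mat"
  assumes iso: "lie_sheaf_iso \<tau> (Ad_sheaf \<tau> n P) (quotient_sheaf \<tau> n d) \<phi>"
begin

lemma phi_bij: "torus_open \<tau> U \<Longrightarrow> bij_betw (\<phi> U) (Ad_sec U) (twisted_sec U)"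
  using iso unfolding lie_sheaf_iso_def by blast

lemma phi_in: "torus_open \<tau> U \<Longrightarrow> s \<in> Ad_sec U \<Longrightarrow> \<phi> U s \<in> twisted_sec U"
  using phi_bij by (rule bij_betw_apply)

lemma phi_surj: assumes "torus_open \<tau> U" "F \<in> twisted_sec U" shows "\<exists>s \<in> Ad_sec U. \<phi> U s = F"
proof -
  have "F \<in> \<phi> U ` Ad_sec U" using bij_betw_imp_surj_on[OF phi_bij[OF assms(1)]] assms(2) by simp
  then show ?thesis by blast
qed

lemma phi_inj: "torus_open \<tau> U \<Longrightarrow> s \<in> Ad_sec U \<Longrightarrow> t \<in> Ad_sec U \<Longrightarrow> \<phi> U s = \<phi> U t \<Longrightarrow> s = t"
  using bij_betw_imp_inj_on[OF phi_bij] by (auto dest: inj_onD)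

lemma phi_add:
  assumes "torus_open \<tau> U" "s \<in> Ad_sec U" "t \<in> Ad_sec U"
  shows "\<phi> U (\<lambda>i p. s i p + t i p) = (\<lambda>z. \<phi> U s z + \<phi> U t z)"
proof -
  have "\<phi> U (add_sec (Ad_sheaf \<tau> n P) s t) = add_sec (quotient_sheaf \<tau> n d) (\<phi> U s) (\<phi> U t)"
    using iso assms unfolding lie_sheaf_iso_def by blast
  then show ?thesis by (simp add: Ad_sheaf_def quotient_sheaf_def)
qed

lemma phi_smult:
  assumes "torus_open \<tau> U" "s \<in> Ad_sec U" "torus_holomorphic_on \<tau> f U"
  shows "\<phi> U (\<lambda>i p. f p \<cdot>\<^sub>m s i p) = (\<lambda>z. f (\<pi> z) \<cdot>\<^sub>m \<phi> U s z)"
proof -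
  have "\<phi> U (smult_sec (Ad_sheaf \<tau> n P) f s) = smult_sec (quotient_sheaf \<tau> n d) f (\<phi> U s)"
    using iso assms unfolding lie_sheaf_iso_def by blast
  then show ?thesis by (simp add: Ad_sheaf_def quotient_sheaf_def)
qed

lemma phi_restrict:
  assumes "torus_open \<tau> U" "torus_open \<tau> V" "V \<subseteq> U" "s \<in> Ad_sec U"
  shows "\<phi> V (\<lambda>i p. if p \<in> V then s i p else 0\<^sub>m n n) = (\<lambda>z. if \<pi> z \<in> V then \<phi> U s z else 0\<^sub>m n n)"
proof -
  have "\<phi> V (restriction (Ad_sheaf \<tau> n P) V s) = restriction (quotient_sheaf \<tau> n d) V (\<phi> U s)"
    using iso assms unfolding lie_sheaf_iso_def by blast
  then show ?thesis by (simp add: Ad_sheaf_def quotient_sheaf_def)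
qed

lemma coordinate_neighbourhood:
  assumes "torus_open \<tau> U" "\<pi> x \<in> U"
  shows "\<exists>f W i0. is_coordinate x f W \<and> W \<subseteq> U \<and> W \<subseteq> chart P i0"
proof -
  obtain f D where f: "is_coordinate x f D" using coordinate_exists by blast
  obtain i0 where i0: "\<pi> x \<in> chart P i0" using chart_cover by blast
  have "is_coordinate x f (D \<inter> (U \<inter> chart P i0))"
    using assms i0 by (intro is_coordinate_Int[OF f] torus_open_Int chart_open) auto
  then show ?thesis by blast
qed

text \<open>On both sides, vanishing at \<open>x\<close> means being divisible by a local
  coordinate, and \<open>\<phi>\<close> is linear over functions.\<close>

lemma phi_vanishes_iff:
  assumes f: "is_coordinate x f W" and Wc: "W \<subseteq> chart P i0" and u: "u \<in> Ad_sec W"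
  shows "\<phi> W u x = 0\<^sub>m n n \<longleftrightarrow> u i0 (\<pi> x) = 0\<^sub>m n n"
proof
  note W = is_coordinate_D(1,2)[OF f]
    and fx = iffD2[OF is_coordinate_D(5)[OF f is_coordinate_D(2)[OF f]] refl] and hol = is_coordinate_D(3)[OF f]
  have zero: "0 \<cdot>\<^sub>m A = 0\<^sub>m n n" if "A \<in> carrier_mat n n" for A :: "complex mat"
    using that by (intro eq_matI) auto
  {
    assume "u i0 (\<pi> x) = 0\<^sub>m n n"
    then obtain t where t: "t \<in> Ad_sec W" "u = (\<lambda>i p. f p \<cdot>\<^sub>m t i p)" using Ad_divide[OF f Wc u] by blast
    have "\<phi> W u x = f (\<pi> x) \<cdot>\<^sub>m \<phi> W t x" unfolding t(2) phi_smult[OF W(1) t(1) hol] ..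
    then show "\<phi> W u x = 0\<^sub>m n n" by (simp add: fx zero[OF twisted_carrier[OF phi_in[OF W(1) t(1)]]])
  }
  {
    assume "\<phi> W u x = 0\<^sub>m n n"
    then obtain T where T: "T \<in> twisted_sec W" "\<And>z. \<phi> W u z = f (\<pi> z) \<cdot>\<^sub>m T z"
      using twisted_divide[OF f phi_in[OF W(1) u]] by blast
    obtain t where t: "t \<in> Ad_sec W" "\<phi> W t = T" using phi_surj[OF W(1) T(1)] by blast
    have "\<phi> W u = \<phi> W (\<lambda>i p. f p \<cdot>\<^sub>m t i p)"
      unfolding phi_smult[OF W(1) t(1) hol] by (rule ext) (simp only: T(2) t(2))
    then have "u = (\<lambda>i p. f p \<cdot>\<^sub>m t i p)" by (rule phi_inj[OF W(1) u Ad_smult[OF t(1) hol]])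
    then have "u i0 (\<pi> x) = f (\<pi> x) \<cdot>\<^sub>m t i0 (\<pi> x)" by (rule fun_cong[THEN fun_cong])
    then show "u i0 (\<pi> x) = 0\<^sub>m n n" by (simp add: fx zero[OF Ad_carrier[OF t(1)]])
  }
qed

text \<open>The well-definedness and injectivity of the map on fibres induced by
  \<open>\<phi>\<close>, obtained by applying \<open>phi_vanishes_iff\<close> to a difference on
  a common small neighbourhood.\<close>

lemma phi_value_eq_iff:
  assumes U: "torus_open \<tau> U" "\<pi> x \<in> U" and s: "s \<in> Ad_sec U"
    and U': "torus_open \<tau> U'" "\<pi> x \<in> U'" and s': "s' \<in> Ad_sec U'"
  shows "\<phi> U s x = \<phi> U' s' x \<longleftrightarrow> ev_map \<tau> x s = ev_map \<tau> x s'"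
proof -
  have UU: "torus_open \<tau> (U \<inter> U')" "\<pi> x \<in> U \<inter> U'" using U U' torus_open_Int by auto
  obtain f W i0 where f: "is_coordinate x f W" and WU: "W \<subseteq> U \<inter> U'" and Wc: "W \<subseteq> chart P i0"
    using coordinate_neighbourhood[OF UU] by blast
  note W = is_coordinate_D(1,2)[OF f]
  have i0: "\<pi> x \<in> chart P i0" using W(2) Wc by blast
  have sub: "W \<subseteq> U" "W \<subseteq> U'" using WU by auto
  define r where "r = (\<lambda>i p. if p \<in> W then s i p else 0\<^sub>m n n)"
  define r' where "r' = (\<lambda>i p. if p \<in> W then s' i p else 0\<^sub>m n n)"
  have r: "r \<in> Ad_sec W" "r' \<in> Ad_sec W"
    unfolding r_def r'_def using Ad_restrict[OF s sub(1)] Ad_restrict[OF s' sub(2)] .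
  have const: "torus_holomorphic_on \<tau> (\<lambda>_. -1) W" by (simp add: torus_holomorphic_on_def)
  define u where "u = (\<lambda>i p. r i p + (-1) \<cdot>\<^sub>m r' i p)"
  have u: "u \<in> Ad_sec W" unfolding u_def by (rule Ad_add[OF r(1) Ad_smult[OF r(2) const]])
  have "\<phi> W u = (\<lambda>z. \<phi> W r z + (-1) \<cdot>\<^sub>m \<phi> W r' z)"
    unfolding u_def phi_add[OF W(1) r(1) Ad_smult[OF r(2) const]] phi_smult[OF W(1) r(2) const] ..
  moreover have "\<phi> W r x = \<phi> U s x" "\<phi> W r' x = \<phi> U' s' x"
    unfolding r_def r'_def phi_restrict[OF U(1) W(1) sub(1) s] phi_restrict[OF U'(1) W(1) sub(2) s'] using W(2) by simp_all
  ultimately have "\<phi> W u x = \<phi> U s x + (-1) \<cdot>\<^sub>m \<phi> U' s' x" by simp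
  then have "\<phi> U s x = \<phi> U' s' x \<longleftrightarrow> \<phi> W u x = 0\<^sub>m n n"
    by (simp only: minus_eq_zero_iff[OF twisted_carrier[OF phi_in[OF U(1) s]] twisted_carrier[OF phi_in[OF U'(1) s']]])
  also have "\<dots> \<longleftrightarrow> u i0 (\<pi> x) = 0\<^sub>m n n" by (rule phi_vanishes_iff[OF f Wc u])
  also have "u i0 (\<pi> x) = s i0 (\<pi> x) + (-1) \<cdot>\<^sub>m s' i0 (\<pi> x)" using W(2) by (simp add: u_def r_def r'_def)
  also have "\<dots> = 0\<^sub>m n n \<longleftrightarrow> s i0 (\<pi> x) = s' i0 (\<pi> x)"
    by (rule minus_eq_zero_iff[OF Ad_carrier[OF s] Ad_carrier[OF s']])
  also have "\<dots> \<longleftrightarrow> ev_map \<tau> x s = ev_map \<tau> x s'"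
  proof
    assume "s i0 (\<pi> x) = s' i0 (\<pi> x)"
    then show "ev_map \<tau> x s = ev_map \<tau> x s'"
      by (intro fibre_eqI[OF ev_in_fibre[OF s U(2)] ev_in_fibre[OF s' U'(2)] i0]) (simp only: ev_map_def)
  next
    assume "ev_map \<tau> x s = ev_map \<tau> x s'"
    from fun_cong[OF this, of i0] show "s i0 (\<pi> x) = s' i0 (\<pi> x)" by (simp only: ev_map_def)
  qed
  finally show ?thesis .
qed

abbreviation "triv \<equiv> trivialization \<tau> n P \<phi>"

lemma triv_ev:
  assumes U: "torus_open \<tau> U" "\<pi> x \<in> U" and s: "s \<in> Ad_sec U"
  shows "triv x (ev_map \<tau> x s) = \<phi> U s x"
  unfolding trivialization_def
proof (rule the_equality)
  show "\<exists>U' s'. torus_open \<tau> U' \<and> \<pi> x \<in> U' \<and> s' \<in> Ad_sec U' \<and> ev_map \<tau> x s' = ev_map \<tau> x s \<and> \<phi> U s x = \<phi> U' s' x"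
    using U s by blast
  fix G assume "\<exists>U' s'. torus_open \<tau> U' \<and> \<pi> x \<in> U' \<and> s' \<in> Ad_sec U' \<and> ev_map \<tau> x s' = ev_map \<tau> x s \<and> G = \<phi> U' s' x"
  then obtain U' s' where U': "torus_open \<tau> U'" "\<pi> x \<in> U'" "s' \<in> Ad_sec U'" "ev_map \<tau> x s' = ev_map \<tau> x s" "G = \<phi> U' s' x"
    by blast
  then show "G = \<phi> U s x" using phi_value_eq_iff[OF U'(1,2,3) U s] by simp
qed

lemma triv_inj:
  assumes v: "v \<in> Ad_fibre n P (\<pi> x)" and w: "w \<in> Ad_fibre n P (\<pi> x)" and eq: "triv x v = triv x w"
  shows "v = w"
proof -
  obtain U s where s: "torus_open \<tau> U" "\<pi> x \<in> U" "s \<in> Ad_sec U" "ev_map \<tau> x s = v"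
    using fibre_extends[OF v] by blast
  obtain U' s' where s': "torus_open \<tau> U'" "\<pi> x \<in> U'" "s' \<in> Ad_sec U'" "ev_map \<tau> x s' = w"
    using fibre_extends[OF w] by blast
  have "\<phi> U s x = \<phi> U' s' x" using eq triv_ev[OF s(1,2,3)] triv_ev[OF s'(1,2,3)] s(4) s'(4) by simp
  then show ?thesis using phi_value_eq_iff[OF s(1,2,3) s'(1,2,3)] s(4) s'(4) by simp
qed

section \<open>Residues and the tensor of the bundle\<close>

text \<open>Near \<open>x\<close>, the section \<open>s\<close> is \<open>t / (z - x)\<close> in
  every chart.\<close>

lemma residue_of_product:
  assumes f: "is_coordinate x f W" and s: "s \<in> Ad_sec (torus \<tau> - {\<pi> x})" and t: "t \<in> Ad_sec W"
    and eq: "\<And>i p. p \<in> W - {\<pi> x} \<Longrightarrow> t i p = f p \<cdot>\<^sub>m s i p"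
  shows "s \<in> H0_Ad \<tau> n P x" "res_map \<tau> n P x s = ev_map \<tau> x t"
proof -
  note W = is_coordinate_D(1,2)[OF f]
    and ev = is_coordinate_D(6)[OF f]
  have quot: "\<forall>\<^sub>F z in at x. s i (\<pi> z) $$ (a, b) = t i (\<pi> z) $$ (a, b) / (z - x)" if "a < n" "b < n" for i a b
  proof -
    from ev eventually_in_punctured[OF W(1) refl W(2)] eventually_neq_at_within[of x x UNIV] show ?thesis
    proof eventually_elim
      case (elim z)
      then show ?case using eq[of "\<pi> z" i] that carrier_matD[OF Ad_carrier[OF s, of i "\<pi> z"]] by simp
    qed
  qed
  have an: "(\<lambda>z. t i (\<pi> z) $$ (a, b)) analytic_on {x}" if "\<pi> x \<in> chart P i" "a < n" "b < n" for i a b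
    by (rule Ad_analytic[OF W(1) t W(2) that])
  show "s \<in> H0_Ad \<tau> n P x"
    unfolding H0_Ad_def mem_Collect_eq at_most_simple_pole_def
    using s an quot by blast
  show "res_map \<tau> n P x s = ev_map \<tau> x t"
  proof
    fix i
    show "res_map \<tau> n P x s i = ev_map \<tau> x t i"
    proof (cases "\<pi> x \<in> chart P i")
      case False
      then show ?thesis using Ad_D(2)[OF t, of "\<pi> x" i] by (simp add: res_map_def ev_map_def)
    next
      case True
      have "residue (\<lambda>z. s i (\<pi> z) $$ (a, b)) x = t i (\<pi> x) $$ (a, b)" if ab: "a < n" "b < n" for a b
      proof -
        obtain S where S: "open S" "x \<in> S" "(\<lambda>z. t i (\<pi> z) $$ (a, b)) holomorphic_on S"
          using an[OF True ab] analytic_at by blast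
        have "residue (\<lambda>z. s i (\<pi> z) $$ (a, b)) x = residue (\<lambda>z. t i (\<pi> z) $$ (a, b) / (z - x)) x"
          by (rule residue_cong[OF quot[OF ab] refl])
        also have "\<dots> = t i (\<pi> x) $$ (a, b)" by (rule residue_simple[OF S])
        finally show ?thesis .
      qed
      then show ?thesis
        using True carrier_matD[OF Ad_carrier[OF t, of i "\<pi> x"]] by (auto simp: res_map_def ev_map_def intro!: eq_matI)
    qed
  qed
qed

lemma H0_Ad_product:
  assumes f: "is_coordinate x f W" and Wc: "W \<subseteq> chart P i0" and s: "s \<in> H0_Ad \<tau> n P x"
  shows "\<exists>t \<in> Ad_sec W. \<forall>i. \<forall>p \<in> W - {\<pi> x}. t i p = f p \<cdot>\<^sub>m s i p"
proof -
  note W = is_coordinate_D(1,2)[OF f] and hol = is_coordinate_D(3)[OF f]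
    and ev = is_coordinate_D(6)[OF f]
  have sA: "s \<in> Ad_sec (torus \<tau> - {\<pi> x})"
    and pole: "\<And>i a b. \<pi> x \<in> chart P i \<Longrightarrow> a < n \<Longrightarrow> b < n \<Longrightarrow> at_most_simple_pole (\<lambda>z. s i (\<pi> z) $$ (a, b)) x"
    using s unfolding H0_Ad_def by blast+
  have sub: "W - {\<pi> x} \<subseteq> torus \<tau> - {\<pi> x}" using W(1) by (auto simp: torus_open_def)
  note hol' = is_coordinate_D(4)[OF f]
  define u where "u = (\<lambda>i p. f p \<cdot>\<^sub>m (if p \<in> W - {\<pi> x} then s i p else 0\<^sub>m n n))"
  have u: "u \<in> Ad_sec (W - {\<pi> x})" unfolding u_def by (rule Ad_smult[OF Ad_restrict[OF sA sub] hol'])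
  have i0: "\<pi> x \<in> chart P i0" using W(2) Wc by blast
  obtain h where h: "\<And>a b. a < n \<Longrightarrow> b < n \<Longrightarrow> h a b analytic_on {x}"
    "\<And>a b. a < n \<Longrightarrow> b < n \<Longrightarrow> \<forall>\<^sub>F z in at x. s i0 (\<pi> z) $$ (a, b) = h a b z / (z - x)"
    using pole[OF i0] unfolding at_most_simple_pole_def by metis
  have "\<forall>\<^sub>F z in at x. u i0 (\<pi> z) $$ (a, b) = h a b z" if ab: "a < n" "b < n" for a b
  proof -
    from ev h(2)[OF ab] eventually_in_punctured[OF W(1) refl W(2)] eventually_neq_at_within[of x x UNIV] show ?thesis
    proof eventually_elim
      case (elim z)
      then show ?case using ab carrier_matD[OF Ad_carrier[OF sA, of i0 "\<pi> z"]] by (simp add: u_def)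
    qed
  qed
  from Ad_removable_singularity[OF W Wc u h(1) this] obtain t where
    t: "t \<in> Ad_sec W" "\<And>i p. p \<noteq> \<pi> x \<Longrightarrow> t i p = u i p" by blast
  have "t i p = f p \<cdot>\<^sub>m s i p" if "p \<in> W - {\<pi> x}" for i p
    using that t(2)[of p i] by (simp add: u_def)
  then show ?thesis using t(1) by blast
qed

text \<open>\<open>\<phi>\<close> commutes with multiplying a pole away. With
  \<open>residue_of_product\<close> this identifies residues on both sides, although
  \<open>\<phi>\<close> is not defined on sections with poles.\<close>

lemma phi_product_iff:
  assumes f: "is_coordinate x f W" and s: "s \<in> Ad_sec (torus \<tau> - {\<pi> x})" and t: "t \<in> Ad_sec W"
  shows "(\<forall>i. \<forall>p \<in> W - {\<pi> x}. t i p = f p \<cdot>\<^sub>m s i p) \<longleftrightarrow>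
    (\<forall>z. \<pi> z \<in> W - {\<pi> x} \<longrightarrow> \<phi> W t z = f (\<pi> z) \<cdot>\<^sub>m \<phi> (torus \<tau> - {\<pi> x}) s z)"
proof -
  let ?V = "W - {\<pi> x}" and ?U = "torus \<tau> - {\<pi> x}"
  note W = is_coordinate_D(1,2)[OF f] and hol = is_coordinate_D(3)[OF f]
  have U: "torus_open \<tau> ?U" and V: "torus_open \<tau> ?V"
    by (intro torus_open_minus torus_open_torus W)+
  have sub: "?V \<subseteq> ?U" using W(1) by (auto simp: torus_open_def)
  have subW: "?V \<subseteq> W" by blast
  note hol' = is_coordinate_D(4)[OF f]
  define a where "a = (\<lambda>i p. if p \<in> ?V then t i p else 0\<^sub>m n n)"
  define b where "b = (\<lambda>i p. if p \<in> ?V then s i p else 0\<^sub>m n n)"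
  have a: "a \<in> Ad_sec ?V" and b: "b \<in> Ad_sec ?V"
    unfolding a_def b_def using Ad_restrict[OF t subW] Ad_restrict[OF s sub] .
  have fb: "(\<lambda>i p. f p \<cdot>\<^sub>m b i p) \<in> Ad_sec ?V" by (rule Ad_smult[OF b hol'])
  have zero: "c \<cdot>\<^sub>m 0\<^sub>m n n = 0\<^sub>m n n" for c :: complex by (intro eq_matI) auto
  have "(\<forall>i. \<forall>p \<in> ?V. t i p = f p \<cdot>\<^sub>m s i p) \<longleftrightarrow> a = (\<lambda>i p. f p \<cdot>\<^sub>m b i p)"
    unfolding fun_eq_iff a_def b_def by (auto simp: zero)
  also have "\<dots> \<longleftrightarrow> \<phi> ?V a = \<phi> ?V (\<lambda>i p. f p \<cdot>\<^sub>m b i p)"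
    using phi_inj[OF V a fb] by auto
  also have "\<phi> ?V (\<lambda>i p. f p \<cdot>\<^sub>m b i p) = (\<lambda>z. f (\<pi> z) \<cdot>\<^sub>m (if \<pi> z \<in> ?V then \<phi> ?U s z else 0\<^sub>m n n))"
    unfolding phi_smult[OF V b hol'] unfolding b_def phi_restrict[OF U V sub s] ..
  also have "\<phi> ?V a = (\<lambda>z. if \<pi> z \<in> ?V then \<phi> W t z else 0\<^sub>m n n)"
    unfolding a_def by (rule phi_restrict[OF W(1) V subW t])
  also have "\<dots> = (\<lambda>z. f (\<pi> z) \<cdot>\<^sub>m (if \<pi> z \<in> ?V then \<phi> ?U s z else 0\<^sub>m n n)) \<longleftrightarrow>
      (\<forall>z. \<pi> z \<in> ?V \<longrightarrow> \<phi> W t z = f (\<pi> z) \<cdot>\<^sub>m \<phi> ?U s z)"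
    unfolding fun_eq_iff by (auto simp: zero)
  finally show ?thesis .
qed

text \<open>Pull the kernel back to a section of \<open>Ad\<close> with a pole at
  \<open>x\<close>. It shows that the residue \<open>v\<close> prescribed by \<open>c\<close> is
  attained. The section with residue \<open>v\<close> selected by \<open>res_inverse\<close>
  need not be this one a priori, but its image under \<open>\<phi>\<close> also has residue
  \<open>c\<close> and so equals the kernel.\<close>

lemma r_endo_eq_kernel:
  assumes c: "c \<in> sl n" and xy: "\<pi> y \<noteq> \<pi> x"
  shows "r_endo \<tau> n P \<phi> x y c = kernel x c y"
proof -
  let ?U = "torus \<tau> - {\<pi> x}"
  have U: "torus_open \<tau> ?U" by (intro torus_open_minus torus_open_torus)
  obtain f W i0 where f: "is_coordinate x f W" and Wc: "W \<subseteq> chart P i0"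
    using coordinate_neighbourhood[OF torus_open_torus tproj_in_torus] by blast
  note W = is_coordinate_D(1,2)[OF f]
  obtain T where T: "T \<in> twisted_sec W" "T x = c" "\<And>z. \<pi> z \<in> W - {\<pi> x} \<Longrightarrow> T z = f (\<pi> z) \<cdot>\<^sub>m kernel x c z"
    using kernel_residue[OF f c] by blast
  obtain t where t: "t \<in> Ad_sec W" "\<phi> W t = T" using phi_surj[OF W(1) T(1)] by blast
  obtain s0 where s0: "s0 \<in> Ad_sec ?U" "\<phi> ?U s0 = kernel x c" using phi_surj[OF U kernel_twisted] by blast
  have "\<forall>i. \<forall>p \<in> W - {\<pi> x}. t i p = f p \<cdot>\<^sub>m s0 i p"
    unfolding phi_product_iff[OF f s0(1) t(1)] t(2) s0(2) using T(3) by blast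
  then have s0H: "s0 \<in> H0_Ad \<tau> n P x" "res_map \<tau> n P x s0 = ev_map \<tau> x t"
    using residue_of_product[OF f s0(1) t(1)] by blast+
  have tv: "triv x (ev_map \<tau> x t) = c" using triv_ev[OF W t(1)] t(2) T(2) by simp
  define v where "v = inv_into (Ad_fibre n P (\<pi> x)) (triv x) c"
  have "c \<in> triv x ` Ad_fibre n P (\<pi> x)"
    using tv ev_in_fibre[OF t(1) W(2)] by (intro image_eqI[of _ _ "ev_map \<tau> x t"]) simp_all
  then have "v \<in> Ad_fibre n P (\<pi> x)" "triv x v = c"
    unfolding v_def by (rule inv_into_into, rule f_inv_into_f)
  then have v: "v = ev_map \<tau> x t"
    using tv by (intro triv_inj[OF _ ev_in_fibre[OF t(1) W(2)]]) simp_all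
  define s where "s = res_inverse \<tau> n P x v"
  have "v \<in> res_map \<tau> n P x ` H0_Ad \<tau> n P x" unfolding v using s0H by (intro image_eqI[of _ _ s0]) simp_all
  then have s: "s \<in> H0_Ad \<tau> n P x" "res_map \<tau> n P x s = v"
    unfolding s_def res_inverse_def by (rule inv_into_into, rule f_inv_into_f)
  have sA: "s \<in> Ad_sec ?U" using s(1) by (simp add: H0_Ad_def)
  obtain t1 where t1: "t1 \<in> Ad_sec W" "\<forall>i. \<forall>p \<in> W - {\<pi> x}. t1 i p = f p \<cdot>\<^sub>m s i p"
    using H0_Ad_product[OF f Wc s(1)] by blast
  have "ev_map \<tau> x t1 = v"
    using residue_of_product(2)[OF f sA t1(1)] t1(2) s(2) by auto
  then have "\<phi> W t1 x = T x"
    using phi_value_eq_iff[OF W t1(1) W t(1)] v t(2) by simp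
  moreover have "\<phi> W t1 z = f (\<pi> z) \<cdot>\<^sub>m \<phi> ?U s z" if "\<pi> z \<in> W - {\<pi> x}" for z
    using t1(2) that unfolding phi_product_iff[OF f sA t1(1)] by blast
  ultimately have "\<phi> ?U s = kernel x c"
    by (intro twisted_residue_unique[OF f phi_in[OF U sA] kernel_twisted phi_in[OF W(1) t1(1)] _ T(1,3)])
  moreover have "triv y (ev_map \<tau> y s) = \<phi> ?U s y"
    using xy by (intro triv_ev[OF U _ sA]) simp
  ultimately show ?thesis unfolding r_endo_def v_def[symmetric] s_def[symmetric] by simp
qed

lemma belavin_in_sl_tensor_sl: "belavin_r_matrix \<tau> n d x y \<in> sl_tensor_sl n"
proof -
  have "belavin_r_matrix \<tau> n d x y = mat_sum (n * n)
      (\<lambda>kl. tensor n (belavin_coeff (fst kl) (snd kl) (y - x) \<cdot>\<^sub>m Z_dual n d (fst kl) (snd kl)) (Z_mat n d (fst kl) (snd kl))) (I_set n)"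
    unfolding belavin_r_matrix_def tensor_smult_left[OF Z_carrier(2)] belavin_coeff_def case_prod_beta ..
  also have "\<dots> \<in> sl_tensor_sl n"
    by (intro mat_sum_tensor_in_sl_tensor_sl smult_sl Z_in_sl) (simp_all add: I_set_eq)
  finally show ?thesis .
qed

lemma tensor_to_End_belavin:
  assumes c: "c \<in> carrier_mat n n" and xy: "\<pi> y \<noteq> \<pi> x"
  shows "tensor_to_End n (belavin_r_matrix \<tau> n d x y) c = kernel x c y"
proof -
  have "tensor_to_End n (a \<cdot>\<^sub>m tensor n (Z_dual n d k l) (Z_mat n d k l)) c =
      (a * mtrace (Z_dual n d k l * c)) \<cdot>\<^sub>m Z_mat n d k l" for a k l
    unfolding tensor_to_End_smult[OF tensor_carrier] tensor_to_End_tensor[OF Z_carrier(2) Z_carrier(1) c]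
    by (rule eq_matI) simp_all
  then show ?thesis
    using xy unfolding belavin_r_matrix_def tensor_to_End_mat_sum kernel_def belavin_coeff_def case_prod_unfold
    by simp
qed

lemma r_matrix_eq_belavin:
  assumes xy: "\<pi> y \<noteq> \<pi> x"
  shows "r_matrix \<tau> n P \<phi> x y = belavin_r_matrix \<tau> n d x y"
  unfolding r_matrix_def
proof (rule the_equality)
  have eq: "tensor_to_End n (belavin_r_matrix \<tau> n d x y) c = r_endo \<tau> n P \<phi> x y c" if "c \<in> sl n" for c
    using tensor_to_End_belavin[OF slD(1)[OF that] xy] r_endo_eq_kernel[OF that xy] by simp
  then show "belavin_r_matrix \<tau> n d x y \<in> sl_tensor_sl n \<and>
      (\<forall>c\<in>sl n. tensor_to_End n (belavin_r_matrix \<tau> n d x y) c = r_endo \<tau> n P \<phi> x y c)"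
    using belavin_in_sl_tensor_sl by blast
  fix T assume T: "T \<in> sl_tensor_sl n \<and> (\<forall>c\<in>sl n. tensor_to_End n T c = r_endo \<tau> n P \<phi> x y c)"
  show "T = belavin_r_matrix \<tau> n d x y"
  proof (rule sl_tensor_sl_eqI[OF n _ belavin_in_sl_tensor_sl])
    show "T \<in> sl_tensor_sl n" using T by blast
    fix c assume "c \<in> sl n"
    then show "tensor_to_End n T c = tensor_to_End n (belavin_r_matrix \<tau> n d x y) c" using T eq by simp
  qed
qed

end

theorem theoremB:
  fixes \<tau> x y :: complex and n d :: nat
    and P :: "'i vbundle"
    and \<phi> :: "tpoint set \<Rightarrow> ('i \<Rightarrow> tpoint \<Rightarrow> complex mat) \<Rightarrow> complex \<Rightarrow> complex mat"
    and V :: "complex set"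
  assumes "Im \<tau> > 0"
    and "0 < d" and "d < n" and "coprime d n"
    and "vector_bundle \<tau> n P"
    and "simple_bundle \<tau> n P"
    and "bundle_degree \<tau> P = int d"
    and "lie_sheaf_iso \<tau> (Ad_sheaf \<tau> n P) (quotient_sheaf \<tau> n d) \<phi>"
    and "open V" and "0 \<in> V" and "inj_on (tproj \<tau>) V"
    and "x \<in> V" and "y \<in> V" and "x \<noteq> y"
  shows "(let z = y - x in
      r_matrix \<tau> n P \<phi> x y = mat_sum (n * n)
        (\<lambda>(k, l). (exp (- (2 * of_real pi * \<i> * of_nat d / of_nat n) * of_nat k * z) *
            kronecker_sigma \<tau> (of_nat d / of_nat n * (of_nat l - of_nat k * \<tau>)) z)
          \<cdot>\<^sub>m tensor n (Z_dual n d k l) (Z_mat n d k l))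
        (I_set n))
    \<and> r_matrix \<tau> n P \<phi> x y = belavin_r_matrix \<tau> n d x y"
proof -
  interpret trivialized_bundle \<tau> n d P \<phi>
    by unfold_locales (use assms in auto)
  have "\<pi> y \<noteq> \<pi> x"
    using assms by (auto dest: inj_onD)
  then have "r_matrix \<tau> n P \<phi> x y = belavin_r_matrix \<tau> n d x y"
    by (rule r_matrix_eq_belavin)
  then show ?thesis by (simp add: belavin_r_matrix_def Let_def)
qed

end
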